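(* Let $k$ be a positive integer and let $D$ be a digraph of order $n$, where $n \ge 12k+3$. If $d_{D}^{+}(u) + d_{D}^{-}(v) \ge n$ for every two distinct vertices $u$ and $v$ of $D$ with $(u,v) \notin A(D)$, then $D$ has a directed $2$-factor consisting of exactly $k$ directed cycles, each of length at least $3$.
   Context: A digraph is finite, without loops or multiple arcs (a pair of opposite arcs $(u,v),(v,u)$ is allowed). $A(D)$ is the arc set, $d_D^+(v)$ and $d_D^-(v)$ are the out-degree and in-degree of $v$. A directed $2$-factor of $D$ is a spanning subdigraph in which every component is a directed cycle. *)

theory Defs
  imports Main
begin

definition digraph :: "'a set \<Rightarrow> ('a \<times> 'a) set \<Rightarrow> bool" where
  "digraph V A \<longleftrightarrow> finite V \<and> A \<subseteq> V \<times> V \<and> (\<forall>v. (v, v) \<notin> A)"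

definition out_deg :: "('a \<times> 'a) set \<Rightarrow> 'a \<Rightarrow> nat" where
  "out_deg A u = card {w. (u, w) \<in> A}"

definition in_deg :: "('a \<times> 'a) set \<Rightarrow> 'a \<Rightarrow> nat" where
  "in_deg A v = card {w. (w, v) \<in> A}"

definition dcycle :: "('a \<times> 'a) set \<Rightarrow> 'a list \<Rightarrow> bool" where
  "dcycle A c \<longleftrightarrow> length c \<ge> 2 \<and> distinct c \<and>
     (\<forall>i < length c. (c ! i, c ! ((i + 1) mod length c)) \<in> A)"

definition dir_2factor :: "'a set \<Rightarrow> ('a \<times> 'a) set \<Rightarrow> 'a list list \<Rightarrow> bool" where
  "dir_2factor V A Cs \<longleftrightarrow>
     (\<forall>c \<in> set Cs. dcycle A c) \<and>
     (\<forall>i < length Cs. \<forall>j < length Cs. i \<noteq> j \<longrightarrow> set (Cs ! i) \<inter> set (Cs ! j) = {}) \<and>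
     (\<Union>c \<in> set Cs. set c) = V"

end

theory Submission
  imports Defs
begin

text \<open>Among all families of \<open>k\<close> disjoint cycles of length at least three, take one whose uncovered set \<open>H\<close> is
  minimal. If \<open>H\<close> is not empty, comparing degree sums shows that no path inside \<open>H\<close> can be inserted into a
  cycle, that \<open>H\<close> is strongly connected, and that no cycle both sends an arc to \<open>H\<close> and receives one at two
  distinct vertices: otherwise the gap between two such vertices could be inserted elsewhere as a whole.

  If \<open>H\<close> has at least three vertices, it inherits the degree condition and is itself Hamiltonian. Every
  cycle then only sends to \<open>H\<close> or only receives from \<open>H\<close>; chords of a cycle split off parts that can be merged through
  \<open>H\<close>, which forces all cycles to have at most six vertices. Then \<open>H\<close> is so large that two of the
  cycles can be replaced by one cycle through both and \<open>H\<close> and a second cycle inside \<open>H\<close>.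

  One or two uncovered vertices are only possible for vertices of total degree below \<open>n\<close> and for
  digons all of whose other adjacencies are one-way and equal. To avoid these, start from \<open>k - 1\<close> short cycles
  disjoint from a short cycle through a vertex of least in-degree and a vertex of least out-degree.
  Such a packing exists because, after a packing of greatest size, the remaining digraph has no directed
  triangles and four-cycles and is therefore too sparse for the degree condition.\<close>
section \<open>Paths, cycles and degrees\<close>

text \<open>The basic move: a path fits between consecutive vertices of a cycle \<open>S\<close>
  once its first vertex receives and its last vertex sends more than \<open>card S\<close> arcs from
  and to \<open>S\<close> in total. The obstacle is that minimality must serve two purposes. An
  exchange may have to move a part of a cycle that has no neighbours in \<open>H\<close>, whereas
  the vertices \<open>a\<close> of least in-degree and \<open>b\<close> of least out-degree must
  stay on a common cycle as long as they are adjacent to \<open>H\<close>. Therefore only the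
  \<open>H\<close>-neighbours of one distinguished cycle are protected. They matter because an
  uncovered vertex of total degree below \<open>n\<close> would have to send to \<open>a\<close> and
  receive from \<open>b\<close>. The exchange with \<open>k = 1\<close> already proves Woodall's
  Hamiltonian theorem, which is then applied to \<open>H\<close>. The bound
  \<open>12 * k + 3\<close> enters twice: cycles of at most six vertices leave at least
  \<open>6 * k + 3\<close> vertices in \<open>H\<close>, and a packing of
  \<open>s \<le> k - 2\<close> cycles of at most four vertices leaves at least
  \<open>8 * s + 23\<close>.\<close>

text \<open>In-degrees are written \<open>od (A\<inverse>)\<close>, so that every statement can be dualised by reversing all arcs.\<close>
definition od :: "('a \<times> 'a) set \<Rightarrow> 'a set \<Rightarrow> 'a \<Rightarrow> nat" where
  "od A X u = card {w \<in> X. (u, w) \<in> A}"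

definition pth :: "('a \<times> 'a) set \<Rightarrow> 'a list \<Rightarrow> bool" where
  "pth A xs \<longleftrightarrow> xs \<noteq> [] \<and> distinct xs \<and> successively (\<lambda>x y. (x, y) \<in> A) xs"

definition cyc :: "('a \<times> 'a) set \<Rightarrow> 'a list \<Rightarrow> bool" where
  "cyc A c \<longleftrightarrow> 3 \<le> length c \<and> pth A c \<and> (last c, hd c) \<in> A"

definition cyclable :: "('a \<times> 'a) set \<Rightarrow> 'a set \<Rightarrow> bool" where
  "cyclable A S \<longleftrightarrow> (\<exists>c. cyc A c \<and> set c = S)"

lemma pth_append:
  assumes "xs \<noteq> []" "ys \<noteq> []"
  shows "pth A (xs @ ys) \<longleftrightarrow>
    pth A xs \<and> pth A ys \<and> set xs \<inter> set ys = {} \<and> (last xs, hd ys) \<in> A"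
  using assms by (auto simp: pth_def successively_append_iff)

lemma pth_single [simp]: "pth A [x]"
  by (simp add: pth_def)

lemma pth_Cons:
  assumes "ys \<noteq> []"
  shows "pth A (x # ys) \<longleftrightarrow> pth A ys \<and> x \<notin> set ys \<and> (x, hd ys) \<in> A"
  using pth_append[of "[x]" ys A] assms by auto

lemma pth_converse: "pth (A\<inverse>) xs \<longleftrightarrow> pth A (rev xs)"
  by (simp add: pth_def successively_rev)

lemma cyc_converse: "cyc (A\<inverse>) xs \<longleftrightarrow> cyc A (rev xs)"
  by (auto simp: cyc_def pth_converse hd_rev last_rev)

lemma cyclable_converse [simp]: "cyclable (A\<inverse>) S \<longleftrightarrow> cyclable A S"
  unfolding cyclable_def cyc_converse by (metis rev_rev_ident set_rev)

lemma cyc_rotate: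
  assumes "cyc A (xs @ ys)"
  shows "cyc A (ys @ xs)"
proof (cases "xs = [] \<or> ys = []")
  case False
  then show ?thesis using assms
    by (auto simp: cyc_def pth_append)
qed (use assms in auto)

lemma cyc_hdE:
  assumes "cyc A c" "x \<in> set c"
  obtains c' where "cyc A (x # c')" "set (x # c') = set c"
proof -
  obtain us vs where c: "c = us @ x # vs" using assms(2) by (meson split_list)
  then have "cyc A ((x # vs) @ us)" using assms(1) cyc_rotate by blast
  then show thesis using that[of "vs @ us"] c by auto
qed

lemma cyc_lastE:
  assumes "cyc A c" "x \<in> set c"
  obtains c' where "cyc A (c' @ [x])" "set (c' @ [x]) = set c"
proof -
  obtain us vs where c: "c = us @ x # vs" using assms(2) by (meson split_list)
  then have "cyc A (vs @ (us @ [x]))" using assms(1) cyc_rotate[of A "us @ [x]" vs] by simp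
  then show thesis using that[of "vs @ us"] c by auto
qed

lemma cyc_distinct: "cyc A c \<Longrightarrow> distinct c"
  by (simp add: cyc_def pth_def)

lemma cyc_card: "cyc A c \<Longrightarrow> card (set c) = length c"
  using cyc_distinct distinct_card by blast

lemma cyclable_finite: "cyclable A S \<Longrightarrow> finite S"
  by (auto simp: cyclable_def)

lemma cyclable_card: "cyclable A S \<Longrightarrow> 3 \<le> card S"
  unfolding cyclable_def using cyc_card by (fastforce simp: cyc_def)

lemma cyclable_ne: "cyclable A S \<Longrightarrow> S \<noteq> {}"
  using cyclable_card by fastforce

lemma cyclableI: "cyc A c \<Longrightarrow> cyclable A (set c)"
  by (auto simp: cyclable_def)

section \<open>Consecutive pairs on paths and cycles\<close>

lemma successively_if_splits:
  assumes "\<And>us x y vs. xs = us @ x # y # vs \<Longrightarrow> R x y"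
  shows "successively R xs"
  using assms
proof (induction xs)
  case (Cons a xs)
  have "successively R xs"
  proof (rule Cons.IH)
    fix us x y vs assume "xs = us @ x # y # vs"
    then show "R x y" using Cons.prems[of "a # us"] by simp
  qed
  moreover have "xs \<noteq> [] \<Longrightarrow> R a (hd xs)"
    using Cons.prems[of "[]" a "hd xs" "tl xs"] by simp
  ultimately show ?case by (auto simp: successively_Cons)
qed simp

text \<open>Each \<open>P\<close> entry but the last forbids \<open>Q\<close> at its successor, so
  the consecutive pairs account for at most \<open>length xs - 1\<close>. Of the two end terms,
  \<open>P (last xs)\<close> is estimated by one and \<open>Q (hd xs)\<close> is kept exact for the
  cyclic version.\<close>

lemma path_count:
  assumes "successively (\<lambda>x y. \<not> (P x \<and> Q y)) xs" "xs \<noteq> []"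
  shows "length (filter P xs) + length (filter Q xs) \<le> length xs + (if Q (hd xs) then 1 else 0)"
  using assms by (induction xs rule: induct_list012) (auto split: if_splits)

lemma path_count':
  assumes "successively (\<lambda>x y. \<not> (P x \<and> Q y)) xs" "xs \<noteq> []"
  shows "length (filter P xs) + length (filter Q xs) \<le> length xs + (if P (last xs) then 1 else 0)"
  using path_count[of Q P "rev xs"] assms
  by (simp add: successively_rev rev_filter[symmetric] hd_rev add.commute conj_commute)

lemma filter_card: "distinct xs \<Longrightarrow> length (filter P xs) = card {x \<in> set xs. P x}"
  by (metis distinct_card distinct_filter set_filter)

lemma path_cross:
  assumes "distinct xs" "xs \<noteq> []" 
    and "card {x \<in> set xs. P x} + card {x \<in> set xs. Q x} > length xs + 1"
  obtains us vs where "xs = us @ vs" "us \<noteq> []" "vs \<noteq> []" "P (last us)" "Q (hd vs)"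
proof -
  have "\<not> successively (\<lambda>x y. \<not> (P x \<and> Q y)) xs"
    using path_count[of P Q xs] assms filter_card[of xs] by (auto split: if_splits)
  then obtain us x y vs where "xs = us @ x # y # vs" "P x \<and> Q y"
    using successively_if_splits[of xs "\<lambda>x y. \<not> (P x \<and> Q y)"] by blast
  then show thesis using that[of "us @ [x]" "y # vs"] by simp
qed

text \<open>On a cycle the pair from last to first counts as well, which lowers the threshold by one
  compared with \<open>path_cross\<close>: if that pair fails, one of the two end corrections
  vanishes.\<close>

lemma cyc_cross:
  assumes "cyc A c" 
    and "card {x \<in> set c. P x} + card {x \<in> set c. Q x} > card (set c)"
  obtains c' where "cyc A c'" "set c' = set c" "P (last c')" "Q (hd c')"
proof (cases "P (last c) \<and> Q (hd c)")
  case True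
  then show thesis using that assms(1) by blast
next
  case False
  have c: "distinct c" "c \<noteq> []" "card (set c) = length c"
    using assms(1) by (auto simp: cyc_def pth_def distinct_card)
  have "\<not> successively (\<lambda>x y. \<not> (P x \<and> Q y)) c"
    using path_count[of P Q c] path_count'[of P Q c] False assms filter_card[of c] c by (auto split: if_splits)
  then obtain us x y vs where e: "c = us @ x # y # vs" "P x \<and> Q y"
    using successively_if_splits[of c "\<lambda>x y. \<not> (P x \<and> Q y)"] by blast
  then have "cyc A ((y # vs) @ (us @ [x]))" using cyc_rotate[of A "us @ [x]" "y # vs"] assms(1) by simp
  then show thesis using that e by fastforce
qed

text \<open>A shortest complementary segment \<open>Sg\<close> works: a \<open>P\<close> vertex in
  it would extend \<open>Pi\<close> at its end, a \<open>Q\<close> vertex at its beginning.\<close>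

lemma cyc_cross_pair:
  assumes "cyc A c" "P a" "Q b" "a \<in> set c" "b \<in> set c" "a \<noteq> b"
  obtains Pi Sg where "cyc A (Pi @ Sg)" "set (Pi @ Sg) = set c" "2 \<le> length Pi"
    "Q (hd Pi)" "P (last Pi)" "\<forall>x \<in> set Sg. \<not> P x \<and> \<not> Q x"
proof -
  define G where "G = (\<lambda>Pi Sg. cyc A (Pi @ Sg) \<and> set (Pi @ Sg) = set c \<and> 2 \<le> length Pi \<and>
    Q (hd Pi) \<and> P (last Pi))"
  have "\<exists>Pi Sg. G Pi Sg"
  proof -
    obtain d where d: "cyc A (b # d)" "set (b # d) = set c" using cyc_hdE assms by metis
    then have "a \<in> set d" using assms by auto
    then obtain us vs where "d = us @ a # vs" by (meson split_list)
    then have "G (b # us @ [a]) vs" using d assms unfolding G_def by auto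
    then show ?thesis by blast
  qed
  then obtain Pi Sg where g: "G Pi Sg" and min: "\<And>Pi' Sg'. G Pi' Sg' \<Longrightarrow> length Sg \<le> length Sg'"
    using ex_has_least_nat[of "\<lambda>p. G (fst p) (snd p)" _ "\<lambda>p. length (snd p)"]
    by fastforce
  have "\<not> P z \<and> \<not> Q z" if z: "z \<in> set Sg" for z
  proof -
    obtain us vs where s: "Sg = us @ z # vs" using z by (meson split_list)
    have "\<not> P z"
    proof
      assume "P z"
      then have "G (Pi @ us @ [z]) vs" using g s unfolding G_def by (auto simp: hd_append)
      then show False using min s by fastforce
    qed
    moreover have "\<not> Q z"
    proof
      assume "Q z"
      have "cyc A ((z # vs) @ Pi @ us)" using cyc_rotate[of A "Pi @ us" "z # vs"] g s
        unfolding G_def by simp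
      then have "G (z # vs @ Pi) us" using g s \<open>Q z\<close> unfolding G_def by (auto simp: last_append)
      then show False using min s by fastforce
    qed
    ultimately show ?thesis by blast
  qed
  then show thesis using that g unfolding G_def by blast
qed

lemma insert_path_cyc:
  assumes "cyc A c" "pth A p" "set p \<inter> set c = {}" "(last c, hd p) \<in> A" "(last p, hd c) \<in> A"
  shows "cyclable A (set c \<union> set p)"
proof -
  have "cyc A (c @ p)" using assms by (auto simp: cyc_def pth_append pth_def[of A c] pth_def[of A p]
    successively_append_iff pth_def)
  then show ?thesis using cyclableI by force
qed

lemma insert_path:
  assumes "cyclable A S" "pth A p" "set p \<inter> S = {}"
    and "od (A\<inverse>) S (hd p) + od A S (last p) > card S"
  shows "cyclable A (S \<union> set p)"
proof -
  obtain c where c: "cyc A c" "set c = S" using assms(1) by (auto simp: cyclable_def)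
  obtain c' where "cyc A c'" "set c' = S" "(last c', hd p) \<in> A" "(last p, hd c') \<in> A"
    using cyc_cross[of A c "\<lambda>x. (x, hd p) \<in> A" "\<lambda>x. (last p, x) \<in> A"] c assms(4)
    by (auto simp: od_def)
  then show ?thesis using insert_path_cyc assms by metis
qed

section \<open>Degrees into a vertex set\<close>

lemma od_le: "finite X \<Longrightarrow> od A X u \<le> card X"
  unfolding od_def by (intro card_mono) auto

lemma od_mono: "finite Y \<Longrightarrow> X \<subseteq> Y \<Longrightarrow> od A X u \<le> od A Y u"
  unfolding od_def by (intro card_mono) auto

lemma od_Un: "finite X \<Longrightarrow> finite Y \<Longrightarrow> X \<inter> Y = {} \<Longrightarrow> od A (X \<union> Y) u = od A X u + od A Y u"
  unfolding od_def by (subst card_Un_disjoint[symmetric]) (auto intro!: arg_cong[where f=card])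

lemma od_Un_le: "finite X \<Longrightarrow> finite Y \<Longrightarrow> od A (X \<union> Y) u \<le> od A X u + od A Y u"
  unfolding od_def
  by (rule order_trans[OF _ card_Un_le]) (auto intro!: card_mono)

lemma od_Diff: "finite Y \<Longrightarrow> X \<subseteq> Y \<Longrightarrow> od A Y u = od A X u + od A (Y - X) u"
  using od_Un[of X "Y - X" A u] by (metis Diff_disjoint Diff_partition finite_Diff finite_subset)

lemma od_le_less:
  assumes "finite X" "x \<in> X" "(u, x) \<notin> A"
  shows "od A X u \<le> card X - 1"
proof -
  have "od A X u \<le> card (X - {x})" unfolding od_def using assms by (intro card_mono) auto
  then show ?thesis using assms by simp
qed

lemma od_eq_0: "finite X \<Longrightarrow> od A X u = 0 \<longleftrightarrow> (\<forall>x\<in>X. (u, x) \<notin> A)"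
  unfolding od_def by auto

lemma od_le_card: "finite Y \<Longrightarrow> (\<And>x. x \<in> X \<Longrightarrow> (u, x) \<in> A \<Longrightarrow> x \<in> Y) \<Longrightarrow> od A X u \<le> card Y"
  unfolding od_def by (intro card_mono) auto

lemma od_card_eq: "finite X \<Longrightarrow> od A X u \<ge> card X \<Longrightarrow> x \<in> X \<Longrightarrow> (u, x) \<in> A"
  unfolding od_def
  by (metis (no_types, lifting) card_seteq mem_Collect_eq subsetI)

lemma od_empty [simp]: "od A {} u = 0"
  by (simp add: od_def)

lemma od_single: "od A {x} u = (if (u, x) \<in> A then 1 else 0)"
  by (auto simp: od_def Collect_conv_if)

lemma od_insert: "finite X \<Longrightarrow> x \<notin> X \<Longrightarrow> od A (insert x X) u = od A X u + (if (u, x) \<in> A then 1 else 0)"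
  using od_Un[of X "{x}" A u] by (auto simp: od_single)

lemma od_Union:
  assumes "finite F" "\<And>S. S \<in> F \<Longrightarrow> finite S" "pairwise disjnt F"
  shows "od A (\<Union>F) u = (\<Sum>S\<in>F. od A S u)"
proof -
  have "{w \<in> \<Union>F. (u, w) \<in> A} = (\<Union>S\<in>F. {w \<in> S. (u, w) \<in> A})" by auto
  then show ?thesis unfolding od_def using assms
    by (simp, subst card_UN_disjoint) (auto simp: pairwise_def disjnt_def)
qed

lemma od_two_common:
  assumes "finite X" "od A X u + od B X v > card X"
  obtains x where "x \<in> X" "(u, x) \<in> A" "(v, x) \<in> B"
proof -
  have "card {w \<in> X. (u, w) \<in> A} + card {w \<in> X. (v, w) \<in> B} 
     = card ({w \<in> X. (u, w) \<in> A} \<union> {w \<in> X. (v, w) \<in> B}) + card ({w \<in> X. (u, w) \<in> A} \<inter> {w \<in> X. (v, w) \<in> B})"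
    using assms(1) by (intro card_Un_Int) auto
  moreover have "card ({w \<in> X. (u, w) \<in> A} \<union> {w \<in> X. (v, w) \<in> B}) \<le> card X"
    using assms(1) by (intro card_mono) auto
  ultimately have "card ({w \<in> X. (u, w) \<in> A} \<inter> {w \<in> X. (v, w) \<in> B}) \<noteq> 0"
    using assms(2) unfolding od_def by linarith
  then have "{w \<in> X. (u, w) \<in> A} \<inter> {w \<in> X. (v, w) \<in> B} \<noteq> {}" by auto
  then show thesis using that by blast
qed

section \<open>The degree condition and families of disjoint cycles\<close>

text \<open>Degrees are counted inside \<open>V\<close> while \<open>A\<close> may be larger, so the
  same arc set serves for the subdigraph induced on the uncovered set.\<close>

definition woodall :: "('a \<times> 'a) set \<Rightarrow> 'a set \<Rightarrow> bool" where
  "woodall A V \<longleftrightarrow> finite V \<and> (\<forall>v. (v, v) \<notin> A) \<and>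
    (\<forall>u\<in>V. \<forall>v\<in>V. u \<noteq> v \<longrightarrow> (u, v) \<notin> A \<longrightarrow> card V \<le> od A V u + od (A\<inverse>) V v)"

lemma woodall_converse [simp]: "woodall (A\<inverse>) V \<longleftrightarrow> woodall A V"
  unfolding woodall_def by (auto simp: add.commute)

lemma woodallD: "woodall A V \<Longrightarrow> u \<in> V \<Longrightarrow> v \<in> V \<Longrightarrow> u \<noteq> v \<Longrightarrow> (u, v) \<notin> A \<Longrightarrow>
   card V \<le> od A V u + od (A\<inverse>) V v"
  by (simp add: woodall_def)

text \<open>Only vertex sets are recorded: exchanges depend on which sets carry a cycle, and a
  cyclic order is chosen anew whenever one is needed.\<close>

definition fam :: "('a \<times> 'a) set \<Rightarrow> 'a set \<Rightarrow> nat \<Rightarrow> 'a set set \<Rightarrow> bool" where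
  "fam A V k F \<longleftrightarrow> finite F \<and> card F = k \<and> pairwise disjnt F \<and> (\<forall>S\<in>F. cyclable A S \<and> S \<subseteq> V)"

lemma fam_converse [simp]: "fam (A\<inverse>) V k F \<longleftrightarrow> fam A V k F"
  by (simp add: fam_def)

lemma fam_exchange:
  assumes "fam A V k F" "G \<subseteq> F" "fam A V (card G) G'" "\<Union>G' \<inter> (\<Union>F - \<Union>G) = {}"
  shows "fam A V k ((F - G) \<union> G')" "\<Union>((F - G) \<union> G') = (\<Union>F - \<Union>G) \<union> \<Union>G'"
proof -
  have fin: "finite F" "finite G" "finite G'" using assms finite_subset by (auto simp: fam_def)
  have d: "\<Union>(F - G) = \<Union>F - \<Union>G" using assms(1,2) unfolding fam_def pairwise_def disjnt_def by fastforce
  then show "\<Union>((F - G) \<union> G') = (\<Union>F - \<Union>G) \<union> \<Union>G'" by auto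
  have dj: "S \<inter> T = {}" if "S \<in> F - G" "T \<in> G'" for S T
    using that assms(4) d by blast
  have "(F - G) \<inter> G' = {}"
  proof (rule ccontr)
    assume "(F - G) \<inter> G' \<noteq> {}"
    then obtain S where "S \<in> F - G" "S \<in> G'" by blast
    moreover then have "S \<noteq> {}" using assms(3) cyclable_ne unfolding fam_def by blast
    ultimately show False using dj by blast
  qed
  then have "card ((F - G) \<union> G') = card (F - G) + card G'" using fin by (simp add: card_Un_disjoint)
  also have "\<dots> = k" using assms fin card_mono[of F G] by (auto simp: fam_def card_Diff_subset)
  finally show "fam A V k ((F - G) \<union> G')"
    using assms(1,3) fin(1,3) dj unfolding fam_def pairwise_def disjnt_def
    by (metis (no_types, lifting) Diff_iff Int_commute Un_iff finite_Diff finite_Un)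
qed

lemma fam_single: "cyclable A S \<Longrightarrow> S \<subseteq> V \<Longrightarrow> fam A V (Suc 0) {S}"
  by (simp add: fam_def)

lemma fam_pair: "cyclable A S \<Longrightarrow> S \<subseteq> V \<Longrightarrow> cyclable A T \<Longrightarrow> T \<subseteq> V \<Longrightarrow> S \<inter> T = {} \<Longrightarrow>
   fam A V 2 {S, T}"
  using cyclable_ne[of A S] by (auto simp: fam_def pairwise_def disjnt_def card_insert_if)

lemma fam_replace:
  assumes "fam A V k F" "S \<in> F" "cyclable A S'" "S' \<subseteq> V" "S' \<inter> (\<Union>F - S) = {}"
  shows "fam A V k (insert S' (F - {S}))" "\<Union>(insert S' (F - {S})) = (\<Union>F - S) \<union> S'"
  using fam_exchange[OF assms(1), of "{S}" "{S'}"] assms fam_single[of A S' V] by auto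

lemma fam_replace2:
  assumes "fam A V k F" "S \<in> F" "T \<in> F" "S \<noteq> T" "cyclable A S'" "S' \<subseteq> V" "cyclable A T'" "T' \<subseteq> V"
    and "S' \<inter> T' = {}" "(S' \<union> T') \<inter> (\<Union>F - S - T) = {}"
  shows "fam A V k (insert S' (insert T' (F - {S, T})))"
    "\<Union>(insert S' (insert T' (F - {S, T}))) = (\<Union>F - S - T) \<union> S' \<union> T'"
proof -
  have c: "card {S, T} = 2" using assms(4) by simp
  have u: "\<Union>{S', T'} \<inter> (\<Union>F - \<Union>{S, T}) = {}" using assms(10) by auto
  have "fam A V (card {S, T}) {S', T'}" using fam_pair assms(5-9) unfolding c by blast
  note e = fam_exchange[OF assms(1) _ this u]
  have st: "{S, T} \<subseteq> F" using assms by blast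
  have i: "(F - {S, T}) \<union> {S', T'} = insert S' (insert T' (F - {S, T}))" by blast
  show "fam A V k (insert S' (insert T' (F - {S, T})))" using e(1)[OF st] unfolding i .
  show "\<Union>(insert S' (insert T' (F - {S, T}))) = (\<Union>F - S - T) \<union> S' \<union> T'"
    using e(2)[OF st] unfolding i by blast
qed

lemma fam_fin: "fam A V k F \<Longrightarrow> S \<in> F \<Longrightarrow> finite S"
  using cyclable_finite by (auto simp: fam_def)

lemma fam_od:
  assumes "fam A V k F"
  shows "od B (\<Union>F) u = (\<Sum>S\<in>F. od B S u)"
  using assms fam_fin[OF assms] by (intro od_Union) (auto simp: fam_def)

lemma fam_card:
  assumes "fam A V k F"
  shows "card (\<Union>F) = (\<Sum>S\<in>F. card S)"
  using assms fam_fin[OF assms] by (intro card_Union_disjoint) (auto simp: fam_def)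

lemma fam_subset:
  assumes "fam A V k F" "G \<subseteq> F"
  shows "fam A V (card G) G"
  using assms finite_subset[OF assms(2)] unfolding fam_def by (auto intro: pairwise_subset)

lemma fam_insertD:
  assumes "fam A V k F" "S \<in> F"
  shows "\<Union>(F - {S}) = \<Union>F - S"
  using assms unfolding fam_def pairwise_def disjnt_def by fastforce

lemma fam_exists_insertable:
  assumes "fam A V k F" "od (A\<inverse>) (\<Union>F) u + od A (\<Union>F) v > card (\<Union>F)"
  obtains S where "S \<in> F" "od (A\<inverse>) S u + od A S v > card S"
proof -
  have "\<exists>S\<in>F. od (A\<inverse>) S u + od A S v > card S"
  proof (rule ccontr)
    assume "\<not> ?thesis"
    then have "(\<Sum>S\<in>F. od (A\<inverse>) S u + od A S v) \<le> (\<Sum>S\<in>F. card S)"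
      by (intro sum_mono) (auto simp: not_less)
    then show False using assms(2) fam_od[OF assms(1)] fam_card[OF assms(1)]
      by (simp add: sum.distrib)
  qed
  then show thesis using that by blast
qed

section \<open>Extremal families of cycles\<close>

lemma cyc_path_close:
  assumes "pth A p" "pth A q" "set p \<inter> set q = {}" "(last p, hd q) \<in> A" "(last q, hd p) \<in> A"
    "3 \<le> length p + length q"
  shows "cyc A (p @ q)"
proof -
  have "p \<noteq> []" "q \<noteq> []" using assms(1,2) by (auto simp: pth_def)
  then show ?thesis using assms by (auto simp: cyc_def pth_append)
qed

lemma cyc_pthD: "cyc A (p @ q) \<Longrightarrow> p \<noteq> [] \<Longrightarrow> pth A p"
  by (cases "q = []") (auto simp: cyc_def pth_append)

lemma cyc_pthD2: "cyc A (p @ q) \<Longrightarrow> q \<noteq> [] \<Longrightarrow> pth A q"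
  using cyc_pthD cyc_rotate by blast

text \<open>Competing families must keep the \<open>H\<close>-neighbours in \<open>S0\<close>
  together on one cycle. The other vertices of \<open>S0\<close> may move to other cycles, which is
  the freedom needed for rerouting a gap in \<open>bad\<close>.\<close>

locale extremal =
  fixes A :: "('a \<times> 'a) set" and V k F H S0
  assumes W: "woodall A V" and fam: "fam A V k F" and H_def: "H = V - \<Union>F" and H_ne: "H \<noteq> {}"
    and S0: "S0 \<in> F"
    and minimal: "\<And>F' S'. fam A V k F' \<Longrightarrow> V - \<Union>F' \<subset> H \<Longrightarrow> S' \<in> F' \<Longrightarrow>
      S0 \<inter> {x. \<exists>h\<in>H. (x, h) \<in> A \<or> (h, x) \<in> A} \<subseteq> S' \<Longrightarrow> False"
begin

lemma converse: "extremal (A\<inverse>) V k F H S0"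
proof
  fix F' S' assume "fam (A\<inverse>) V k F'" "V - \<Union>F' \<subset> H" "S' \<in> F'"
     "S0 \<inter> {x. \<exists>h\<in>H. (x, h) \<in> A\<inverse> \<or> (h, x) \<in> A\<inverse>} \<subseteq> S'"
  then show False using minimal[of F' S'] by (auto simp: disj_commute)
qed (use W fam H_def H_ne S0 in auto)

lemma finV: "finite V" using W by (simp add: woodall_def)

lemma loopfree: "(v, v) \<notin> A" using W by (simp add: woodall_def)

lemma UV: "\<Union>F \<subseteq> V" using fam by (auto simp: fam_def)

lemma finU: "finite (\<Union>F)" using UV finV finite_subset by blast

lemma HV: "H \<subseteq> V" using H_def by auto

lemma finH: "finite H" using HV finV finite_subset by blast

lemma UH: "V = \<Union>F \<union> H" "\<Union>F \<inter> H = {}" using UV H_def by auto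

lemma card_UH: "card V = card (\<Union>F) + card H" using UH finU finH by (metis card_Un_disjoint)

lemma od_UH: "od B V u = od B (\<Union>F) u + od B H u" using od_Un[OF finU finH UH(2)] UH(1) by simp

lemma memF: "S \<in> F \<Longrightarrow> S \<subseteq> V" "S \<in> F \<Longrightarrow> finite S" "S \<in> F \<Longrightarrow> S \<inter> H = {}"
   "S \<in> F \<Longrightarrow> cyclable A S" "S \<in> F \<Longrightarrow> T \<in> F \<Longrightarrow> S \<noteq> T \<Longrightarrow> S \<inter> T = {}"
  using fam H_def fam_fin[OF fam] by (auto simp: fam_def pairwise_def disjnt_def)

lemma psubset_uncovered:
  assumes "\<Union>F \<subseteq> X" "x \<in> X" "x \<in> H"
  shows "V - X \<subset> H"
  using assms UH by blast

lemma absorb: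
  assumes S: "S \<in> F" and P: "P \<subseteq> H" "P \<noteq> {}" 
  shows "\<not> cyclable A (S \<union> P)"
proof
  assume c: "cyclable A (S \<union> P)"
  have d: "(S \<union> P) \<inter> (\<Union>F - S) = {}" using P UH by blast
  have v: "S \<union> P \<subseteq> V" using memF(1)[OF S] P HV by blast
  note n = fam_replace[OF fam S c v d]
  have "V - \<Union>(insert (S \<union> P) (F - {S})) \<subset> H" unfolding n(2) using P UH by blast
  moreover have "\<exists>S'\<in>insert (S \<union> P) (F - {S}). S0 \<subseteq> S'" using S0 by blast
  ultimately show False using minimal[OF n(1)] by blast
qed

lemma H_path_not_insertable:
  assumes p: "pth A p" "set p \<subseteq> H" and S: "S \<in> F"
  shows "od (A\<inverse>) S (hd p) + od A S (last p) \<le> card S"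
proof (rule ccontr)
  assume "\<not> ?thesis"
  moreover have "set p \<inter> S = {}" using memF(3)[OF S] p(2) by blast
  ultimately have "cyclable A (S \<union> set p)"
    using insert_path memF(4)[OF S] p(1) by (metis not_le)
  moreover have "set p \<noteq> {}" using p(1) by (simp add: pth_def)
  ultimately show False using absorb[OF S p(2)] by blast
qed

lemma H_path_sum:
  assumes p: "pth A p" "set p \<subseteq> H" and G: "G \<subseteq> F"
  shows "od (A\<inverse>) (\<Union>G) (hd p) + od A (\<Union>G) (last p) \<le> card (\<Union>G)"
  using H_path_not_insertable[OF p] fam_exists_insertable[OF fam_subset[OF fam G]] G 
  by (metis not_le subsetD)

text \<open>Without a path from \<open>x\<close> to \<open>y\<close> in \<open>H\<close> there is no
  arc and no common intermediate vertex in \<open>H\<close>, so the degree condition puts at least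
  \<open>card (\<Union>F) + 2\<close> arcs out of \<open>x\<close> and into \<open>y\<close> on the
  cycles. A path from \<open>y\<close> to \<open>x\<close> would then be insertable; if that is
  missing too, adding both estimates makes \<open>x\<close> or \<open>y\<close> alone
  insertable.\<close>

lemma strong:
  assumes "x \<in> H" "y \<in> H"
  obtains p where "pth A p" "set p \<subseteq> H" "hd p = x" "last p = y"
proof -
  define con where "con = (\<lambda>x y. \<exists>p. pth A p \<and> set p \<subseteq> H \<and> hd p = x \<and> last p = y)"
  have refl: "con x x" if "x \<in> H" for x
    unfolding con_def using that by (intro exI[of _ "[x]"]) auto
  have lower: "od A (\<Union>F) x + od (A\<inverse>) (\<Union>F) y \<ge> card (\<Union>F) + 2" 
    if "x \<in> H" "y \<in> H" "\<not> con x y" for x y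
  proof -
    have ne: "x \<noteq> y" using that refl by blast
    have 1: "(x, y) \<notin> A"
    proof
      assume "(x, y) \<in> A"
      then have "pth A [x, y]" using ne by (auto simp: pth_def)
      then show False using that unfolding con_def by force
    qed
    have 2: "\<not> ((x, z) \<in> A \<and> (z, y) \<in> A)" if z: "z \<in> H" for z
    proof
      assume a: "(x, z) \<in> A \<and> (z, y) \<in> A"
      then have "pth A [x, z, y]" using ne loopfree by (auto simp: pth_def)
      then show False using z \<open>\<not> con x y\<close> \<open>x \<in> H\<close> \<open>y \<in> H\<close> unfolding con_def by force
    qed
    have "od A (H - {x, y}) x + od (A\<inverse>) (H - {x, y}) y \<le> card (H - {x, y})"
      using od_two_common[of "H - {x,y}" A x "A\<inverse>" y] 2 finH
      by (metis DiffD1 converse_iff finite_Diff not_le)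
    moreover have "od A H x \<le> od A (H - {x, y}) x" "od (A\<inverse>) H y \<le> od (A\<inverse>) (H - {x, y}) y"
      unfolding od_def using 1 loopfree finH by (auto intro!: card_mono)
    moreover have "card (H - {x, y}) + 2 = card H"
      using that ne finH card_mono[of H "{x, y}"] by (simp add: card_Diff_subset)
    moreover have "card V \<le> od A V x + od (A\<inverse>) V y"
      using woodallD[OF W _ _ ne 1] that HV by blast
    ultimately show ?thesis unfolding od_UH card_UH by linarith
  qed
  have small: "od (A\<inverse>) (\<Union>F) x + od A (\<Union>F) y \<le> card (\<Union>F)" if "con x y" for x y
    using that H_path_sum[of _ F] unfolding con_def by blast
  have "con x y"
    using lower[of x y] lower[of y x] small[of y x] small[OF refl, of x] small[OF refl, of y] assms
    by linarith
  then show thesis using that unfolding con_def by blast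
qed

text \<open>Closing the segment \<open>Pi\<close> through \<open>H\<close> gives a cycle that misses
  only the gap \<open>Sg\<close>. The gap has no neighbours in \<open>H\<close>, so the non-arcs
  between \<open>H\<close> and its two ends force many arcs from these ends to the cycles, enough to
  insert \<open>Sg\<close> as a path into \<open>Pi\<close> or into another cycle.\<close>

lemma bad:
  assumes S: "S \<in> F" and a: "a \<in> S" "h \<in> H" "(a, h) \<in> A" and b: "b \<in> S" "h' \<in> H" "(h', b) \<in> A"
  shows "a = b"
proof (rule ccontr)
  assume ab: "a \<noteq> b"
  define P where "P = (\<lambda>x. \<exists>h\<in>H. (x, h) \<in> A)"
  define Q where "Q = (\<lambda>x. \<exists>h\<in>H. (h, x) \<in> A)"
  obtain c where c: "cyc A c" "set c = S" using memF(4)[OF S] by (auto simp: cyclable_def)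
  obtain Pi Sg where ps: "cyc A (Pi @ Sg)" "set (Pi @ Sg) = S" "2 \<le> length Pi"
    "Q (hd Pi)" "P (last Pi)" and free: "\<forall>x \<in> set Sg. \<not> P x \<and> \<not> Q x"
    using cyc_cross_pair[of A c P a Q b] c ab a b unfolding P_def Q_def by metis
  obtain hb where hb: "hb \<in> H" "(last Pi, hb) \<in> A" using ps unfolding P_def by blast
  obtain ha where ha: "ha \<in> H" "(ha, hd Pi) \<in> A" using ps unfolding Q_def by blast
  obtain q where q: "pth A q" "set q \<subseteq> H" "hd q = hb" "last q = ha" using strong hb ha by metis
  have qne: "q \<noteq> []" "Pi \<noteq> []" using q ps by (auto simp: pth_def)
  have pPi: "pth A Pi" using cyc_pthD ps qne by blast
  have S_eq: "S = set Pi \<union> set Sg" using ps by auto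
  have dist: "distinct (Pi @ Sg)" using cyc_distinct ps by blast
  have qS: "set q \<inter> \<Union>F = {}" using q UH by blast
  have PiF: "set Pi \<subseteq> \<Union>F" "set Sg \<subseteq> \<Union>F" using S S_eq by auto
  have nbS: "S \<inter> {x. \<exists>h\<in>H. (x, h) \<in> A \<or> (h, x) \<in> A} \<subseteq> set Pi"
    using free S_eq unfolding P_def Q_def by blast
  have "1 \<le> length q" using qne by (simp add: Suc_le_eq)
  moreover have "set Pi \<inter> set q = {}" using qS PiF by blast
  ultimately have "cyc A (Pi @ q)" using cyc_path_close[OF pPi q(1)] hb ha q(3,4) ps(3) by auto
  then have c1: "cyclable A (set Pi \<union> set q)" using cyclableI[of A "Pi @ q"] by auto
  have use_S: False if "cyclable A (S \<union> set q)"
    using absorb[OF S q(2)] qne that by simp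
  have Sgne: "Sg \<noteq> []" using use_S c1 S_eq by auto
  have pSg: "pth A Sg" using cyc_pthD2 ps Sgne by blast
  have conn: "(last Pi, hd Sg) \<in> A" "(last Sg, hd Pi) \<in> A"
    using ps Sgne qne by (auto simp: cyc_def pth_append)
  define s where "s = length Sg"
  have cs: "card (set Sg) = s" "card (set Pi) = length Pi" "card S = length Pi + s"
    using dist S_eq distinct_card[of Sg] distinct_card[of Pi] distinct_card[OF dist] ps(2) 
    by (auto simp: s_def)
  let ?G = "F - {S}"
  have G: "\<Union>?G = \<Union>F - S" using fam_insertD[OF fam S] .
  have cG: "card (\<Union>F) = card (\<Union>?G) + card S"
    unfolding G using finU S by (metis Sup_upper card_Diff_subset card_mono finite_subset le_add_diff_inverse2)
  have odG: "od B (\<Union>F) u = od B (\<Union>?G) u + (od B (set Pi) u + od B (set Sg) u)" for B u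
  proof -
    have "S \<subseteq> \<Union>F" using S by blast
    then have "od B (\<Union>F) u = od B S u + od B (\<Union>F - S) u" by (rule od_Diff[OF finU])
    moreover have "od B S u = od B (set Pi) u + od B (set Sg) u"
      unfolding S_eq by (rule od_Un) (use dist in auto)
    ultimately show ?thesis unfolding G by simp
  qed
  \<comment> \<open>If \<open>Pi\<close> splits at a crossing, \<open>Sg\<close> joins its two
    pieces and \<open>q\<close> could be inserted into all of \<open>S\<close>. The
    \<open>+ 1\<close> is that of \<open>path_cross\<close>, as \<open>Pi\<close> is only a
    path.\<close>
  have Pi_le: "od (A\<inverse>) (set Pi) hb + od A (set Pi) ha \<le> length Pi + 1"
  proof (rule ccontr)
    assume "\<not> ?thesis"
    then obtain us vs where uv: "Pi = us @ vs" "us \<noteq> []" "vs \<noteq> []" "(last us, hb) \<in> A" "(ha, hd vs) \<in> A"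
      using path_cross[of Pi "\<lambda>x. (x, hb) \<in> A" "\<lambda>x. (ha, x) \<in> A"] dist qne
      by (auto simp: od_def)
    have "cyc A (vs @ Sg @ us)" using cyc_rotate[of A us "vs @ Sg"] ps uv by simp
    moreover have "set q \<inter> set (vs @ Sg @ us) = {}" using uv(1) qS PiF by auto
    ultimately have "cyclable A (set (vs @ Sg @ us) \<union> set q)"
      using insert_path_cyc[of A "vs @ Sg @ us" q] q uv by auto
    moreover have "set (vs @ Sg @ us) = S" using uv S_eq by auto
    ultimately show False using use_S by simp
  qed
  have Sg0: "od (A\<inverse>) (set Sg) hb = 0" "od A (set Sg) ha = 0"
    using free hb ha unfolding P_def Q_def by (auto simp: od_eq_0)
  have rest: "od (A\<inverse>) (\<Union>?G) hb + od A (\<Union>?G) ha \<le> card (\<Union>?G)"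
    using H_path_sum[OF q(1,2), of ?G] q by auto
  have "od (A\<inverse>) H hb \<le> card H - 1" "od A H ha \<le> card H - 1"
    using od_le_less[OF finH] hb ha loopfree by auto
  moreover have "card H > 0" using finH H_ne by (simp add: card_gt_0_iff)
  ultimately have up: "od (A\<inverse>) V hb + od A V ha + s + 1 \<le> card (\<Union>F) + 2 * card H"
    unfolding od_UH odG Sg0 using rest Pi_le cG cs by linarith
  define sg where "sg = hd Sg"
  define tau where "tau = last Sg"
  have st: "sg \<in> set Sg" "tau \<in> set Sg" using Sgne by (auto simp: sg_def tau_def)
  have stV: "sg \<in> V" "tau \<in> V" "sg \<notin> H" "tau \<notin> H" using st PiF UV UH by auto
  have na: "(ha, sg) \<notin> A" "(tau, hb) \<notin> A" using free st hb ha unfolding P_def Q_def by auto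
  have "card V \<le> od A V ha + od (A\<inverse>) V sg" "card V \<le> od A V tau + od (A\<inverse>) V hb"
    using woodallD[OF W] na stV ha hb HV by blast+
  moreover have "od (A\<inverse>) H sg = 0" "od A H tau = 0"
    using free st unfolding P_def Q_def by (auto simp: od_eq_0 finH)
  ultimately have low: "od (A\<inverse>) (\<Union>F) sg + od A (\<Union>F) tau \<ge> card (\<Union>F) + s + 1"
    using up unfolding card_UH od_UH[of "A\<inverse>" sg] od_UH[of A tau] by linarith
  have "od (A\<inverse>) (set Sg) sg \<le> s - 1" "od A (set Sg) tau \<le> s - 1"
    using od_le_less[of "set Sg"] st loopfree cs by auto
  moreover have "s > 0" using Sgne s_def by simp
  ultimately have "od (A\<inverse>) (\<Union>?G) sg + od A (\<Union>?G) tau + (od (A\<inverse>) (set Pi) sg + od A (set Pi) tau)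
     \<ge> card (\<Union>?G) + length Pi + 3"
    using low unfolding odG using cG cs by linarith
  then consider "od (A\<inverse>) (\<Union>?G) sg + od A (\<Union>?G) tau > card (\<Union>?G)" |
    "od (A\<inverse>) (set Pi) sg + od A (set Pi) tau > length Pi + 1" by linarith
  then show False
  proof cases
    case 1
    obtain D where D: "D \<in> ?G" "od (A\<inverse>) D sg + od A D tau > card D"
      using fam_exists_insertable[OF fam_subset[OF fam, of ?G] 1] by auto
    have DS: "D \<inter> S = {}" "D \<in> F" "D \<noteq> S" using D(1) memF(5)[of D S] S by auto
    have c2: "cyclable A (D \<union> set Sg)"
      using insert_path[of A D Sg] memF(4)[of D] D DS pSg S_eq sg_def tau_def by auto
    have dj: "(set Pi \<union> set q) \<inter> (D \<union> set Sg) = {}" 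
      "((set Pi \<union> set q) \<union> (D \<union> set Sg)) \<inter> (\<Union>F - S - D) = {}"
    proof -
      have "set Pi \<inter> set Sg = {}" using dist by simp
      moreover have "set q \<inter> D = {}" "set q \<inter> set Sg = {}" using q(2) UH(2) DS PiF by blast+
      moreover have "set Pi \<inter> D = {}" using DS S_eq by blast
      ultimately show "(set Pi \<union> set q) \<inter> (D \<union> set Sg) = {}" by blast
      show "((set Pi \<union> set q) \<union> (D \<union> set Sg)) \<inter> (\<Union>F - S - D) = {}"
        using q(2) UH(2) S_eq by blast
    qed
    have v: "set Pi \<union> set q \<subseteq> V" "D \<union> set Sg \<subseteq> V" using PiF UV q HV DS(2) by blast+
    note n = fam_replace2[OF fam S DS(2) DS(3)[symmetric] c1 v(1) c2 v(2) dj]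
    let ?F = "insert (set Pi \<union> set q) (insert (D \<union> set Sg) (F - {S, D}))"
    have "V - \<Union>?F \<subset> H"
    proof (rule psubset_uncovered[of _ ha])
      show "\<Union>F \<subseteq> \<Union>?F" unfolding n(2) S_eq by blast
      show "ha \<in> \<Union>?F" unfolding n(2) using q(4) qne last_in_set by blast
    qed (fact ha)
    moreover obtain S' where "S' \<in> ?F" "S0 \<inter> {x. \<exists>h\<in>H. (x, h) \<in> A \<or> (h, x) \<in> A} \<subseteq> S'"
    proof -
      have "\<exists>S'\<in>?F. S0 \<inter> {x. \<exists>h\<in>H. (x, h) \<in> A \<or> (h, x) \<in> A} \<subseteq> S'"
      proof -
      \<comment> \<open>The weak form of the protection is used here: for \<open>S0 = S\<close> all
        \<open>H\<close>-neighbours lie in \<open>Pi\<close>, so moving \<open>Sg\<close> to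
        \<open>D\<close> is admissible.\<close>
      consider "S0 = S" | "S0 = D" | "S0 \<in> F - {S, D}" using S0 by blast
      then show ?thesis
      proof cases
        case 1
        then show ?thesis using nbS by (intro bexI[of _ "set Pi \<union> set q"]) auto
      next
        case 2
        then show ?thesis by (intro bexI[of _ "D \<union> set Sg"]) auto
      next
        case 3
        then show ?thesis by (intro bexI[of _ S0]) auto
      qed
      qed
      then show thesis by (elim bexE) (rule that)
    qed
    ultimately show False by (rule minimal[OF n(1)])
  next
    case 2
    then obtain us vs where uv: "Pi = us @ vs" "us \<noteq> []" "vs \<noteq> []" "(last us, sg) \<in> A" "(tau, hd vs) \<in> A"
      using path_cross[of Pi "\<lambda>x. (x, sg) \<in> A" "\<lambda>x. (tau, x) \<in> A"] dist qne
      by (auto simp: od_def)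
    have "cyc A (vs @ q @ us)" using cyc_rotate[of A us "vs @ q"] \<open>cyc A (Pi @ q)\<close> uv by simp
    moreover have "set Sg \<inter> set (vs @ q @ us) = {}" using uv(1) qS PiF dist by auto
    ultimately have "cyclable A (set (vs @ q @ us) \<union> set Sg)"
      using insert_path_cyc[of A "vs @ q @ us" Sg] pSg uv sg_def tau_def by auto
    moreover have "set (vs @ q @ us) \<union> set Sg = S \<union> set q" using uv S_eq by auto
    ultimately show False using use_S by simp
  qed
qed

end

section \<open>Hamiltonian cycles and insertion of single vertices\<close>

lemma bounded_max_path:
  assumes "finite X" "x \<in> X"
  obtains p where "pth A p" "set p \<subseteq> X" "\<And>y. y \<in> X \<Longrightarrow> y \<notin> set p \<Longrightarrow> (last p, y) \<notin> A"
proof -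
  define R where "R = (\<lambda>p. pth A p \<and> set p \<subseteq> X)"
  have "length p \<le> card X" if "R p" for p
    using that assms(1) card_mono[of X "set p"] by (auto simp: R_def pth_def distinct_card)
  moreover have "R [x]" using assms by (simp add: R_def)
  ultimately obtain p where p: "R p" "\<And>q. R q \<Longrightarrow> length q \<le> length p"
    using ex_has_greatest_nat[of R "[x]" length "Suc (card X)"] by (metis le_imp_less_Suc)
  show thesis
  proof (rule that)
    show "pth A p" "set p \<subseteq> X" using p(1) by (auto simp: R_def)
    fix y assume "y \<in> X" "y \<notin> set p"
    show "(last p, y) \<notin> A"
    proof
      assume "(last p, y) \<in> A"
      then have "R (p @ [y])" using p(1) \<open>y \<in> X\<close> \<open>y \<notin> set p\<close>
        by (auto simp: R_def pth_append[of p "[y]"] pth_def[of A p])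
      then show False using p(2) by fastforce
    qed
  qed
qed

text \<open>The end of a maximal path has all its out-neighbours on the path; one of two differs
  from the predecessor, so the cycle it closes is not a digon.\<close>

lemma cycle_if_outdegree_ge_2:
  assumes "finite X" "X \<noteq> {}" "\<And>v. (v, v) \<notin> A" "\<And>v. v \<in> X \<Longrightarrow> 2 \<le> od A X v"
  obtains S where "S \<subseteq> X" "cyclable A S"
proof -
  obtain p where p: "pth A p" "set p \<subseteq> X" "\<And>y. y \<in> X \<Longrightarrow> y \<notin> set p \<Longrightarrow> (last p, y) \<notin> A"
    using bounded_max_path assms(1,2) by (metis ex_in_conv)
  have pne: "p \<noteq> []" using p by (simp add: pth_def)
  define z where "z = last p"
  define N where "N = {y \<in> X. (z, y) \<in> A}"
  have "z \<in> X" using pne p(2) z_def last_in_set by blast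
  then have N2: "2 \<le> card N" using assms(4) by (simp add: N_def od_def)
  have NP: "N \<subseteq> set p" "z \<notin> N" using p assms(3) by (auto simp: N_def z_def)
  have "p \<noteq> [z]" using NP N2 by (metis card.empty empty_set list.simps(15) not_numeral_le_zero subset_empty subset_insert)
  then obtain r y where r: "p = r @ [y, z]"
    by (metis append_Nil append_assoc append_butlast_last_id append_Cons pne z_def)
  have "\<not> N \<subseteq> {y}" using N2 card_mono[of "{y}" N] by auto
  then obtain x where x: "x \<in> N" "x \<noteq> y" by blast
  then have "x \<in> set r" using NP r by auto
  then obtain us vs where uv: "r = us @ x # vs" by (meson split_list)
  have "cyc A (x # vs @ [y, z])"
    using p(1) x unfolding cyc_def r uv pth_def
    by (auto simp: successively_append_iff N_def)
  then have "cyclable A (set (x # vs @ [y, z]))" by (rule cyclableI)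
  then show thesis using that[of "set (x # vs @ [y, z])"] p(2) r uv by auto
qed

lemma woodall_outdegree_ge_2:
  assumes W: "woodall A V" and "3 \<le> card V" "u \<in> V"
  shows "2 \<le> od A V u"
proof (cases "\<exists>z\<in>V - {u}. (u, z) \<notin> A")
  case True
  then obtain z where z: "z \<in> V" "z \<noteq> u" "(u, z) \<notin> A" by blast
  have fin: "finite V" "\<And>v. (v, v) \<notin> A" using W by (auto simp: woodall_def)
  have "od (A\<inverse>) V z \<le> card (V - {u, z})"
    using z fin by (intro od_le_card) auto
  moreover have "card (V - {u, z}) + 2 = card V"
    using fin z assms card_Diff_subset[of "{u,z}" V] by auto
  ultimately show ?thesis using woodallD[OF W assms(3) z(1)] z by force
next
  case False
  have "V - {u} \<subseteq> {w \<in> V. (u, w) \<in> A}" using False by blast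
  moreover have "finite V" using W by (auto simp: woodall_def)
  ultimately have "card (V - {u}) \<le> od A V u" unfolding od_def by (intro card_mono) auto
  then show ?thesis using assms \<open>finite V\<close> by simp
qed

lemma ex_least_uncovered:
  fixes R :: "'a set set \<Rightarrow> bool"
  assumes "finite V" "R F0"
  obtains F where "R F" "\<And>F'. R F' \<Longrightarrow> \<not> V - \<Union>F' \<subset> V - \<Union>F"
proof -
  obtain F where "R F" "\<And>F'. R F' \<Longrightarrow> card (V - \<Union>F) \<le> card (V - \<Union>F')"
    using ex_has_least_nat[of R F0 "\<lambda>F. card (V - \<Union>F)"] assms by blast
  moreover have "finite (V - \<Union>F)" using assms(1) by simp
  ultimately show thesis using that[of F] psubset_card_mono[of "V - \<Union>F"] by (metis not_le)
qed

text \<open>A vertex \<open>t \<noteq> x\<close> of \<open>S\<close> sends nothing to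
  \<open>H\<close>, and a vertex of \<open>H\<close> receives at most one arc from \<open>S\<close>;
  together they miss the degree bound by one.\<close>

lemma (in extremal) single_cycle_attached:
  assumes F1: "F = {S}" and A1: "\<And>a h. a \<in> S \<Longrightarrow> h \<in> H \<Longrightarrow> (a, h) \<in> A \<Longrightarrow> a = x"
  shows False
proof -
  have S: "S \<in> F" "\<Union>F = S" using F1 by auto
  have c3: "3 \<le> card S" using cyclable_card memF S by blast
  obtain t where t: "t \<in> S" "t \<noteq> x"
    using c3 card_mono[of "{x}" S] by fastforce
  obtain h where h: "h \<in> H" using H_ne by blast
  have th: "(t, h) \<notin> A" "t \<noteq> h" using A1 t h memF(3)[OF S(1)] by auto
  have "card V \<le> od A V t + od (A\<inverse>) V h"
    using woodallD[OF W _ _ th(2,1)] t h HV UV S by blast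
  moreover have "od A H t = 0" using t A1 by (auto simp: od_eq_0 finH)
  moreover have "od A S t \<le> card S - 1" by (rule od_le_less) (use loopfree t memF(2) S in auto)
  moreover have "od (A\<inverse>) S h \<le> card {x}" using A1 h by (intro od_le_card) auto
  moreover have "od (A\<inverse>) H h \<le> card H - 1" using od_le_less[of H h h "A\<inverse>"] loopfree h finH by auto
  moreover have "card H > 0" using finH H_ne by (simp add: card_gt_0_iff)
  ultimately show False unfolding card_UH od_UH S(2) using c3 by simp
qed

text \<open>Woodall's theorem. If vertices remain outside a maximal cycle, it both sends to and
  receives from them, and \<open>bad\<close> makes all sending arcs leave from one vertex, against
  \<open>single_cycle_attached\<close>.\<close>

theorem woodall_hamiltonian:
  assumes W: "woodall A V" and "3 \<le> card V"
  shows "cyclable A V"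
proof -
  have fin: "finite V" "\<And>v. (v, v) \<notin> A" using W by (auto simp: woodall_def)
  have "V \<noteq> {}" using assms by auto
  then obtain S1 where "S1 \<subseteq> V" "cyclable A S1"
    using cycle_if_outdegree_ge_2[of V A] woodall_outdegree_ge_2[OF assms] fin by metis
  then have "fam A V 1 {S1}" by (simp add: fam_def)
  then obtain F where F: "fam A V 1 F" "\<And>F'. fam A V 1 F' \<Longrightarrow> \<not> V - \<Union>F' \<subset> V - \<Union>F"
    using ex_least_uncovered[of V "fam A V 1"] fin by metis
  then obtain S where S: "F = {S}" by (auto simp: fam_def card_1_singleton_iff)
  show ?thesis
  proof (cases "V - \<Union>F = {}")
    case True
    then have "S = V" using F S by (auto simp: fam_def)
    then show ?thesis using F S by (auto simp: fam_def)
  next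
    case False
    interpret extremal A V 1 F "V - \<Union>F" S
      by standard (use F S False W in auto)
    interpret cv: extremal "A\<inverse>" V 1 F "V - \<Union>F" S by (rule converse)
    have SF: "S \<in> F" using S by simp
    have "\<exists>a\<in>S. \<exists>h\<in>V - \<Union>F. (a, h) \<in> A"
      using single_cycle_attached[OF S] by blast
    then obtain a h where a: "a \<in> S" "h \<in> V - \<Union>F" "(a, h) \<in> A" by blast
    have "\<exists>b\<in>S. \<exists>h\<in>V - \<Union>F. (h, b) \<in> A"
      using cv.single_cycle_attached[OF S] by blast
    then obtain b h' where b: "b \<in> S" "h' \<in> V - \<Union>F" "(h', b) \<in> A" by blast
    have "x = b" if "x \<in> S" "h \<in> V - \<Union>F" "(x, h) \<in> A" for x h
      using bad[OF SF that b] .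
    then have False by (rule single_cycle_attached[OF S])
    then show ?thesis ..
  qed
qed

lemma woodall_path_le_3:
  assumes W: "woodall A V" and "x \<in> V" "y \<in> V"
  obtains p where "pth A p" "set p \<subseteq> V" "hd p = x" "last p = y" "length p \<le> 3"
proof (cases "x = y \<or> (x, y) \<in> A")
  case True
  then consider "x = y" | "x \<noteq> y" "(x, y) \<in> A" by blast
  then show thesis
    by cases (use that[of "[x]"] that[of "[x, y]"] assms in \<open>auto simp: pth_def\<close>)
next
  case False
  have fin: "finite V" "\<And>v. (v, v) \<notin> A" using W by (auto simp: woodall_def)
  have "od A (V - {x, y}) x + od (A\<inverse>) (V - {x, y}) y \<ge> card V"
  proof -
    have "{w \<in> V - {x, y}. (x, w) \<in> A} = {w \<in> V. (x, w) \<in> A}"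
      "{w \<in> V - {x, y}. (y, w) \<in> A\<inverse>} = {w \<in> V. (y, w) \<in> A\<inverse>}" using False fin by auto
    then have "od A (V - {x, y}) x = od A V x" "od (A\<inverse>) (V - {x, y}) y = od (A\<inverse>) V y"
      by (simp_all only: od_def)
    then show ?thesis using woodallD[OF assms] False by simp
  qed
  moreover have "card V > card (V - {x, y})" 
    using fin assms by (intro psubset_card_mono) auto
  ultimately have "od A (V - {x, y}) x + od (A\<inverse>) (V - {x, y}) y > card (V - {x, y})" by linarith
  then obtain z where "z \<in> V - {x, y}" "(x, z) \<in> A" "(y, z) \<in> A\<inverse>"
    using od_two_common[of "V - {x, y}" A x "A\<inverse>" y] fin by blast
  then show thesis using that[of "[x, z, y]"] False assms by (auto simp: pth_def)
qed

text \<open>The bound survives each step: inserting one vertex enlarges the cycles by one and lowers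
  \<open>2 * card R\<close> by two.\<close>
lemma insert_vertices:
  assumes "fam A V k G" "finite R" "R \<subseteq> V" "R \<inter> \<Union>G = {}" "G0 \<subseteq> G" "\<And>v. (v, v) \<notin> A"
    and "\<And>z w. z \<in> R \<Longrightarrow> w \<in> \<Union>G0 \<Longrightarrow> (z, w) \<notin> A \<and> (w, z) \<notin> A"
    and "\<And>z. z \<in> R \<Longrightarrow> card (\<Union>G - \<Union>G0) + 2 * card R \<le>
      od (A\<inverse>) (\<Union>G \<union> R) z + od A (\<Union>G \<union> R) z + 1"
  shows "\<exists>G'. fam A V k G' \<and> \<Union>G' = \<Union>G \<union> R"
  using assms
proof (induction "card R" arbitrary: G R)
  case 0
  then show ?case by auto
next
  case (Suc r)
  then have "R \<noteq> {}" by auto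
  then obtain z where z: "z \<in> R" by blast
  have finG: "finite (\<Union>G)" using Suc.prems(1) fam_fin[OF Suc.prems(1)] by (auto simp: fam_def)
  have G: "\<Union>(G - G0) = \<Union>G - \<Union>G0"
    using Suc.prems(1,5) unfolding fam_def pairwise_def disjnt_def by fastforce
  have G0: "finite (\<Union>G0)" "\<Union>G0 \<subseteq> \<Union>G" using finG Suc.prems(5) by (auto intro: finite_subset)
  have odG: "od B (\<Union>G \<union> R) z \<le> od B (\<Union>(G - G0)) z + (card R - 1)" if "B = A \<or> B = A\<inverse>" for B
  proof -
    have "od B (\<Union>G0) z = 0" using Suc.prems(7)[OF z] that by (auto simp: od_eq_0 G0)
    moreover have "od B R z \<le> card R - 1"
      using that Suc.prems(2,6) z by (intro od_le_less[of R z]) auto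
    ultimately show ?thesis
      using od_Un_le[OF finG Suc.prems(2), of B z] od_Diff[OF finG G0(2), of B z] G by simp
  qed
  have cR: "card R \<ge> 1" using Suc.hyps by simp
  then have "od (A\<inverse>) (\<Union>(G - G0)) z + od A (\<Union>(G - G0)) z > card (\<Union>(G - G0))"
    using Suc.prems(8)[OF z] odG[of A] odG[of "A\<inverse>"] unfolding G by auto
  then obtain D where D: "D \<in> G - G0" "od (A\<inverse>) D z + od A D z > card D"
    using fam_exists_insertable[OF fam_subset[OF Suc.prems(1), of "G - G0"]] by auto
  have DG: "D \<in> G" "D \<subseteq> V" "cyclable A D" "z \<notin> D" using D Suc.prems(1,4) z by (auto simp: fam_def)
  then have c: "cyclable A (D \<union> {z})" using insert_path[of A D "[z]"] D by simp
  let ?G = "insert (D \<union> {z}) (G - {D})"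
  have d: "(D \<union> {z}) \<inter> (\<Union>G - D) = {}" using Suc.prems(4) z by auto
  have v: "D \<union> {z} \<subseteq> V" using DG z Suc.prems(3) by auto
  note n = fam_replace[OF Suc.prems(1) DG(1) c v d]
  have UG: "\<Union>?G = insert z (\<Union>G)" using n(2) DG by blast
  have nz: "z \<notin> \<Union>G" using z Suc.prems(4) by blast
  have cR': "card (R - {z}) = card R - 1" using z Suc.prems(2) by simp
  have U': "\<Union>?G \<union> (R - {z}) = \<Union>G \<union> R" unfolding UG using z by blast
  have "z \<notin> \<Union>G0" using nz G0 by blast
  have "card (\<Union>?G - \<Union>G0) \<le> card (\<Union>G - \<Union>G0) + 1"
    unfolding UG using finG by (simp add: insert_Diff_if card_insert_if)
  then have b: "card (\<Union>?G - \<Union>G0) + 2 * card (R - {z}) \<le> card (\<Union>G - \<Union>G0) + 2 * card R"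
    unfolding cR' using cR by simp
  have "\<exists>G'. fam A V k G' \<and> \<Union>G' = \<Union>?G \<union> (R - {z})"
  proof (rule Suc.hyps(1)[OF _ n(1)])
    show "r = card (R - {z})" using cR' Suc.hyps by simp
    show "(R - {z}) \<inter> \<Union>?G = {}" unfolding UG using Suc.prems(4) by blast
    show "G0 \<subseteq> ?G" using D Suc.prems(5) by blast
    fix y assume y: "y \<in> R - {z}"
    show "card (\<Union>?G - \<Union>G0) + 2 * card (R - {z}) \<le> 
       od (A\<inverse>) (\<Union>?G \<union> (R - {z})) y + od A (\<Union>?G \<union> (R - {z})) y + 1"
      unfolding U' using b Suc.prems(8)[of y] y by force
  qed (use Suc.prems(2,3,6,7) in auto)
  then show ?case unfolding U' .
qed

section \<open>Families leaving at least three vertices uncovered\<close>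

text \<open>Applied to \<open>A\<inverse>\<close> this is the set of cycle vertices that receive an
  arc from \<open>H\<close>.\<close>

definition attached :: "('a \<times> 'a) set \<Rightarrow> 'a set set \<Rightarrow> 'a set \<Rightarrow> 'a set" where
  "attached A F H = {x \<in> \<Union>F. \<exists>h\<in>H. (x, h) \<in> A}"

text \<open>A fixed position visits every vertex once as the cycle is rotated; this turns a bound
  for each rotation into a sum over all vertices.\<close>

lemma sum_rotate_nth:
  assumes "distinct c" "i < length c"
  shows "(\<Sum>j<length c. f (rotate j c ! i)) = (\<Sum>x\<in>set c. f x)"
proof -
  have "(\<Sum>j<length c. f (rotate j c ! i)) = (\<Sum>j<length c. f (rotate i c ! j))"
    using assms by (intro sum.cong) (auto simp: nth_rotate add.commute)
  also have "\<dots> = sum_list (map f (rotate i c))"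
    by (simp add: sum_list_sum_nth atLeast0LessThan)
  also have "\<dots> = (\<Sum>x\<in>set (rotate i c). f x)"
    using assms by (intro sum_list_distinct_conv_sum_set) simp
  finally show ?thesis by simp
qed

lemma cyc_rotate_n: "cyc A c \<Longrightarrow> cyc A (rotate j c)"
  using cyc_rotate[of A "take (j mod length c) c" "drop (j mod length c) c"] 
  by (simp add: rotate_drop_take)

context extremal
begin

abbreviation "AA \<equiv> attached A F H"
abbreviation "BB \<equiv> attached (A\<inverse>) F H"
abbreviation "UU \<equiv> \<Union>F - AA - BB"

lemma att_sub: "AA \<subseteq> \<Union>F" "BB \<subseteq> \<Union>F" by (auto simp: attached_def)

lemma fin_att: "finite AA" "finite BB" using att_sub finU finite_subset by blast+

text \<open>A vertex \<open>h\<close> of \<open>H\<close> does not send to \<open>x\<close>, and its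
  out-neighbours are among \<open>BB\<close> and the other vertices of \<open>H\<close>; the rest of
  the degree sum must enter \<open>x\<close> from the cycles.\<close>

lemma indeg_not_BB:
  assumes "x \<in> \<Union>F" "x \<notin> BB"
  shows "card (\<Union>F) + 1 \<le> od (A\<inverse>) (\<Union>F) x + card BB"
proof -
  obtain h where h: "h \<in> H" using H_ne by blast
  have hx: "(h, x) \<notin> A" "h \<noteq> x" using assms h UH by (auto simp: attached_def)
  have "card V \<le> od A V h + od (A\<inverse>) V x" using woodallD[OF W _ _ hx(2,1)] h assms HV UV by blast
  moreover have "od (A\<inverse>) H x = 0" using assms by (auto simp: od_eq_0 finH attached_def)
  moreover have "od A (\<Union>F) h \<le> card BB" using h by (intro od_le_card fin_att) (auto simp: attached_def)
  moreover have "od A H h \<le> card H - 1" using od_le_less[of H h h A] loopfree h finH by auto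
  moreover have H_pos: "0 < card H" using finH H_ne by (simp add: card_gt_0_iff)
  ultimately show ?thesis unfolding card_UH od_UH using H_pos by linarith
qed

lemma outdeg_not_AA:
  assumes "x \<in> \<Union>F" "x \<notin> AA"
  shows "card (\<Union>F) + 1 \<le> od A (\<Union>F) x + card AA"
  using extremal.indeg_not_BB[OF converse] assms by simp

lemma att_bad:
  assumes "S \<in> F" "a \<in> AA \<inter> S" "b \<in> BB \<inter> S"
  shows "a = b"
  using assms bad[of S a _ b] by (auto simp: attached_def)

lemma in_from_BB:
  assumes "x \<in> \<Union>F" "x \<notin> BB"
  shows "\<exists>b\<in>BB. (b, x) \<in> A"
proof (rule ccontr)
  assume "\<not> ?thesis"
  then have "od (A\<inverse>) (\<Union>F) x \<le> card (\<Union>F - BB)" using finU by (intro od_le_card) auto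
  also have "\<dots> = card (\<Union>F) - card BB" using att_sub fin_att by (simp add: card_Diff_subset)
  finally show False using indeg_not_BB[OF assms] card_mono[OF finU att_sub(2)] by linarith
qed

end

text \<open>If some \<open>u\<close> has out-degree at most one after deleting \<open>Q\<close>, its
  out-degree in \<open>H\<close> is at most 1 + 3, so the vertices it does not reach have in-degree
  at least \<open>card H - 4\<close>. Restricting to these loses at most 3 + 1 + 1 vertices, so
  in-degrees stay at least two and the dual criterion gives a cycle.\<close>

lemma cycle_avoiding_few:
  assumes W: "woodall A H" and m: "15 \<le> card H" and Q: "Q \<subseteq> H" "card Q \<le> 3"
  obtains Z where "Z \<subseteq> H - Q" "cyclable A Z"
proof -
  have fin: "finite H" "\<And>v. (v, v) \<notin> A" using W by (auto simp: woodall_def)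
  then have finQ: "finite Q" using Q finite_subset by blast
  define X0 where "X0 = H - Q"
  have cX0: "card X0 + card Q = card H" using Q fin finQ card_mono[of H Q] by (simp add: X0_def card_Diff_subset)
  have "\<exists>Z\<subseteq>X0. cyclable A Z"
  proof (cases "\<forall>u\<in>X0. 2 \<le> od A X0 u")
    case True
    have "X0 \<noteq> {}" using cX0 m Q by auto
    then obtain S where "S \<subseteq> X0" "cyclable A S"
      using cycle_if_outdegree_ge_2[of X0 A] True fin by (auto simp: X0_def)
    then show ?thesis by blast
  next
    case False
    then obtain u where u: "u \<in> X0" "od A X0 u \<le> 1" by fastforce
    define X where "X = {z \<in> X0 - {u}. (u, z) \<notin> A}"
    have "H - X \<subseteq> Q \<union> ({u} \<union> {z \<in> X0. (u, z) \<in> A})" by (auto simp: X_def X0_def)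
    then have "card (H - X) \<le> card (Q \<union> ({u} \<union> {z \<in> X0. (u, z) \<in> A}))"
      using fin finQ by (intro card_mono) (auto simp: X0_def)
    also have "\<dots> \<le> card Q + (card {u} + card {z \<in> X0. (u, z) \<in> A})"
      by (intro order_trans[OF card_Un_le] add_left_mono card_Un_le)
    also have "\<dots> \<le> 5" using u(2) Q(2) by (simp add: od_def)
    finally have c5: "card (H - X) \<le> 5" .
    have XH: "X \<subseteq> H" "finite X" using fin by (auto simp: X_def X0_def)
    have deg: "2 \<le> od (A\<inverse>) X z" if z: "z \<in> X" for z
    proof -
      have "card H \<le> od A H u + od (A\<inverse>) H z"
        using woodallD[OF W, of u z] z u(1) by (auto simp: X_def X0_def)
      moreover have "od A H u \<le> 4"
        using od_Diff[OF fin(1) Q(1), of A u] od_le[OF finQ, of A u] u(2) Q(2) by (simp add: X0_def)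
      moreover have "od (A\<inverse>) H z \<le> od (A\<inverse>) X z + 5"
        using od_Diff[OF fin(1) XH(1), of "A\<inverse>" z] od_le[of "H - X" "A\<inverse>" z] fin c5 by simp
      ultimately show ?thesis using m by linarith
    qed
    have "card H \<le> card X + card (H - X)" using card_Un_le[of X "H - X"] XH by (simp add: Un_absorb1)
    then have "X \<noteq> {}" using c5 m by auto
    then obtain S where "S \<subseteq> X" "cyclable (A\<inverse>) S"
      using cycle_if_outdegree_ge_2[OF XH(2), of "A\<inverse>"] deg fin by auto
    then show ?thesis by (auto simp: X_def)
  qed
  then show thesis using that X0_def by blast
qed

text \<open>All families compete here, so \<open>minimal\<close> holds whichever member serves as
  \<open>S0\<close>.\<close>

locale stuck_family =
  fixes A :: "('a \<times> 'a) set" and V k F H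
  assumes big_W: "woodall A V" and big_fam: "fam A V k F" and big_H: "H = V - \<Union>F"
    and H3: "3 \<le> card H" and F_ne: "F \<noteq> {}"
    and least: "\<And>F'. fam A V k F' \<Longrightarrow> V - \<Union>F' \<subset> H \<Longrightarrow> False"

sublocale stuck_family \<subseteq> extremal A V k F H "SOME S. S \<in> F"
proof unfold_locales
  show "H \<noteq> {}" using H3 by auto
  show "(SOME S. S \<in> F) \<in> F" using F_ne by (simp add: some_in_eq)
  fix F' S' assume "fam A V k F'" "V - \<Union>F' \<subset> H"
  then show False by (rule least)
qed (fact big_W big_fam big_H)+

context stuck_family
begin

lemma stuck_family_converse: "stuck_family (A\<inverse>) V k F H"
  by unfold_locales (use W fam H_def H3 F_ne least in auto)

lemma no_spanning_family: "fam A V k G \<Longrightarrow> V \<subseteq> \<Union>G \<Longrightarrow> False"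
  using least[of G] H_ne by blast

text \<open>\<open>H\<close> contains a path from \<open>v\<close> to \<open>u\<close>. As it cannot
  be inserted, its ends use at most \<open>card (\<Union>F)\<close> of the degree sum on the cycles,
  and the remainder lies in \<open>H\<close>.\<close>

lemma H_wood: "woodall A H"
  unfolding woodall_def
proof (intro conjI ballI impI)
  fix u v assume uv: "u \<in> H" "v \<in> H" "u \<noteq> v" "(u, v) \<notin> A"
  obtain p where "pth A p" "set p \<subseteq> H" "hd p = v" "last p = u" using strong uv by metis
  then have "od (A\<inverse>) (\<Union>F) v + od A (\<Union>F) u \<le> card (\<Union>F)" using H_path_sum[of p F] by auto
  moreover have "card V \<le> od A V u + od (A\<inverse>) V v" using woodallD[OF W _ _ uv(3,4)] uv HV by blast
  ultimately show "card H \<le> od A H u + od (A\<inverse>) H v" unfolding od_UH card_UH by linarith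
qed (use finH loopfree in auto)

lemma H_cyclable: "cyclable A H"
  using woodall_hamiltonian[OF H_wood H3] .

lemma card_by_parts: "X \<subseteq> \<Union>F \<Longrightarrow> card X = (\<Sum>S\<in>F. card (X \<inter> S))"
proof -
  assume X: "X \<subseteq> \<Union>F"
  then have "X = (\<Union>S\<in>F. X \<inter> S)" by blast
  moreover have "card (\<Union>S\<in>F. X \<inter> S) = (\<Sum>S\<in>F. card (X \<inter> S))"
    using fam memF(2,5) by (intro card_UN_disjoint) (auto simp: fam_def)
  ultimately show ?thesis by simp
qed

lemma att_part:
  assumes S: "S \<in> F"
  shows "card (AA \<inter> S) + card (BB \<inter> S) \<le> card S"
proof (cases "AA \<inter> S = {} \<or> BB \<inter> S = {}")
  case True
  then show ?thesis using memF(2)[OF S] card_mono[of S "AA \<inter> S"] card_mono[of S "BB \<inter> S"] by auto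
next
  case False
  then obtain x where "AA \<inter> S \<subseteq> {x}" "BB \<inter> S \<subseteq> {x}" using att_bad[OF S] by blast
  then have "card (AA \<inter> S) \<le> 1" "card (BB \<inter> S) \<le> 1" using card_mono[of "{x}"] by fastforce+
  then show ?thesis using cyclable_card memF(4)[OF S] by fastforce
qed

lemma att_rest:
  assumes S: "S \<in> F"
  shows "card AA + card BB + card S \<le> card (\<Union>F) + card (AA \<inter> S) + card (BB \<inter> S)"
proof -
  have f: "finite F" using fam by (simp add: fam_def)
  have "card AA + card BB = (\<Sum>T\<in>F. card (AA \<inter> T) + card (BB \<inter> T))"
    using card_by_parts[OF att_sub(1)] card_by_parts[OF att_sub(2)] by (simp add: sum.distrib)
  also have "\<dots> = card (AA \<inter> S) + card (BB \<inter> S) + (\<Sum>T\<in>F - {S}. card (AA \<inter> T) + card (BB \<inter> T))"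
    using sum.remove[OF f S] by simp
  also have "\<dots> \<le> card (AA \<inter> S) + card (BB \<inter> S) + (\<Sum>T\<in>F - {S}. card T)"
    using att_part by (intro add_left_mono sum_mono) auto
  finally show ?thesis using fam_card[OF fam] sum.remove[OF f S, of card] by simp
qed

lemma card_rest:
  assumes S: "S \<in> F"
  shows "card (\<Union>F) = card (\<Union>(F - {S})) + card S"
proof -
  have "S \<subseteq> \<Union>F" using S by blast
  then show ?thesis using card_Diff_subset[of S "\<Union>F"] card_mono[OF finU, of S] memF(2)[OF S] 
      fam_insertD[OF fam S] by simp
qed

text \<open>\<open>H\<close> takes the place of \<open>S\<close>. The vertices of \<open>S\<close>
  have no arcs to or from \<open>H\<close>, hence so many elsewhere that they can be inserted one by
  one into the other cycles.\<close>

lemma no_isolated: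
  assumes S: "S \<in> F" and e: "AA \<inter> S = {}" "BB \<inter> S = {}"
  shows False
proof -
  have d: "H \<inter> (\<Union>F - S) = {}" using UH by blast
  note n = fam_replace[OF fam S H_cyclable HV d]
  let ?G = "insert H (F - {S})"
  have SH: "S \<inter> \<Union>?G = {}" unfolding n(2) using memF(3)[OF S] by blast
  have US: "\<Union>?G \<union> S = V" unfolding n(2) using UH S by blast
  have "S \<subseteq> \<Union>F" using S by blast
  have "\<exists>G'. fam A V k G' \<and> \<Union>G' = \<Union>?G \<union> S"
  proof (rule insert_vertices[OF n(1) memF(2)[OF S] memF(1)[OF S] SH, of "{H}"])
    fix z assume z: "z \<in> S"
    then have zz: "z \<in> \<Union>F" "z \<notin> AA" "z \<notin> BB" using S e by auto
    have "\<Union>?G - \<Union>{H} = \<Union>F - S" unfolding n(2) using UH by auto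
    then have "card (\<Union>?G - \<Union>{H}) + card S = card (\<Union>F)"
      using card_rest[OF S] fam_insertD[OF fam S] by simp
    moreover have m: "od B (\<Union>F) z \<le> od B V z" for B using od_mono[OF finV UV] .
    have "card AA + card BB + card S \<le> card (\<Union>F)" using att_rest[OF S] unfolding e by simp
    ultimately show "card (\<Union>?G - \<Union>{H}) + 2 * card S \<le>
      od (A\<inverse>) (\<Union>?G \<union> S) z + od A (\<Union>?G \<union> S) z + 1"
      using indeg_not_BB[OF zz(1,3)] outdeg_not_AA[OF zz(1,2)] m[of A] m[of "A\<inverse>"]
      unfolding US by linarith
    fix w assume "w \<in> \<Union>{H}"
    then show "(z, w) \<notin> A \<and> (w, z) \<notin> A" using zz by (auto simp: attached_def)
  qed (use loopfree in auto)
  then show False using no_spanning_family US by auto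
qed

text \<open>Merging two cycles frees a place in the family, which \<open>H\<close> fills.\<close>

lemma no_absorb_cycle:
  assumes "S \<in> F" "D \<in> F" "S \<noteq> D"
  shows "\<not> cyclable A (D \<union> S)"
proof
  assume c: "cyclable A (D \<union> S)"
  have v: "D \<union> S \<subseteq> V" using memF(1) assms by blast
  have d: "H \<inter> (D \<union> S) = {}" "(H \<union> (D \<union> S)) \<inter> (\<Union>F - S - D) = {}"
    using memF(3) assms UH by blast+
  note n = fam_replace2[OF fam assms H_cyclable HV c v d]
  show False by (rule no_spanning_family[OF n(1)]) (unfold n(2), use UH assms in blast)
qed

text \<open>The path \<open>p\<close> left after deleting \<open>x\<close> goes into another cycle
  and \<open>H\<close> replaces \<open>S\<close>, so that only \<open>x\<close> is uncovered. This
  family is again extremal, and its cycle through \<open>p\<close> sends to \<open>x\<close> and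
  receives from \<open>x\<close> at the two distinct ends of \<open>p\<close>, against
  \<open>bad\<close>.\<close>

lemma no_common_attachment:
  assumes S: "S \<in> F" and x: "AA \<inter> S = {x}" "BB \<inter> S = {x}"
  shows False
proof -
  obtain c0 where c0: "cyc A c0" "set c0 = S" using memF(4)[OF S] by (auto simp: cyclable_def)
  have "x \<in> S" using x by blast
  then obtain p where p: "cyc A (x # p)" "set (x # p) = S" using cyc_hdE c0 by metis
  have pne: "p \<noteq> []" using p(1) by (auto simp: cyc_def)
  have pp: "pth A p" using cyc_pthD2[of A "[x]" p] p pne by simp
  have dist: "x \<notin> set p" "distinct p" using cyc_distinct[OF p(1)] by auto
  have Sp: "S = insert x (set p)" using p by auto
  define sg where "sg = hd p"
  define tau where "tau = last p"
  have st: "sg \<in> set p" "tau \<in> set p" using pne by (auto simp: sg_def tau_def)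
  have conn: "(x, sg) \<in> A" "(tau, x) \<in> A"
    using p(1) pne by (auto simp: cyc_def pth_Cons sg_def tau_def)
  have "sg \<noteq> tau"
  proof -
    have "length p \<ge> 2" using p(1) by (simp add: cyc_def)
    then show ?thesis using dist(2) unfolding sg_def tau_def
      by (cases p) (auto split: if_splits simp: Suc_le_eq)
  qed
  have SF: "S \<subseteq> \<Union>F" using S by blast
  have nn: "sg \<in> \<Union>F" "sg \<notin> BB" "tau \<in> \<Union>F" "tau \<notin> AA"
    using st Sp SF x dist by auto
  have "od (A\<inverse>) S sg \<le> card S - 1" "od A S tau \<le> card S - 1"
    using od_le_less[OF memF(2)[OF S], of sg sg "A\<inverse>"] od_le_less[OF memF(2)[OF S], of tau tau A] 
      st Sp loopfree by simp_all
  moreover have "3 \<le> card S" using cyclable_card memF(4)[OF S] by blast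
  moreover have "od B (\<Union>F) u = od B S u + od B (\<Union>(F - {S})) u" for B u
    using od_Diff[OF finU SF] fam_insertD[OF fam S] by metis
  ultimately have "od (A\<inverse>) (\<Union>(F - {S})) sg + od A (\<Union>(F - {S})) tau > card (\<Union>(F - {S}))"
    using indeg_not_BB[OF nn(1,2)] outdeg_not_AA[OF nn(3,4)] att_rest[OF S] card_rest[OF S] x by simp
  then obtain D where D: "D \<in> F - {S}" "od (A\<inverse>) D sg + od A D tau > card D"
    by (rule fam_exists_insertable[OF fam_subset[OF fam Diff_subset]])
  have D': "D \<in> F" "S \<noteq> D" "D \<inter> S = {}" using D(1) memF(5)[OF _ S, of D] by auto
  have c: "cyclable A (D \<union> set p)"
    using insert_path[OF memF(4)[OF D'(1)] pp] D(2) D'(3) Sp unfolding sg_def tau_def by blast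
  have v: "D \<union> set p \<subseteq> V" using memF(1) D' S Sp by blast
  have d: "H \<inter> (D \<union> set p) = {}" "(H \<union> (D \<union> set p)) \<inter> (\<Union>F - S - D) = {}"
    using memF(3) S D' UH Sp by blast+
  note n = fam_replace2[OF fam S D'(1,2) H_cyclable HV c v d]
  let ?G = "insert H (insert (D \<union> set p) (F - {S, D}))"
  have UG: "\<Union>?G = V - {x}" unfolding n(2)
  proof -
    have "x \<notin> H" "x \<notin> D" using memF(3)[OF S] \<open>x \<in> S\<close> D' by blast+
    then show "\<Union>F - S - D \<union> H \<union> (D \<union> set p) = V - {x}" using UH(1) Sp dist(1) SF D'(1) by blast
  qed
  have xV: "x \<in> V" using \<open>x \<in> S\<close> memF(1)[OF S] by blast
  have e: "V - \<Union>?G = {x}" unfolding UG using xV by blast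
  interpret E: extremal A V k ?G "{x}" "D \<union> set p"
  proof unfold_locales
    fix F' assume F': "fam A V k F'" "V - \<Union>F' \<subset> {x}"
    then have "V \<subseteq> \<Union>F'" by blast
    then show False using no_spanning_family[OF F'(1)] by blast
  qed (use W n(1) e in auto)
  have "tau = sg" by (rule E.bad[of "D \<union> set p" tau x sg x]) (use st conn in auto)
  then show False using \<open>sg \<noteq> tau\<close> by simp
qed

lemma types:
  assumes S: "S \<in> F"
  shows "AA \<inter> S \<noteq> {} \<and> BB \<inter> S = {} \<or> AA \<inter> S = {} \<and> BB \<inter> S \<noteq> {}"
proof -
  have "AA \<inter> S = {} \<or> BB \<inter> S = {}"
  proof (rule ccontr)
    assume "\<not> ?thesis"
    then obtain x where "AA \<inter> S = {x}" "BB \<inter> S = {x}" using att_bad[OF S] by blast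
    then show False using no_common_attachment[OF S] by blast
  qed
  then show ?thesis using no_isolated[OF S] by blast
qed

lemma AA_BB: "AA \<inter> BB = {}"
  using types att_sub by blast

lemma card_UU: "card AA + card BB + card UU = card (\<Union>F)"
proof -
  have "card (AA \<union> BB) = card AA + card BB" using AA_BB fin_att by (simp add: card_Un_disjoint)
  moreover have "card (\<Union>F - (AA \<union> BB)) = card (\<Union>F) - card (AA \<union> BB)"
    using att_sub fin_att by (intro card_Diff_subset) auto
  moreover have "card (AA \<union> BB) \<le> card (\<Union>F)" using att_sub finU by (intro card_mono) auto
  ultimately show ?thesis by (simp add: Diff_eq Int_assoc)
qed

lemma deg_sum:
  assumes "x \<in> \<Union>F" "x \<notin> BB" "y \<in> \<Union>F" "y \<notin> AA"
  shows "card (\<Union>F) + card UU + 2 \<le> od (A\<inverse>) (\<Union>F) x + od A (\<Union>F) y"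
  using indeg_not_BB[OF assms(1,2)] outdeg_not_AA[OF assms(3,4)] card_UU by linarith

text \<open>\<open>Q\<close> is the part of \<open>H\<close> spent on connecting cycles. Its at most
  three vertices are exactly paid for by the surplus 2 in \<open>deg_sum\<close> and the 1 in
  \<open>insert_vertices\<close>.\<close>

lemma no_completion:
  assumes G: "fam A V k G" "G0 \<subseteq> G" "\<Union>G0 \<subseteq> H" and R: "R \<subseteq> UU" "R \<inter> \<Union>G = {}"
    and c: "\<Union>F \<subseteq> \<Union>G \<union> R" "\<Union>G - \<Union>G0 \<subseteq> (\<Union>F - R) \<union> Q" 
    and Q: "card Q \<le> 3" "finite Q" and h: "h \<in> \<Union>G" "h \<in> H"
  shows False
proof -
  have finR: "finite R" "R \<subseteq> \<Union>F"
    by (rule finite_subset[OF _ finU]) (use R(1) in auto)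
  have finG: "finite (\<Union>G)" using G(1) fam_fin[OF G(1)] by (auto simp: fam_def)
  have "card (\<Union>G - \<Union>G0) \<le> card (\<Union>F - R) + card Q"
    using card_mono[OF _ c(2)] finU Q(2) card_Un_le[of "\<Union>F - R" Q] by simp
  moreover have "card (\<Union>F - R) + card R = card (\<Union>F)" 
    using finR finU card_mono[of "\<Union>F" R] by (simp add: card_Diff_subset)
  moreover have "card R \<le> card UU" using R(1) finU by (intro card_mono) auto
  ultimately have 1: "card (\<Union>G - \<Union>G0) + 2 * card R \<le> card (\<Union>F) + card UU + 3" using Q(1) by linarith
  have "\<exists>G'. fam A V k G' \<and> \<Union>G' = \<Union>G \<union> R"
  proof (rule insert_vertices[OF G(1) finR(1) _ R(2) G(2)])
    fix z assume z: "z \<in> R"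
    then have zz: "z \<in> \<Union>F" "z \<notin> AA" "z \<notin> BB" using R(1) by auto
    have "od B (\<Union>F) z \<le> od B (\<Union>G \<union> R) z" for B using od_mono[OF _ c(1)] finG finR by simp
    from this[of A] this[of "A\<inverse>"]
    show "card (\<Union>G - \<Union>G0) + 2 * card R \<le> od (A\<inverse>) (\<Union>G \<union> R) z + od A (\<Union>G \<union> R) z + 1"
      using 1 deg_sum[OF zz(1,3,1,2)] by linarith
    fix w assume "w \<in> \<Union>G0"
    then have "w \<in> H" using G(3) by blast
    then show "(z, w) \<notin> A \<and> (w, z) \<notin> A" using zz by (auto simp: attached_def)
  qed (use finR UV loopfree in auto)
  then obtain G' where G': "fam A V k G'" "\<Union>G' = \<Union>G \<union> R" by blast
  have "V - \<Union>G' \<subset> H" by (rule psubset_uncovered[of _ h]) (use c(1) h G' in auto)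
  then show False using least[OF G'(1)] by blast
qed

section \<open>Chords and lengths of the cycles\<close>

text \<open>The start of \<open>W\<close> has an in-neighbour \<open>b\<close> in \<open>BB\<close>,
  on a cycle \<open>T\<close> that only receives from \<open>H\<close>. Entering \<open>T\<close>
  from \<open>H\<close> at the first \<open>BB\<close> vertex after \<open>b\<close> and following
  it up to \<open>b\<close> closes the cycle; the skipped piece \<open>T1\<close> has no arcs to or
  from \<open>H\<close>.\<close>

lemma connect:
  assumes S: "S \<in> F" "BB \<inter> S = {}" and W: "pth A W" "set W \<subseteq> S" "last W \<in> AA"
  obtains T Q T1 T2 where "T \<in> F" "T \<noteq> S" "cyc A (W @ Q @ T2)" "T1 \<subseteq> UU" "T = T1 \<union> set T2" "T1 \<inter> set T2 = {}"
    "set Q \<subseteq> H" "Q \<noteq> []" "length Q \<le> 3"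
proof -
  have Wne: "W \<noteq> []" using W by (simp add: pth_def)
  then have w: "hd W \<in> S" using W by (meson hd_in_set subsetD)
  then have w': "hd W \<in> \<Union>F" "hd W \<notin> BB" using S by auto
  have "\<exists>b\<in>BB. (b, hd W) \<in> A" by (rule in_from_BB[OF w'])
  then obtain b where b: "b \<in> \<Union>F" "(b, hd W) \<in> A" "b \<in> BB" using att_sub by blast
  then obtain T where T: "T \<in> F" "b \<in> T" by blast
  have TS: "T \<noteq> S" using T b S by blast
  have TA: "AA \<inter> T = {}" using types[OF T(1)] b T by blast
  obtain t0 where "cyc A t0" "set t0 = T" using memF(4)[OF T(1)] by (auto simp: cyclable_def)
  then obtain t where t: "cyc A (t @ [b])" "set (t @ [b]) = T" using cyc_lastE T(2) by metis
  have "\<exists>x\<in>set (t @ [b]). x \<in> BB" using b by simp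
  then obtain T1 y T2 where tt: "t @ [b] = T1 @ y # T2" "y \<in> BB" "\<forall>x\<in>set T1. x \<notin> BB"
    using split_list_first_prop[of "t @ [b]" "\<lambda>x. x \<in> BB"] by blast
  have lb: "last (y # T2) = b" using tt(1) by (metis last_appendR last_snoc list.simps(3))
  obtain h where h: "h \<in> H" "(last W, h) \<in> A" using W by (auto simp: attached_def)
  obtain h' where h': "h' \<in> H" "(h', y) \<in> A" using tt by (auto simp: attached_def)
  obtain Q where Q: "pth A Q" "set Q \<subseteq> H" "hd Q = h" "last Q = h'" "length Q \<le> 3"
    using woodall_path_le_3[OF H_wood h(1) h'(1)] by metis
  have Qne: "Q \<noteq> []" using Q by (simp add: pth_def)
  have pT: "pth A (y # T2)" using cyc_pthD2[of A T1 "y # T2"] t(1) tt(1) by simp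
  have T2T: "set (y # T2) \<subseteq> T" "set T1 \<union> set (y # T2) = T" using t(2) tt(1) by auto
  have dT: "set T1 \<inter> set (y # T2) = {}" using cyc_distinct[OF t(1)] unfolding tt(1) by auto
  have ST: "S \<inter> T = {}" using memF(5) S T TS by blast
  have "set W \<inter> set Q = {}" using memF(3)[OF S(1)] Q(2) W(2) by blast
  moreover have "set W \<inter> set (y # T2) = {}" using W(2) T2T(1) ST by blast
  ultimately have d1: "set W \<inter> set (Q @ y # T2) = {}" "set Q \<inter> set (y # T2) = {}"
    using memF(3)[OF T(1)] Q(2) T2T(1) unfolding set_append by blast+
  have "pth A (Q @ y # T2)" using pth_append[of Q "y # T2" A] Qne Q pT d1 h' by simp
  moreover have "(last W, hd (Q @ y # T2)) \<in> A" using Qne Q h by simp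
  moreover have "(last (Q @ y # T2), hd W) \<in> A" using lb b by simp
  moreover have "3 \<le> length W + length (Q @ y # T2)" using Wne Qne by (cases W; cases Q) auto
  ultimately have "cyc A (W @ (Q @ y # T2))" using cyc_path_close[OF W(1)] d1(1) by blast
  moreover have "set T1 \<subseteq> UU"
  proof
    fix x assume x: "x \<in> set T1"
    then have "x \<in> T" using T2T(2) by blast
    then show "x \<in> UU" using x tt(3) TA T(1) by blast
  qed
  ultimately show thesis by (rule that[OF T(1) TS _ _ T2T(2)[symmetric] dT Q(2) Qne Q(5)])
qed

text \<open>A chord of a cycle that sends to \<open>H\<close> splits off a shorter cycle; were the rest able to reach \<open>H\<close>,
  it could be merged through \<open>H\<close> with a cycle that receives from \<open>H\<close>.\<close>
lemma chord:
  assumes S: "S \<in> F" "BB \<inter> S = {}" and c: "cyc A (Z @ W)" "set (Z @ W) = S" "3 \<le> length Z"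
    "(last Z, hd Z) \<in> A"
  shows "set W \<inter> AA = {}"
proof (rule ccontr)
  assume "set W \<inter> AA \<noteq> {}"
  then have "\<exists>x\<in>set W. x \<in> AA" by blast
  \<comment> \<open>Cutting at the last \<open>AA\<close> vertex leaves a piece \<open>W2\<close> of
    \<open>UU\<close> vertices, which \<open>no_completion\<close> can insert.\<close>
  then obtain W1 a W2 where w: "W = W1 @ a # W2" "a \<in> AA" "\<forall>x\<in>set W2. x \<notin> AA"
    using split_list_last_prop[of W "\<lambda>x. x \<in> AA"] by blast
  let ?W = "W1 @ [a]"
  have WW: "W = ?W @ W2" using w by simp
  have dist: "distinct (Z @ ?W @ W2)" using cyc_distinct[OF c(1)] unfolding WW .
  have cZ: "cyclable A (set Z)"
  proof -
    have "pth A Z" using cyc_pthD[OF c(1)] c(3) by force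
    then show ?thesis using c by (intro cyclableI) (simp add: cyc_def)
  qed
  have "pth A W" using cyc_pthD2[OF c(1)] w by simp
  then have pW: "pth A ?W" unfolding WW pth_def by (simp add: successively_append_iff)
  have "set ?W \<subseteq> S" using c w by auto
  then obtain T Q T1 T2 where T: "T \<in> F" "T \<noteq> S" "cyc A (?W @ Q @ T2)" "T1 \<subseteq> UU" "T = T1 \<union> set T2" 
    "T1 \<inter> set T2 = {}" "set Q \<subseteq> H" "Q \<noteq> []" "length Q \<le> 3"
    using connect[OF S pW] w(2) by (metis last_snoc)
  define Gm where "Gm = set ?W \<union> set Q \<union> set T2"
  have cG: "cyclable A Gm" using cyclableI[OF T(3)] unfolding Gm_def by (simp add: Un_assoc)
  have Seq: "S = set Z \<union> set ?W \<union> set W2" using c(2) WW by auto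
  have ST: "S \<inter> T = {}" "S \<subseteq> \<Union>F" "T \<subseteq> \<Union>F" using memF(5) S T by blast+
  have QF: "set Q \<inter> \<Union>F = {}" using T(7) UH by blast
  have dZ: "set Z \<inter> set ?W = {}" "set Z \<inter> set W2 = {}" "set ?W \<inter> set W2 = {}" using dist by auto
  have QS: "set Q \<inter> S = {}" "set Q \<inter> T = {}" using QF ST by blast+
  have sub: "set Z \<subseteq> S" "set ?W \<subseteq> S" "set W2 \<subseteq> S" "T1 \<subseteq> T" "set T2 \<subseteq> T"
    using Seq T(5) by (blast, blast, blast, blast, blast)
  have v: "set Z \<subseteq> V" "Gm \<subseteq> V"
  proof -
    show "set Z \<subseteq> V" using sub(1) memF(1)[OF S(1)] by blast
    have "set ?W \<subseteq> V" "set T2 \<subseteq> V" using sub(2,5) memF(1)[OF S(1)] memF(1)[OF T(1)] by blast+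
    then show "Gm \<subseteq> V" unfolding Gm_def using T(7) HV by blast
  qed
  have dd: "set Z \<inter> set Q = {}" "set W2 \<inter> set Q = {}" "T1 \<inter> set Q = {}"
    using sub(1,3,4) QS by blast+
  have de: "set Z \<inter> set T2 = {}" "set W2 \<inter> set T2 = {}" "T1 \<inter> set Z = {}" "T1 \<inter> set ?W = {}"
    using sub ST(1) by blast+
  have d: "set Z \<inter> Gm = {}" "(set Z \<union> Gm) \<inter> (\<Union>F - S - T) = {}"
  proof -
    show "set Z \<inter> Gm = {}" unfolding Gm_def using dZ(1) dd(1) de(1) by blast
    show "(set Z \<union> Gm) \<inter> (\<Union>F - S - T) = {}" unfolding Gm_def using sub(1,2,5) QF by blast
  qed
  note n = fam_replace2[OF fam S(1) T(1) T(2)[symmetric] cZ v(1) cG v(2) d]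
  let ?R = "set W2 \<union> T1"
  have R: "?R \<subseteq> UU" using w(3) Seq S(2) ST T(4) by blast
  have Rd: "?R \<inter> \<Union>(insert (set Z) (insert Gm (F - {S, T}))) = {}"
  proof -
    have "?R \<inter> set Z = {}" using dZ(2) de(3) by blast
    moreover have "?R \<inter> Gm = {}" unfolding Gm_def using dZ(3) dd(2,3) de(2,4) T(6) by blast
    moreover have "?R \<inter> (\<Union>F - S - T) = {}" using sub(3,4) by blast
    ultimately show ?thesis unfolding n(2) by blast
  qed
  have "last Q \<in> set Q" using T(8) by simp
  show False
  proof (rule no_completion[OF n(1), of "{}" ?R "set Q" "last Q"])
    show "\<Union>F \<subseteq> \<Union>(insert (set Z) (insert Gm (F - {S, T}))) \<union> ?R"
      unfolding n(2) unfolding Gm_def using Seq T(5) by blast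
    have "\<Union>F - S - T \<subseteq> \<Union>F - ?R" using sub(3,4) by blast
    moreover have "set Z \<subseteq> \<Union>F - ?R" using sub(1) ST(2) dZ(2) de(3) by blast
    moreover have "set ?W \<subseteq> \<Union>F - ?R" using sub(2) ST(2) dZ(3) de(4) by blast
    moreover have "set T2 \<subseteq> \<Union>F - ?R" using sub(5) ST(3) de(2) T(6) by blast
    ultimately have "\<Union>F - S - T \<union> set Z \<union> Gm \<subseteq> \<Union>F - ?R \<union> set Q" unfolding Gm_def by blast
    then show "\<Union>(insert (set Z) (insert Gm (F - {S, T}))) - \<Union>{} \<subseteq> \<Union>F - ?R \<union> set Q"
      unfolding n(2) by simp
    show "card (set Q) \<le> 3" using T(9) card_length[of Q] by linarith
    show "last Q \<in> \<Union>(insert (set Z) (insert Gm (F - {S, T})))"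
      unfolding n(2) unfolding Gm_def using \<open>last Q \<in> set Q\<close> by blast
    show "last Q \<in> H" using \<open>last Q \<in> set Q\<close> T(7) by blast
  qed (use R Rd in auto)
qed

text \<open>The cycle opened between two such vertices is a path that no other cycle can absorb, so
  by \<open>deg_sum\<close> its ends need \<open>card S + 4\<close> arcs from and to
  \<open>S\<close>. Fix an \<open>AA\<close> vertex \<open>a\<close> on it: by \<open>chord\<close>,
  the start receives only from its successor and from \<open>a\<close> onwards, the end sends only
  to its predecessor and up to \<open>a\<close>, at most \<open>card S + 3\<close> arcs in
  all.\<close>

lemma no_adjacent_UU:
  assumes S: "S \<in> F" "BB \<inter> S = {}" and c: "cyc A c" "set c = S"
  shows "\<not> (hd c \<in> UU \<and> last c \<in> UU)"
proof
  assume u: "hd c \<in> UU \<and> last c \<in> UU"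
  have SF: "S \<subseteq> \<Union>F" using S by blast
  have cne: "c \<noteq> []" and pc: "pth A c" using c by (auto simp: cyc_def)
  have rest: "od (A\<inverse>) D (hd c) + od A D (last c) \<le> card D" if "D \<in> F - {S}" for D
    using no_absorb_cycle[OF S(1), of D] insert_path[OF memF(4) pc, of D] that c memF(5)[OF S(1), of D]
    by (metis DiffD1 DiffD2 singletonI not_le)
  then have "od (A\<inverse>) (\<Union>(F - {S})) (hd c) + od A (\<Union>(F - {S})) (last c) \<le> card (\<Union>(F - {S}))"
    using fam_exists_insertable[OF fam_subset[OF fam, of "F - {S}"]] by (metis Diff_subset not_le)
  moreover have "od B (\<Union>F) w = od B S w + od B (\<Union>(F - {S})) w" for B w
    using od_Diff[OF finU SF] fam_insertD[OF fam S(1)] by metis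
  moreover have "card (\<Union>F) + card UU + 2 \<le> od (A\<inverse>) (\<Union>F) (hd c) + od A (\<Union>F) (last c)"
    using deg_sum u by blast
  moreover have "2 \<le> card UU"
  proof -
    have "hd c \<noteq> last c"
      using c(1) by (cases c) (auto simp: cyc_def pth_def split: if_splits)
    then show ?thesis using u finU card_mono[of UU "{hd c, last c}"] by auto
  qed
  ultimately have ge: "card S + 4 \<le> od (A\<inverse>) S (hd c) + od A S (last c)"
    using card_rest[OF S(1)] by simp
  obtain a where a: "a \<in> AA" "a \<in> S" using types[OF S(1)] S(2) by blast
  then obtain X Y where XY: "c = X @ a # Y" using c by (metis split_list)
  have "od (A\<inverse>) S (hd c) \<le> card (insert (c ! 1) (set (a # Y)))"
  proof (rule od_le_card)
    fix x assume x: "x \<in> S" "(hd c, x) \<in> A\<inverse>"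
    show "x \<in> insert (c ! 1) (set (a # Y))"
    proof (rule ccontr)
      assume n: "x \<notin> insert (c ! 1) (set (a # Y))"
      then have "x \<in> set X" using x c XY by auto
      then obtain X1 X2 where X: "X = X1 @ x # X2" by (meson split_list)
      let ?Z = "X1 @ [x]" and ?W = "X2 @ a # Y"
      have cZ: "c = ?Z @ ?W" using XY X by simp
      have cr: "cyc A (?Z @ ?W)" using c(1) cZ by simp
      have "set (?Z @ ?W) = S" using cZ c(2) by simp
      moreover have "hd ?Z = hd c" using cZ by (cases X1) simp_all
      then have "(last ?Z, hd ?Z) \<in> A" using x by simp
      ultimately have "set ?W \<inter> AA = {}" if "3 \<le> length ?Z" using chord[OF S cr _ that] by blast
      moreover have "a \<in> set ?W" by simp
      ultimately have "\<not> 3 \<le> length ?Z" using a(1) by blast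
      then have "length X1 \<le> 1" by simp
      then consider "X1 = []" | y where "X1 = [y]" by (cases X1) auto
      then show False using n x cZ loopfree by cases auto
    qed
  qed simp
  also have "\<dots> \<le> length Y + 2" using card_length[of "c ! 1 # a # Y"] by simp
  finally have 1: "od (A\<inverse>) S (hd c) \<le> length Y + 2" .
  have "od A S (last c) \<le> card (insert (last (butlast c)) (set (a # X)))"
  proof (rule od_le_card)
    fix x assume x: "x \<in> S" "(last c, x) \<in> A"
    show "x \<in> insert (last (butlast c)) (set (a # X))"
    proof (rule ccontr)
      assume n: "x \<notin> insert (last (butlast c)) (set (a # X))"
      then have "x \<in> set Y" using x c XY by auto
      then obtain X1 X2 where X: "Y = X1 @ x # X2" by (meson split_list)
      let ?Z = "x # X2" and ?W = "X @ a # X1"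
      have cZ: "c = ?W @ ?Z" using XY X by simp
      then have cr: "cyc A (?Z @ ?W)" using c(1) cyc_rotate by metis
      have "set (?Z @ ?W) = S" using cZ c(2) by auto
      moreover have "(last ?Z, hd ?Z) \<in> A" using x cZ by simp
      ultimately have "set ?W \<inter> AA = {}" if "3 \<le> length ?Z" using chord[OF S cr _ that] by blast
      moreover have "a \<in> set ?W" by simp
      ultimately have "\<not> 3 \<le> length ?Z" using a(1) by blast
      then have "length X2 \<le> 1" by simp
      then consider "X2 = []" | y where "X2 = [y]" by (cases X2) auto
      then show False using n x cZ loopfree by cases (auto simp: butlast_append)
    qed
  qed simp
  also have "\<dots> \<le> length X + 2" using card_length[of "last (butlast c) # a # X"] by simp
  finally have "od A S (last c) \<le> length X + 2" .
  moreover have "card S = length X + length Y + 1" using cyc_card[OF c(1)] c(2) XY by simp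
  ultimately show False using 1 ge by linarith
qed

text \<open>By \<open>chord\<close> the piece outside consists of \<open>UU\<close> vertices, and no
  two of these are consecutive.\<close>

lemma UU_block:
  assumes S: "S \<in> F" "BB \<inter> S = {}" and c: "cyc A (Z @ W)" "set (Z @ W) = S" "3 \<le> length Z"
    "(last Z, hd Z) \<in> A"
  shows "length W \<le> 1"
proof (rule ccontr)
  assume "\<not> ?thesis"
  then obtain x y W' where W: "W = x # y # W'" by (cases W; cases "tl W") auto
  have "cyc A ((y # W') @ (Z @ [x]))" using cyc_rotate[of A "Z @ [x]" "y # W'"] c(1) W by simp
  then have "\<not> (y \<in> UU \<and> x \<in> UU)" using no_adjacent_UU[OF S, of "(y # W') @ (Z @ [x])"] c(2) W by auto
  moreover have "x \<notin> AA" "y \<notin> AA" using chord[OF S c] W by auto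
  moreover have "x \<in> S" "y \<in> S" using c(2) W by auto
  ultimately show False using S by blast
qed

text \<open>A chord either forms a digon with the predecessor or closes a cycle that misses at most
  one vertex; besides the successor this leaves only the vertex after it.\<close>

lemma last_out:
  assumes S: "S \<in> F" "BB \<inter> S = {}" and c: "cyc A c" "set c = S" and y: "y \<in> S" "(last c, y) \<in> A"
  shows "y \<in> {c ! 0, c ! 1, c ! (length c - 2)}"
proof -
  obtain W Z where W: "c = W @ y # Z" using y(1) c(2) by (metis split_list)
  then have cr: "cyc A ((y # Z) @ W)" using c(1) cyc_rotate by metis
  have l: "(last (y # Z), hd (y # Z)) \<in> A" using y(2) W by simp
  have "length (y # Z) = 2 \<or> length W \<le> 1"
  proof -
    have "Z \<noteq> []" using y W loopfree by auto
    moreover have "length W \<le> 1" if "3 \<le> length (y # Z)"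
      by (rule UU_block[OF S cr _ that l]) (use c W in auto)
    ultimately show ?thesis by (cases Z) (auto simp: Suc_le_eq)
  qed
  then show ?thesis
  proof
    assume "length (y # Z) = 2"
    then show ?thesis unfolding W by (auto simp: nth_append)
  next
    assume "length W \<le> 1"
    then consider "W = []" | x where "W = [x]" by (cases W) auto
    then show ?thesis unfolding W by cases auto
  qed
qed

lemma hd_in:
  assumes S: "S \<in> F" "BB \<inter> S = {}" and c: "cyc A c" "set c = S" and y: "y \<in> S" "(y, hd c) \<in> A"
  shows "y \<in> {c ! 1, c ! (length c - 1), c ! (length c - 2)}"
proof -
  obtain Z W where W: "c = Z @ y # W" using y(1) c(2) by (metis split_list)
  let ?Z = "Z @ [y]"
  have cr: "cyc A (?Z @ W)" using c(1) W by simp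
  have l: "(last ?Z, hd ?Z) \<in> A" using y(2) W by (cases Z) auto
  have "length ?Z = 2 \<or> length W \<le> 1"
  proof -
    have "Z \<noteq> []" using y W loopfree by auto
    moreover have "length W \<le> 1" if "3 \<le> length ?Z"
      by (rule UU_block[OF S cr _ that l]) (use c W in auto)
    ultimately show ?thesis by (cases Z) (auto simp: Suc_le_eq)
  qed
  then show ?thesis
  proof
    assume "length ?Z = 2"
    then show ?thesis unfolding W by (auto simp: nth_append)
  next
    assume "length W \<le> 1"
    then consider "W = []" | x where "W = [x]" by (cases W) auto
    then show ?thesis unfolding W by cases (auto simp: nth_append)
  qed
qed

text \<open>On a longer cycle the pairs at distance three are non-arcs; summing the degree condition over
  all of them contradicts the sparsity of chords.\<close>
lemma card_le_6:
  assumes S: "S \<in> F" "BB \<inter> S = {}"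
  shows "card S \<le> 6"
proof (rule ccontr)
  assume large: "\<not> ?thesis"
  obtain c where c: "cyc A c" "set c = S" using memF(4)[OF S(1)] by (auto simp: cyclable_def)
  define s where "s = length c"
  have s: "card S = s" "7 \<le> s" using cyc_card[OF c(1)] c large by (auto simp: s_def)
  have dc: "distinct c" using cyc_distinct c by blast
  have cr: "cyc A (rotate j c)" "set (rotate j c) = S" "length (rotate j c) = s" for j
    using cyc_rotate_n[OF c(1)] c by (auto simp: s_def)
  have cne: "rotate j c \<noteq> []" for j using cr(3)[of j] s by auto
  have hl: "hd (rotate j c) = rotate j c ! 0" "last (rotate j c) = rotate j c ! (s - 1)" for j
    using cne[of j] cr(3)[of j] by (auto simp: hd_conv_nth last_conv_nth)
  have sumr: "(\<Sum>j<s. f (rotate j c ! i)) = (\<Sum>x\<in>S. f x)" if "i < s" for f :: "'a \<Rightarrow> nat" and i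
    using sum_rotate_nth[OF dc, of i f] that c(2) s_def by simp
  have SF: "S \<subseteq> \<Union>F" using S by blast
  have fS: "finite S" using memF S by blast
  have dd: "card {a, b, d} \<le> 3" for a b d :: 'a
    using card_length[of "[a, b, d]"] by simp
  have out3: "od A S x \<le> 3" if x: "x \<in> S" for x
  proof -
    obtain c' where c': "cyc A (c' @ [x])" "set (c' @ [x]) = S" using cyc_lastE c x by metis
    have "od A S x \<le> card {(c' @ [x]) ! 0, (c' @ [x]) ! 1, (c' @ [x]) ! (length (c' @ [x]) - 2)}"
      using last_out[OF S c'] by (intro od_le_card) auto
    then show ?thesis using dd le_trans by blast
  qed
  have in3: "od (A\<inverse>) S x \<le> 3" if x: "x \<in> S" for x
  proof -
    obtain c' where c': "cyc A (x # c')" "set (x # c') = S" using cyc_hdE c x by metis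
    have "od (A\<inverse>) S x \<le> card {(x # c') ! 1, (x # c') ! (length (x # c') - 1), (x # c') ! (length (x # c') - 2)}"
      using hd_in[OF S c'] by (intro od_le_card) auto
    then show ?thesis using dd le_trans by blast
  qed
  have rest: "od (A\<inverse>) (\<Union>(F - {S})) (rotate j c ! 0) + od A (\<Union>(F - {S})) (rotate j c ! (s - 1)) 
    \<le> card (\<Union>(F - {S}))" for j
  proof -
    have "od (A\<inverse>) D (hd (rotate j c)) + od A D (last (rotate j c)) \<le> card D" if "D \<in> F - {S}" for D
      using no_absorb_cycle[OF S(1), of D] insert_path[OF memF(4), of D "rotate j c"] that cr[of j]
        memF(5)[OF S(1), of D]
      by (metis DiffD1 DiffD2 singletonI not_le cyc_def)
    then show ?thesis unfolding hl
      using fam_exists_insertable[OF fam_subset[OF fam, of "F - {S}"]] by (metis Diff_subset not_le)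
  qed
  \<comment> \<open>Positions \<open>s - 1\<close> and 2 are three steps apart around the cycle, and
    for \<open>s \<ge> 7\<close> this target is none of the three that \<open>last_out\<close>
    allows.\<close>
  have nonarc: "card V \<le> od A V (rotate j c ! (s - 1)) + od (A\<inverse>) V (rotate j c ! 2)" for j
  proof -
    have ne: "rotate j c ! a \<noteq> rotate j c ! b" if "a < s" "b < s" "a \<noteq> b" for a b
      using nth_eq_iff_index_eq[of "rotate j c" a b] that dc cr(3)[of j] by auto
    have inS: "rotate j c ! a \<in> S" if "a < s" for a using that cr(2,3)[of j] nth_mem by metis
    have "(rotate j c ! (s - 1), rotate j c ! 2) \<notin> A"
    proof
      assume "(rotate j c ! (s - 1), rotate j c ! 2) \<in> A"
      then have "rotate j c ! 2 \<in> {rotate j c ! 0, rotate j c ! 1, rotate j c ! (s - 2)}"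
        using last_out[OF S cr(1,2)[of j], of "rotate j c ! 2"] inS[of 2] s hl[of j] cr(3)[of j] by auto
      then show False using ne[of 2 0] ne[of 2 1] ne[of 2 "s - 2"] s by auto
    qed
    moreover have "rotate j c ! (s - 1) \<noteq> rotate j c ! 2" using ne[of "s - 1" 2] s by simp
    moreover have "rotate j c ! (s - 1) \<in> V" "rotate j c ! 2 \<in> V"
      using inS[of "s - 1"] inS[of 2] s memF(1)[OF S(1)] by auto
    ultimately show ?thesis using woodallD[OF W] by blast
  qed
  have split: "od B V x = od B S x + od B (\<Union>(F - {S})) x + od B H x" for B x
    using od_UH od_Diff[OF finU SF] fam_insertD[OF fam S(1)] by metis
  have "s * card V = (\<Sum>j<s. card V)" by simp
  also have "\<dots> \<le> (\<Sum>j<s. od A V (rotate j c ! (s - 1)) + od (A\<inverse>) V (rotate j c ! 2))"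
    using nonarc by (intro sum_mono) auto
  also have "\<dots> = (\<Sum>x\<in>S. od A V x) + (\<Sum>x\<in>S. od (A\<inverse>) V x)"
    using s sumr[of "s - 1" "od A V"] sumr[of 2 "od (A\<inverse>) V"] by (simp add: sum.distrib)
  also have "\<dots> = (\<Sum>x\<in>S. od A S x + od (A\<inverse>) S x) + 
     ((\<Sum>x\<in>S. od (A\<inverse>) (\<Union>(F - {S})) x) + (\<Sum>x\<in>S. od A (\<Union>(F - {S})) x))
     + (\<Sum>x\<in>S. od A H x + od (A\<inverse>) H x)"
    unfolding split by (simp add: sum.distrib)
  \<comment> \<open>Six is three out-neighbours plus three in-neighbours inside \<open>S\<close>;
    the middle term holds because the cycle, opened anywhere, cannot be inserted elsewhere;
    \<open>S\<close> receives nothing from \<open>H\<close>, so only sending counts in the last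
    term.\<close>
  also have "\<dots> \<le> 6 * s + s * card (\<Union>(F - {S})) + s * card H"
  proof (intro add_mono)
    show "(\<Sum>x\<in>S. od A S x + od (A\<inverse>) S x) \<le> 6 * s"
      using sum_bounded_above[of S "\<lambda>x. od A S x + od (A\<inverse>) S x" 6] add_mono[OF out3 in3] s by force
    have "(\<Sum>x\<in>S. od (A\<inverse>) (\<Union>(F - {S})) x) + (\<Sum>x\<in>S. od A (\<Union>(F - {S})) x) =
      (\<Sum>j<s. od (A\<inverse>) (\<Union>(F - {S})) (rotate j c ! 0) + od A (\<Union>(F - {S})) (rotate j c ! (s - 1)))"
      using s sumr[of "s - 1" "od A (\<Union>(F - {S}))"] sumr[of 0 "od (A\<inverse>) (\<Union>(F - {S}))"]
      by (simp add: sum.distrib)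
    also have "\<dots> \<le> (\<Sum>j<s. card (\<Union>(F - {S})))" using rest by (intro sum_mono) auto
    finally show "(\<Sum>x\<in>S. od (A\<inverse>) (\<Union>(F - {S})) x) + (\<Sum>x\<in>S. od A (\<Union>(F - {S})) x) \<le>
       s * card (\<Union>(F - {S}))" by simp
    have "od A H x + od (A\<inverse>) H x \<le> card H" if "x \<in> S" for x
    proof -
      have "x \<notin> BB" "x \<in> \<Union>F" using that S by auto
      then have "od (A\<inverse>) H x = 0" by (auto simp: od_eq_0 finH attached_def)
      then show ?thesis using od_le[OF finH, of A x] by simp
    qed
    then show "(\<Sum>x\<in>S. od A H x + od (A\<inverse>) H x) \<le> s * card H"
      using sum_bounded_above[of S "\<lambda>x. od A H x + od (A\<inverse>) H x" "card H"] s by simp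
  qed
  finally have "s * card V \<le> s * (6 + card (\<Union>(F - {S})) + card H)" by (simp add: algebra_simps)
  then have "card V \<le> 6 + card (\<Union>(F - {S})) + card H" using s by simp
  then show False using card_UH card_rest[OF S(1)] s by simp
qed

text \<open>Merging a sending cycle with a receiving one through \<open>H\<close> frees a place,
  which a second cycle inside \<open>H\<close> fills. Two such cycles give \<open>k \<ge> 2\<close>,
  so at least \<open>6 * k + 3 \<ge> 15\<close> vertices lie in \<open>H\<close>, enough for
  \<open>cycle_avoiding_few\<close>.\<close>

lemma stuck_family_impossible:
  assumes n: "12 * k + 3 \<le> card V"
  shows False
proof -
  obtain S1 where S1: "S1 \<in> F" using F_ne by blast
  then obtain x where x: "x \<in> \<Union>F" using cyclable_ne memF(4) by blast
  have "AA \<noteq> {}"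
  proof
    assume AA: "AA = {}"
    then have "card (\<Union>F) + 1 \<le> od A (\<Union>F) x" using outdeg_not_AA[OF x] by simp
    then show False using od_le[OF finU, of A x] by linarith
  qed
  then obtain a where a: "a \<in> AA" by blast
  then obtain S where S: "S \<in> F" "a \<in> S" using att_sub by blast
  have SB: "BB \<inter> S = {}" using types[OF S(1)] a S(2) by blast
  obtain c0 where "cyc A c0" "set c0 = S" using memF(4)[OF S(1)] by (auto simp: cyclable_def)
  then obtain c where c: "cyc A (c @ [a])" "set (c @ [a]) = S" using cyc_lastE S(2) by metis
  let ?W = "c @ [a]"
  have pW: "pth A ?W" using c by (simp add: cyc_def)
  have "set ?W \<subseteq> S" "last ?W \<in> AA" using c a by simp_all
  then obtain T Q T1 T2 where T: "T \<in> F" "T \<noteq> S" "cyc A (?W @ Q @ T2)" "T1 \<subseteq> UU" "T = T1 \<union> set T2" 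
    "T1 \<inter> set T2 = {}" "set Q \<subseteq> H" "Q \<noteq> []" "length Q \<le> 3"
    using connect[OF S(1) SB pW] by metis
  have finF: "finite F" "card F = k" using fam by (auto simp: fam_def)
  have "card {S, T} \<le> card F" using S T finF by (intro card_mono) auto
  then have k: "2 \<le> k" using T(2) finF by (simp add: card_insert_if split: if_splits)
  have "card D \<le> 6" if D: "D \<in> F" for D
    using types[OF D] card_le_6[OF D] stuck_family.card_le_6[OF stuck_family_converse D] by auto
  then have "card (\<Union>F) \<le> 6 * k"
    unfolding fam_card[OF fam] using sum_bounded_above[of F card 6] finF by (simp add: mult.commute)
  then have m: "15 \<le> card H" using n k card_UH by linarith
  have cQ: "card (set Q) \<le> 3" using T(9) card_length[of Q] by linarith
  obtain Z where Z: "Z \<subseteq> H - set Q" "cyclable A Z" using cycle_avoiding_few[OF H_wood m T(7) cQ] .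
  define Gm where "Gm = S \<union> set Q \<union> set T2"
  have cG: "cyclable A Gm" using cyclableI[OF T(3)] unfolding Gm_def c(2)[symmetric] by (simp add: Un_assoc)
  have ST: "S \<inter> T = {}" "S \<subseteq> \<Union>F" "T \<subseteq> \<Union>F" using memF(5) S T by blast+
  have sub: "T1 \<subseteq> T" "set T2 \<subseteq> T" using T(5) by blast+
  have v: "Gm \<subseteq> V" "Z \<subseteq> V" unfolding Gm_def
    using memF(1)[OF S(1)] memF(1)[OF T(1)] sub(2) T(7) HV Z(1) by blast+
  have ZF: "Z \<inter> \<Union>F = {}" "set Q \<inter> \<Union>F = {}" using Z(1) T(7) UH(2) by blast+
  have d1: "Gm \<inter> Z = {}" unfolding Gm_def using ZF(1) ST(2,3) sub(2) Z(1) by blast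
  have d2: "(Gm \<union> Z) \<inter> (\<Union>F - S - T) = {}" unfolding Gm_def using ZF sub(2) by blast
  note n = fam_replace2[OF fam S(1) T(1) T(2)[symmetric] cG v(1) Z(2) v(2) d1 d2]
  let ?G = "insert Gm (insert Z (F - {S, T}))"
  have lQ: "last Q \<in> set Q" using T(8) by simp
  show False
  proof (rule no_completion[OF n(1), of "{Z}" T1 "set Q" "last Q"])
    show "T1 \<inter> \<Union>?G = {}"
    proof -
      have "T1 \<inter> Z = {}" using sub(1) ST(3) ZF(1) by blast
      moreover have "T1 \<inter> S = {}" "T1 \<inter> set Q = {}" using sub(1) ST ZF(2) by blast+
      ultimately have "T1 \<inter> (Gm \<union> Z) = {}" unfolding Gm_def using T(6) by blast
      moreover have "T1 \<inter> (\<Union>F - S - T) = {}" using sub(1) by blast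
      ultimately show ?thesis unfolding n(2) by blast
    qed
    show "\<Union>F \<subseteq> \<Union>?G \<union> T1" unfolding n(2) unfolding Gm_def T(5) by blast
    have "S \<subseteq> \<Union>F - T1" using ST sub(1) by blast
    moreover have "set T2 \<subseteq> \<Union>F - T1" using ST(3) sub(2) T(6) by blast
    moreover have "\<Union>F - S - T \<subseteq> \<Union>F - T1" using sub(1) by blast
    ultimately show "\<Union>?G - \<Union>{Z} \<subseteq> \<Union>F - T1 \<union> set Q" unfolding n(2) unfolding Gm_def by blast
    show "last Q \<in> \<Union>?G" unfolding n(2) unfolding Gm_def using lQ by blast
    show "last Q \<in> H" using lQ T(7) by blast
  qed (use Z(1) T(4) cQ in auto)
qed

end

section \<open>Packing short cycles\<close>

lemma od_sum: "finite X \<Longrightarrow> od A X u = (\<Sum>x\<in>X. if (u, x) \<in> A then 1 else 0)"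
  unfolding od_def card_eq_sum by (rule sum.inter_filter)

lemma two_elements: "finite X \<Longrightarrow> 2 \<le> card X \<Longrightarrow> \<exists>c\<in>X. \<exists>d\<in>X. c \<noteq> d"
  using card_le_Suc0_iff_eq[of X] by fastforce

text \<open>A vertex outside a digon without directed triangles through it has at most two arcs
  to and from the digon, so deleting digons one by one gives the bound.\<close>
lemma triangle_free_arcs:
  assumes "finite W" "\<And>v. (v, v) \<notin> A"
    and "\<And>x y z. x \<in> W \<Longrightarrow> y \<in> W \<Longrightarrow> z \<in> W \<Longrightarrow> (x, y) \<in> A \<Longrightarrow> (y, z) \<in> A \<Longrightarrow> (z, x) \<in> A \<Longrightarrow> False"
  shows "2 * (\<Sum>x\<in>W. od A W x) \<le> card W * card W"
  using assms
proof (induction "card W" arbitrary: W rule: less_induct)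
  case less
  note fin = less.prems(1)
  show ?case
  proof (cases "W = {}")
    case False
    have "\<exists>D. D \<subseteq> W \<and> D \<noteq> {} \<and> (\<Sum>z\<in>W - D. od A D z) + (\<Sum>x\<in>D. od A (W - D) x) \<le> card D * card (W - D)
        \<and> 2 * (\<Sum>x\<in>D. od A D x) \<le> card D * card D"
    proof (cases "\<exists>x\<in>W. \<exists>y\<in>W. (x, y) \<in> A \<and> (y, x) \<in> A")
      case True
      then obtain x y where xy: "x \<in> W" "y \<in> W" "(x, y) \<in> A" "(y, x) \<in> A" by blast
      have ne: "x \<noteq> y" using xy less.prems(2) by auto
      have f: "finite (W - {x, y})" using fin by simp
      have "(\<Sum>z\<in>W - {x, y}. od A {x, y} z) + (\<Sum>u\<in>{x, y}. od A (W - {x, y}) u)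
        = (\<Sum>z\<in>W - {x, y}. od A {x, y} z + ((if (x, z) \<in> A then 1 else 0) + (if (y, z) \<in> A then 1 else 0)))"
        using ne by (simp add: od_sum[OF f] sum.distrib)
      also have "\<dots> \<le> (\<Sum>z\<in>W - {x, y}. 2)"
        using less.prems(3)[of x _ y] less.prems(3)[of y _ x] xy ne
        by (intro sum_mono) (auto simp: od_insert od_single)
      also have "\<dots> = card {x, y} * card (W - {x, y})" using ne by simp
      finally show ?thesis using xy ne less.prems(2)
        by (intro exI[of _ "{x, y}"]) (auto simp: od_insert od_single)
    next
      case nodigon: False
      obtain x where x: "x \<in> W" using False by blast
      have f: "finite (W - {x})" using fin by simp
      have "(\<Sum>z\<in>W - {x}. od A {x} z) + od A (W - {x}) x
        = (\<Sum>z\<in>W - {x}. od A {x} z + (if (x, z) \<in> A then 1 else 0))"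
        by (simp add: od_sum[OF f] sum.distrib)
      also have "\<dots> \<le> (\<Sum>z\<in>W - {x}. 1)"
        using nodigon x by (intro sum_mono) (auto simp: od_single)
      finally show ?thesis using x less.prems(2)
        by (intro exI[of _ "{x}"]) (auto simp: od_single)
    qed
    then obtain D where D: "D \<subseteq> W" "D \<noteq> {}"
      "(\<Sum>z\<in>W - D. od A D z) + (\<Sum>x\<in>D. od A (W - D) x) \<le> card D * card (W - D)"
      "2 * (\<Sum>x\<in>D. od A D x) \<le> card D * card D" by blast
    have fD: "finite D" using D fin finite_subset by blast
    have cW: "card W = card D + card (W - D)" using D(1) fin fD card_mono[of W D] by (simp add: card_Diff_subset)
    moreover have "card D > 0" using D(2) fD by (simp add: card_gt_0_iff)
    ultimately have "2 * (\<Sum>x\<in>W - D. od A (W - D) x) \<le> card (W - D) * card (W - D)"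
      using less.hyps[of "W - D"] less.prems by auto
    moreover have "(\<Sum>x\<in>W. od A W x) = (\<Sum>x\<in>W - D. od A D x + od A (W - D) x) + (\<Sum>x\<in>D. od A D x + od A (W - D) x)"
      using sum.subset_diff[OF D(1) fin, of "od A W"] od_Diff[OF fin D(1), of A] by simp
    ultimately have "2 * (\<Sum>x\<in>W. od A W x) \<le>
       card (W - D) * card (W - D) + 2 * (card D * card (W - D)) + card D * card D"
      using D(3,4) by (simp add: sum.distrib)
    then show ?thesis unfolding cW by (simp add: algebra_simps)
  qed simp
qed

section \<open>Digraphs without directed triangles and four-cycles\<close>

text \<open>\<open>H\<close> stands for what a greatest packing leaves, and \<open>e\<close> for the
  loss when the degree condition is restricted to \<open>H\<close>. This loss is controlled only for
  the ends of short paths that avoid the exceptional set \<open>X\<close>.\<close>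

locale sparse =
  fixes A :: "('a \<times> 'a) set" and H X e
  assumes finH: "finite H" and XH: "X \<subseteq> H" and e1: "1 \<le> e" and loopfree: "\<And>v. (v, v) \<notin> A"
    and no3: "\<And>x y z. x \<in> H \<Longrightarrow> y \<in> H \<Longrightarrow> z \<in> H \<Longrightarrow> (x, y) \<in> A \<Longrightarrow> (y, z) \<in> A \<Longrightarrow> (z, x) \<in> A \<Longrightarrow> False"
    and no4: "\<And>x y z w. x \<in> H \<Longrightarrow> y \<in> H \<Longrightarrow> z \<in> H \<Longrightarrow> w \<in> H \<Longrightarrow> x \<noteq> z \<Longrightarrow> y \<noteq> w \<Longrightarrow>
      (x, y) \<in> A \<Longrightarrow> (y, z) \<in> A \<Longrightarrow> (z, w) \<in> A \<Longrightarrow> (w, x) \<in> A \<Longrightarrow> False"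
    and regular: "\<And>P. pth A P \<Longrightarrow> set P \<subseteq> H - X \<Longrightarrow> length P = 2 \<or> length P = 3 \<Longrightarrow> (last P, hd P) \<notin> A \<Longrightarrow>
      card H \<le> od A H (last P) + od (A\<inverse>) H (hd P) + e"
begin

lemma sparse_converse: "sparse (A\<inverse>) H X e"
proof
  fix P assume P: "pth (A\<inverse>) P" "set P \<subseteq> H - X" "length P = 2 \<or> length P = 3" "(last P, hd P) \<notin> A\<inverse>"
  then have "pth A (rev P)" by (simp add: pth_converse)
  then show "card H \<le> od (A\<inverse>) H (last P) + od ((A\<inverse>)\<inverse>) H (hd P) + e"
    using regular[of "rev P"] P by (simp add: hd_rev last_rev)
qed (use finH XH e1 loopfree no3 no4 in \<open>auto 0 3\<close>)

text \<open>Each \<open>x\<close> in \<open>B'\<close> ends a path \<open>v, u, x\<close>, with no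
  arc back to \<open>v\<close> (no triangle) and none into \<open>C\<close> (no four-cycle). The
  degree condition then forces at least \<open>card B + 1 - e - xB\<close> arcs from
  \<open>x\<close> into \<open>B'\<close>, while \<open>triangle_free_arcs\<close> limits their
  average to half of \<open>card B'\<close>.\<close>

lemma one_way_head:
  assumes v: "v \<in> H - X" and u: "u \<in> H - X" and vu: "(v, u) \<in> A" "(u, v) \<notin> A"
  shows "od A H u + 2 \<le> 2 * e + card {w \<in> X. (u, w) \<in> A}"
proof -
  define B where "B = {w \<in> H. (u, w) \<in> A}"
  define C where "C = {w \<in> H. (w, v) \<in> A}"
  define B' where "B' = B - X"
  define xB where "xB = card {w \<in> X. (u, w) \<in> A}"
  have fin: "finite B" "finite C" "finite B'" using finH by (auto simp: B_def C_def B'_def)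
  have b: "od A H u = card B" "od (A\<inverse>) H v = card C" by (auto simp: od_def B_def C_def)
  have xB: "{w \<in> X. (u, w) \<in> A} = B - B'" using XH by (auto simp: B_def B'_def)
  have cB: "card B = card B' + xB" 
    unfolding xB_def xB using fin card_mono[of B B'] by (subst card_Diff_subset) (auto simp: B'_def)
  show ?thesis
  proof (cases "B' = {}")
    case True
    then show ?thesis using b cB e1 unfolding xB_def by simp
  next
    case False
    have BC: "B \<inter> C = {}" using no3[of v u] v u vu by (auto simp: B_def C_def)
    have vn: "v \<notin> B \<union> C" using vu loopfree by (auto simp: B_def C_def)
    have cBC: "card (insert v (B \<union> C)) = card B + card C + 1"
      using vn BC fin by (simp add: card_Un_disjoint)
    have sub: "insert v (B \<union> C) \<subseteq> H" using v by (auto simp: B_def C_def)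
    have main: "card B + 1 \<le> od A B' x + (e + xB)" if x: "x \<in> B'" for x
    proof -
      have xx: "x \<in> H" "x \<notin> X" "(u, x) \<in> A" using x by (auto simp: B'_def B_def)
      have xv: "(x, v) \<notin> A" using no3[of v u x] xx v u vu by auto
      have "pth A [v, u, x]" using vu xx loopfree by (auto simp: pth_def)
      then have "card H \<le> od A H x + od (A\<inverse>) H v + e"
        using regular[of "[v, u, x]"] xx u v xv by auto
      moreover have "od A H x \<le> card ({w \<in> B'. (x, w) \<in> A} \<union> ((B - B') \<union> (H - insert v (B \<union> C))))"
      proof (rule od_le_card)
        fix w assume w: "w \<in> H" "(x, w) \<in> A"
        have "w \<notin> C"
          using no4[of v u x w] w xx v u vu xv by (auto simp: C_def)
        then show "w \<in> {w \<in> B'. (x, w) \<in> A} \<union> ((B - B') \<union> (H - insert v (B \<union> C)))"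
          using w xv by auto
      qed (use fin finH in auto)
      moreover have "card ({w \<in> B'. (x, w) \<in> A} \<union> ((B - B') \<union> (H - insert v (B \<union> C)))) \<le>
         od A B' x + (card (B - B') + card (H - insert v (B \<union> C)))"
        unfolding od_def by (intro order_trans[OF card_Un_le] add_left_mono card_Un_le)
      moreover have "card (B - B') = xB" unfolding xB_def xB ..
      moreover have "card (H - insert v (B \<union> C)) + card B + card C + 1 = card H"
        using cBC sub fin finH card_mono[OF finH sub] by (subst card_Diff_subset) auto
      ultimately show ?thesis unfolding b by linarith
    qed
    have "x \<in> H" if "x \<in> B'" for x using that by (simp add: B'_def B_def)
    then have tri: "2 * (\<Sum>x\<in>B'. od A B' x) \<le> card B' * card B'"
      using triangle_free_arcs[OF fin(3) loopfree] no3 by blast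
    have "card B' * (card B + 1) = (\<Sum>x\<in>B'. card B + 1)" by simp
    also have "\<dots> \<le> (\<Sum>x\<in>B'. od A B' x + (e + xB))" using main by (intro sum_mono)
    also have "\<dots> = (\<Sum>x\<in>B'. od A B' x) + card B' * (e + xB)" by (simp add: sum.distrib)
    finally have "2 * (card B' * (card B + 1)) \<le> card B' * card B' + 2 * (card B' * (e + xB))"
      using tri by (simp add: algebra_simps)
    then have "card B' * (2 * (card B + 1)) \<le> card B' * (card B' + 2 * (e + xB))"
      by (simp add: algebra_simps)
    moreover have "card B' > 0" using False fin by (simp add: card_gt_0_iff)
    ultimately have "2 * (card B + 1) \<le> card B' + 2 * (e + xB)" unfolding mult_le_cancel1 by blast
    then have "card B + 2 \<le> 2 * e + xB" using cB unfolding distrib_left by linarith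
    then show ?thesis unfolding b xB_def .
  qed
qed

text \<open>The two ends contribute at most \<open>2 * e - 2\<close> each, apart from arcs at
  \<open>X\<close>; a vertex of \<open>X\<close> counted for both would close a triangle.\<close>

lemma one_way_bound:
  assumes v: "v \<in> H - X" and u: "u \<in> H - X" and vu: "(v, u) \<in> A" "(u, v) \<notin> A"
  shows "card H + 4 \<le> 5 * e + card X"
proof -
  have "pth A [v, u]" using vu loopfree by (auto simp: pth_def)
  then have "card H \<le> od A H u + od (A\<inverse>) H v + e" using regular[of "[v, u]"] u v vu by auto
  moreover have "od A H u + 2 \<le> 2 * e + card {w \<in> X. (u, w) \<in> A}" by (rule one_way_head[OF assms])
  moreover have "od (A\<inverse>) H v + 2 \<le> 2 * e + card {w \<in> X. (v, w) \<in> A\<inverse>}"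
    by (rule sparse.one_way_head[OF sparse_converse u v]) (use vu in auto)
  moreover have "card {w \<in> X. (u, w) \<in> A} + card {w \<in> X. (v, w) \<in> A\<inverse>} \<le> card X"
  proof -
    have "finite X" using finH XH finite_subset by blast
    moreover have "{w \<in> X. (u, w) \<in> A} \<inter> {w \<in> X. (v, w) \<in> A\<inverse>} = {}"
      using no3[of v u] v u vu XH by auto
    ultimately show ?thesis using card_mono[of X "{w \<in> X. (u, w) \<in> A} \<union> {w \<in> X. (v, w) \<in> A\<inverse>}"]
      by (subst card_Un_disjoint[symmetric]) auto
  qed
  ultimately show ?thesis by linarith
qed

text \<open>For the path \<open>c, a, d\<close>, the out-neighbours of \<open>d\<close> and the
  in-neighbours of \<open>c\<close> share at most \<open>a\<close> (no four-cycle) and avoid the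
  neighbours of \<open>a\<close> (no triangle). As they number at least \<open>card H - e\<close> in
  total, at most \<open>e + 1\<close> neighbours of \<open>a\<close> remain.\<close>

lemma two_neighbours:
  assumes sym: "\<And>x y. x \<in> H - X \<Longrightarrow> y \<in> H - X \<Longrightarrow> (x, y) \<in> A \<Longrightarrow> (y, x) \<in> A"
    and a: "a \<in> H - X" and c: "c \<in> H - X" "d \<in> H - X" "c \<noteq> d" "(a, c) \<in> A" "(a, d) \<in> A"
  shows "od A (H - X) a \<le> e + 1" and "card H \<le> od A (H - X) c + od A (H - X) d + card X + e"
proof -
  have s: "(c, a) \<in> A" "(d, a) \<in> A" using sym a c by auto
  have "pth A [c, a, d]" using c s loopfree by (auto simp: pth_def)
  moreover have cd: "(d, c) \<notin> A" using no3[of a d c] a c s by auto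
  ultimately have r: "card H \<le> od A H d + od (A\<inverse>) H c + e" using regular[of "[c, a, d]"] a c by auto
  define D where "D = {w \<in> H. (d, w) \<in> A}"
  define C where "C = {w \<in> H. (w, c) \<in> A}"
  define Z where "Z = {w \<in> H - X. (a, w) \<in> A}"
  have fin: "finite D" "finite C" "finite Z" using finH by (auto simp: D_def C_def Z_def)
  have DC: "D \<inter> C \<subseteq> {a}" using no4[of c a d] a c s by (auto simp: D_def C_def)
  have DZ: "D \<inter> Z = {}"
    using no3[of a d] a c sym by (auto simp: D_def Z_def)
  have CZ: "C \<inter> Z = {}"
    using no3[of a _ c] a c s by (auto simp: C_def Z_def)
  have "card D + card C = card (D \<union> C) + card (D \<inter> C)" using fin card_Un_Int by blast
  moreover have "card (D \<inter> C) \<le> 1" using card_mono[OF _ DC] by simp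
  moreover have "card (D \<union> C) + card Z \<le> card H"
  proof -
    have "card (D \<union> C) + card Z = card (D \<union> C \<union> Z)" using fin DZ CZ by (subst card_Un_disjoint) auto
    also have "\<dots> \<le> card H" using finH by (intro card_mono) (auto simp: D_def C_def Z_def)
    finally show ?thesis .
  qed
  moreover have "od A H d = card D" "od (A\<inverse>) H c = card C" "od A (H - X) a = card Z"
    by (auto simp: od_def D_def C_def Z_def)
  ultimately show "od A (H - X) a \<le> e + 1" using r by linarith
  have "od B H w = od B (H - X) w + od B X w" for B w using od_Diff[OF finH XH, of B w] by simp
  moreover have "od (A\<inverse>) (H - X) c = od A (H - X) c"
    unfolding od_def using sym c by (intro arg_cong[where f=card]) auto
  moreover have "od A X d + od (A\<inverse>) X c \<le> card X"
  proof (rule ccontr)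
    assume "\<not> ?thesis"
    then obtain x where "x \<in> X" "(d, x) \<in> A" "(c, x) \<in> A\<inverse>"
      using od_two_common[OF finite_subset[OF XH finH], of A d "A\<inverse>" c] not_le by blast
    then have "x \<in> D \<inter> C" using XH by (auto simp: D_def C_def)
    then show False using DC a \<open>x \<in> X\<close> by blast
  qed
  ultimately show "card H \<le> od A (H - X) c + od A (H - X) d + card X + e" using r by simp
qed

lemma out_pair:
  assumes "2 \<le> od A (H - X) x"
  shows "\<exists>c\<in>{w \<in> H - X. (x, w) \<in> A}. \<exists>d\<in>{w \<in> H - X. (x, w) \<in> A}. c \<noteq> d"
  by (rule two_elements) (use assms finH in \<open>auto simp: od_def\<close>)

lemma symmetric_bound:
  assumes sym: "\<And>x y. x \<in> H - X \<Longrightarrow> y \<in> H - X \<Longrightarrow> (x, y) \<in> A \<Longrightarrow> (y, x) \<in> A"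
    and a: "a \<in> H - X" "2 \<le> od A (H - X) a"
  shows "card H \<le> 3 * e + 2 + card X"
proof -
  have le: "od A (H - X) x \<le> e + 1" if x: "x \<in> H - X" for x
  proof (cases "2 \<le> od A (H - X) x")
    case True
    obtain c d where "c \<in> {w \<in> H - X. (x, w) \<in> A}" "d \<in> {w \<in> H - X. (x, w) \<in> A}" "c \<noteq> d"
      by (rule bexE[OF out_pair[OF True]]) blast
    then show ?thesis using two_neighbours(1)[OF sym x, of c d] by auto
  qed (use e1 in simp)
  obtain c d where cd: "c \<in> {w \<in> H - X. (a, w) \<in> A}" "d \<in> {w \<in> H - X. (a, w) \<in> A}" "c \<noteq> d"
    by (rule bexE[OF out_pair[OF a(2)]]) blast
  have "card H \<le> od A (H - X) c + od A (H - X) d + card X + e"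
    using two_neighbours(2)[OF sym a(1), of c d] cd by auto
  then show ?thesis using le[of c] le[of d] cd by auto
qed

end

section \<open>Greatest packings of short cycles\<close>

lemma fam_Un:
  assumes "fam A V i F" "fam A V j G" "\<Union>F \<inter> \<Union>G = {}"
  shows "fam A V (i + j) (F \<union> G)"
proof -
  have "F \<inter> G = {}"
  proof (rule ccontr)
    assume "F \<inter> G \<noteq> {}"
    then obtain S where S: "S \<in> F" "S \<in> G" by blast
    then have "S \<noteq> {}" using assms(1) cyclable_ne unfolding fam_def by blast
    then show False using S assms(3) by blast
  qed
  then have "card (F \<union> G) = i + j" using assms by (simp add: fam_def card_Un_disjoint)
  moreover have "pairwise disjnt (F \<union> G)"
  proof -
    have "disjnt S T" if "S \<in> F" "T \<in> G" for S T using that assms(3) unfolding disjnt_def by blast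
    moreover have "pairwise disjnt F" "pairwise disjnt G" using assms by (simp_all add: fam_def)
    ultimately show ?thesis unfolding pairwise_def by (metis Un_iff disjnt_sym)
  qed
  ultimately show ?thesis using assms by (auto simp: fam_def)
qed

text \<open>Five cells fit into no row and no column of a four by four grid. Take a cell, one
  outside its row and one outside its column: two of the three differ in both coordinates.\<close>

lemma grid_pair:
  assumes "E \<subseteq> S \<times> T" "finite S" "finite T" "card S \<le> 4" "card T \<le> 4" "5 \<le> card E"
  obtains y P y' P' where "(y, P) \<in> E" "(y', P') \<in> E" "y \<noteq> y'" "P \<noteq> P'"
proof -
  have "E \<noteq> {}" using assms(6) by auto
  then obtain y0 P0 where 0: "(y0, P0) \<in> E" by auto
  have "\<not> E \<subseteq> {y0} \<times> T"
    using card_mono[of "{y0} \<times> T" E] assms by (auto simp: card_cartesian_product)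
  then obtain y1 P1 where 1: "(y1, P1) \<in> E" "y1 \<noteq> y0" using assms(1) by auto
  have "\<not> E \<subseteq> S \<times> {P0}"
    using card_mono[of "S \<times> {P0}" E] assms by (auto simp: card_cartesian_product)
  then obtain y2 P2 where 2: "(y2, P2) \<in> E" "P2 \<noteq> P0" using assms(1) by auto
  show thesis using that 0 1 2 by metis
qed

text \<open>\<open>k - 1\<close> cycles are wanted besides \<open>Gm\<close>; if the packing falls
  short, \<open>s + 2 \<le> k\<close>, which explains the last assumption.\<close>

locale packing =
  fixes A :: "('a \<times> 'a) set" and V Gm F s
  assumes W: "woodall A V" and Gm: "Gm \<subseteq> V" "card Gm \<le> 4"
    and F: "fam A (V - Gm) s F" "\<And>S. S \<in> F \<Longrightarrow> card S \<le> 4"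
    and greatest: "\<And>G t. fam A (V - Gm) t G \<Longrightarrow> (\<And>S. S \<in> G \<Longrightarrow> card S \<le> 4) \<Longrightarrow> t \<le> s"
    and n: "12 * (s + 2) + 3 \<le> card V"
begin

definition "H = V - Gm - \<Union>F"

text \<open>Of the deficit \<open>s + 4\<close>, four compensates for \<open>Gm\<close> and one is
  left for each packed cycle: the ends of an exceptional path have more than
  \<open>card (\<Union>F) + s\<close> arcs to and from the packing.\<close>

definition exc :: "'a list \<Rightarrow> bool" where
  "exc P \<longleftrightarrow> pth A P \<and> set P \<subseteq> H \<and> (length P = 2 \<or> length P = 3) \<and> (last P, hd P) \<notin> A \<and>
    od A H (last P) + od (A\<inverse>) H (hd P) + (s + 4) < card H"

lemma fin: "finite V" "finite Gm" "finite (\<Union>F)" "finite H" "finite F" "card F = s"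
proof -
  show V: "finite V" using W by (simp add: woodall_def)
  show "finite Gm" using Gm V finite_subset by blast
  show "finite (\<Union>F)" using F(1) fam_fin[OF F(1)] by (auto simp: fam_def)
  show "finite H" using V by (simp add: H_def)
  show "finite F" "card F = s" using F(1) by (auto simp: fam_def)
qed

lemma parts: "V = H \<union> (Gm \<union> \<Union>F)" "H \<inter> (Gm \<union> \<Union>F) = {}" "Gm \<inter> \<Union>F = {}"
  using F(1) Gm(1) by (auto simp: H_def fam_def)

lemma card_parts: "card V = card H + card Gm + card (\<Union>F)"
  using parts fin by (metis card_Un_disjoint finite_Un add.assoc)

lemma od_parts: "od B V u = od B H u + od B Gm u + od B (\<Union>F) u"
  using parts fin by (metis od_Un finite_Un add.assoc)

lemma loopfree: "(v, v) \<notin> A" using W by (simp add: woodall_def)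

lemma no_short_cycle:
  assumes "S \<subseteq> H" "cyclable A S" "card S \<le> 4"
  shows False
proof -
  have "S \<subseteq> V - Gm" using assms(1) by (auto simp: H_def)
  then have "fam A (V - Gm) 1 {S}" using fam_single[of A S "V - Gm"] assms by simp
  moreover have "\<Union>F \<inter> \<Union>{S} = {}" using assms(1) by (auto simp: H_def)
  ultimately have "fam A (V - Gm) (s + 1) (F \<union> {S})" using fam_Un[OF F(1)] by blast
  from greatest[OF this] show False using F(2) assms(3) by auto
qed

lemma no3:
  assumes "x \<in> H" "y \<in> H" "z \<in> H" "(x, y) \<in> A" "(y, z) \<in> A" "(z, x) \<in> A"
  shows False
proof -
  have "cyc A [x, y, z]" using assms loopfree by (auto simp: cyc_def pth_def)
  then have "cyclable A {x, y, z}" using cyclableI by fastforce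
  moreover have "card {x, y, z} \<le> 4" using card_length[of "[x, y, z]"] by simp
  ultimately show False using no_short_cycle[of "{x, y, z}"] assms by blast
qed

lemma no4:
  assumes "x \<in> H" "y \<in> H" "z \<in> H" "w \<in> H" "x \<noteq> z" "y \<noteq> w"
    "(x, y) \<in> A" "(y, z) \<in> A" "(z, w) \<in> A" "(w, x) \<in> A"
  shows False
proof -
  have "cyc A [x, y, z, w]" using assms loopfree by (auto simp: cyc_def pth_def)
  then have "cyclable A {x, y, z, w}" using cyclableI by fastforce
  moreover have "card {x, y, z, w} \<le> 4" using card_length[of "[x, y, z, w]"] by simp
  ultimately show False using no_short_cycle[of "{x, y, z, w}"] assms by blast
qed

lemma exc_cycles:
  assumes P: "exc P"
  shows "card (\<Union>F) + s < (\<Sum>S\<in>F. od A S (last P) + od (A\<inverse>) S (hd P))"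
proof -
  have P0: "pth A P" "set P \<subseteq> H" "length P = 2 \<or> length P = 3" using P by (auto simp: exc_def)
  then have Pne: "P \<noteq> []" "2 \<le> length P" by auto
  have "last P \<noteq> hd P"
    using Pne P0(1) by (cases P) (auto simp: pth_def Suc_le_eq)
  moreover have "last P \<in> V" "hd P \<in> V"
    using P0(2) Pne(1) parts(1) last_in_set hd_in_set by blast+
  ultimately have P': "last P \<noteq> hd P" "last P \<in> V" "hd P \<in> V" .
  have "(last P, hd P) \<notin> A" using P by (simp add: exc_def)
  then have "card V \<le> od A V (last P) + od (A\<inverse>) V (hd P)" by (rule woodallD[OF W P'(2,3,1)])
  moreover have "od A Gm (last P) \<le> card Gm" "od (A\<inverse>) Gm (hd P) \<le> card Gm"
    by (simp_all add: od_le fin(2))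
  moreover have "od A H (last P) + od (A\<inverse>) H (hd P) + (s + 4) < card H" using P by (simp add: exc_def)
  ultimately have "card (\<Union>F) + s < od A (\<Union>F) (last P) + od (A\<inverse>) (\<Union>F) (hd P)"
    using Gm(2) unfolding od_parts card_parts by linarith
  then show ?thesis by (simp add: fam_od[OF F(1)] sum.distrib)
qed

text \<open>Four disjoint exceptional paths would, on some cycle of the packing, be closed so often that
  two of them are closed by distinct vertices: the cycle could be exchanged for two short ones.\<close>
lemma no_four_exc:
  assumes P: "finite PP" "card PP = 4" "\<And>P. P \<in> PP \<Longrightarrow> exc P"
    and dj: "\<And>P Q. P \<in> PP \<Longrightarrow> Q \<in> PP \<Longrightarrow> P \<noteq> Q \<Longrightarrow> set P \<inter> set Q = {}"
  shows False
proof -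
  have "\<exists>S\<in>F. 4 * card S + 4 < (\<Sum>P\<in>PP. od A S (last P) + od (A\<inverse>) S (hd P))"
  proof (rule ccontr)
    assume "\<not> ?thesis"
    then have "(\<Sum>S\<in>F. \<Sum>P\<in>PP. od A S (last P) + od (A\<inverse>) S (hd P)) \<le> (\<Sum>S\<in>F. 4 * card S + 4)"
      by (intro sum_mono) (auto simp: not_less)
    also have "\<dots> = 4 * card (\<Union>F) + 4 * s"
      using fin by (simp add: sum.distrib fam_card[OF F(1)] sum_distrib_left)
    finally have "(\<Sum>P\<in>PP. \<Sum>S\<in>F. od A S (last P) + od (A\<inverse>) S (hd P)) \<le> 4 * (card (\<Union>F) + s)"
      by (subst sum.swap) simp
    moreover have "(\<Sum>P\<in>PP. card (\<Union>F) + s + 1) \<le> (\<Sum>P\<in>PP. \<Sum>S\<in>F. od A S (last P) + od (A\<inverse>) S (hd P))"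
      using exc_cycles P(3) by (intro sum_mono) (simp add: Suc_leI)
    ultimately show False using P(2) by simp
  qed
  then obtain S where S: "S \<in> F" "4 * card S + 4 < (\<Sum>P\<in>PP. od A S (last P) + od (A\<inverse>) S (hd P))" by blast
  have fS: "finite S" using fam_fin[OF F(1) S(1)] .
  \<comment> \<open>\<open>cl P\<close> consists of the vertices of \<open>S\<close> that close
    \<open>P\<close> to a cycle of at most four vertices; five pairs in \<open>E\<close> yield two
    such cycles that are disjoint.\<close>
  define cl where "cl = (\<lambda>P. {y \<in> S. (last P, y) \<in> A \<and> (y, hd P) \<in> A})"
  define E where "E = (\<Union>P\<in>PP. cl P \<times> {P})"
  have cl: "od A S (last P) + od (A\<inverse>) S (hd P) \<le> card S + card (cl P)" for P
  proof -
    have "od A S (last P) + od (A\<inverse>) S (hd P) =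
      card ({y \<in> S. (last P, y) \<in> A} \<union> {y \<in> S. (hd P, y) \<in> A\<inverse>}) + 
      card ({y \<in> S. (last P, y) \<in> A} \<inter> {y \<in> S. (hd P, y) \<in> A\<inverse>})"
      unfolding od_def using fS by (intro card_Un_Int) auto
    moreover have "{y \<in> S. (last P, y) \<in> A} \<inter> {y \<in> S. (hd P, y) \<in> A\<inverse>} = cl P"
      by (auto simp: cl_def)
    moreover have "card ({y \<in> S. (last P, y) \<in> A} \<union> {y \<in> S. (hd P, y) \<in> A\<inverse>}) \<le> card S"
      using fS by (intro card_mono) auto
    ultimately show ?thesis by simp
  qed
  have finite_cl: "finite (cl P)" for P using fS by (simp add: cl_def)
  have "card E = (\<Sum>P\<in>PP. card (cl P \<times> {P}))"
    unfolding E_def using P(1) finite_cl by (intro card_UN_disjoint) auto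
  also have "\<dots> = (\<Sum>P\<in>PP. card (cl P))" by (simp add: card_cartesian_product)
  moreover have "(\<Sum>P\<in>PP. od A S (last P) + od (A\<inverse>) S (hd P)) \<le> (\<Sum>P\<in>PP. card S + card (cl P))"
    using cl by (intro sum_mono)
  ultimately have "4 * card S + 4 < 4 * card S + card E"
    using S(2) P(2) by (simp add: sum.distrib)
  then have "5 \<le> card E" by simp
  moreover have "E \<subseteq> S \<times> PP" by (auto simp: E_def cl_def)
  ultimately obtain y P1 z P2 where e: "(y, P1) \<in> E" "(z, P2) \<in> E" "y \<noteq> z" "P1 \<noteq> P2"
    using grid_pair[of E S PP] fS P(1,2) F(2)[OF S(1)] by (metis order_refl)
  have new: "cyclable A (insert x (set Q)) \<and> card (insert x (set Q)) \<le> 4 \<and> insert x (set Q) \<subseteq> V - Gm"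
    if "(x, Q) \<in> E" for x Q
  proof -
    have x: "x \<in> S" "(last Q, x) \<in> A" "(x, hd Q) \<in> A" "Q \<in> PP" using that by (auto simp: E_def cl_def)
    have Q: "pth A Q" "set Q \<subseteq> H" "2 \<le> length Q" "length Q \<le> 3" using P(3)[OF x(4)] by (auto simp: exc_def)
    have "x \<in> \<Union>F" using x S by blast
    then have xH: "x \<notin> H" "x \<in> V - Gm" using parts by blast+
    then have "set Q \<inter> set [x] = {}" using Q(2) by auto
    then have "cyc A (Q @ [x])" using cyc_path_close[OF Q(1), of "[x]"] x Q(3) by simp
    then have "cyclable A (insert x (set Q))" using cyclableI by fastforce
    moreover have "card (insert x (set Q)) \<le> 4" using card_length[of "x # Q"] Q(4) by simp
    moreover have "insert x (set Q) \<subseteq> V - Gm" using Q(2) xH(2) by (auto simp: H_def)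
    ultimately show ?thesis by blast
  qed
  let ?C = "insert y (set P1)" and ?D = "insert z (set P2)"
  have yz: "y \<in> S" "z \<in> S" "P1 \<in> PP" "P2 \<in> PP" using e by (auto simp: E_def cl_def)
  have PH: "set P1 \<subseteq> H" "set P2 \<subseteq> H" using P(3) yz by (auto simp: exc_def)
  have SH: "S \<inter> H = {}" "S \<subseteq> \<Union>F" using S(1) parts by blast+
  have "?C \<inter> ?D = {}" using dj[OF yz(3,4) e(4)] e(3) yz PH SH(1) by blast
  then have p: "fam A (V - Gm) 2 {?C, ?D}" using fam_pair[of A ?C "V - Gm" ?D] new[OF e(1)] new[OF e(2)] by simp
  have "\<Union>(F - {S}) = \<Union>F - S" using fam_insertD[OF F(1) S(1)] .
  moreover have "(\<Union>F - S) \<inter> (?C \<union> ?D) = {}" using yz PH parts(2) by blast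
  ultimately have "\<Union>(F - {S}) \<inter> \<Union>{?C, ?D} = {}" by simp
  then have "fam A (V - Gm) (card (F - {S}) + 2) ((F - {S}) \<union> {?C, ?D})"
    by (rule fam_Un[OF fam_subset[OF F(1) Diff_subset] p])
  then have "card (F - {S}) + 2 \<le> s"
    by (rule greatest) (use F(2) new e in auto)
  moreover have "card (F - {S}) + 1 = s"
    using card_Suc_Diff1[OF fin(5) S(1)] fin(6) by simp
  ultimately show False by linarith
qed

text \<open>\<open>X\<close> is covered by a greatest collection of disjoint exceptional paths, at
  most three paths of at most three vertices. Without packed cycles no path is exceptional, a case
  that the final arithmetic treats separately.\<close>

lemma exc_cover:
  shows "\<exists>X\<subseteq>H. card X \<le> 9 \<and> (s = 0 \<longrightarrow> X = {}) \<and> (\<forall>P. exc P \<longrightarrow> set P \<inter> X \<noteq> {})"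
proof -
  define R where "R = (\<lambda>PP. finite PP \<and> (\<forall>P\<in>PP. exc P) \<and> (\<forall>P\<in>PP. \<forall>Q\<in>PP. P \<noteq> Q \<longrightarrow> set P \<inter> set Q = {}))"
  have lt: "card PP < 4" if PP: "R PP" for PP
  proof (rule ccontr)
    assume "\<not> ?thesis"
    then obtain QQ where "QQ \<subseteq> PP" "card QQ = 4" "finite QQ"
      using obtain_subset_with_card_n[of 4 PP] by (metis not_less)
    then show False using no_four_exc[of QQ] PP unfolding R_def by blast
  qed
  have "R {}" by (simp add: R_def)
  then obtain PP where PP: "R PP" "\<And>QQ. R QQ \<Longrightarrow> card QQ \<le> card PP"
    using ex_has_greatest_nat[of R "{}" card 4] lt by (metis)
  define X where "X = (\<Union>P\<in>PP. set P)"
  have XH: "X \<subseteq> H" using PP(1) by (auto simp: X_def R_def exc_def)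
  have "card X \<le> (\<Sum>P\<in>PP. card (set P))" unfolding X_def using PP(1) by (intro card_UN_le) (simp add: R_def)
  also have "\<dots> \<le> (\<Sum>P\<in>PP. 3)"
  proof (rule sum_mono)
    fix P assume "P \<in> PP"
    then have "length P \<le> 3" using PP(1) by (auto simp: R_def exc_def)
    then show "card (set P) \<le> 3" using card_length[of P] by linarith
  qed
  also have "\<dots> \<le> 9" using lt[OF PP(1)] by simp
  finally have X9: "card X \<le> 9" .
  have X0: "X = {}" if "s = 0"
  proof -
    have "F = {}" using that fin by simp
    then have "\<not> exc P" for P using exc_cycles[of P] by auto
    then have "PP = {}" using PP(1) by (auto simp: R_def)
    then show ?thesis by (simp add: X_def)
  qed
  have "set P \<inter> X \<noteq> {}" if P: "exc P" for P
  proof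
    assume e: "set P \<inter> X = {}"
    have Pne: "set P \<noteq> {}" using P by (simp add: exc_def pth_def)
    have sX: "set Q \<subseteq> X" if "Q \<in> PP" for Q using that by (auto simp: X_def)
    have nP: "P \<notin> PP"
    proof
      assume "P \<in> PP"
      then have "set P \<inter> X = set P" using sX by blast
      then show False using e Pne by simp
    qed
    have "set P \<inter> set Q = {}" if "Q \<in> PP" for Q using e sX[OF that] by blast
    then have "R (insert P PP)" using PP(1) P unfolding R_def by (simp add: Int_commute)
    then have "card (insert P PP) \<le> card PP" by (rule PP(2))
    moreover have "finite PP" using PP(1) by (simp add: R_def)
    ultimately show False using nP by simp
  qed
  then show ?thesis using XH X9 X0 by blast
qed

lemma packing_impossible: False
proof -
  obtain X where X: "X \<subseteq> H" "card X \<le> 9" "s = 0 \<longrightarrow> X = {}" "\<forall>P. exc P \<longrightarrow> set P \<inter> X \<noteq> {}"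
    using exc_cover by blast
  have finX: "finite X" using X(1) fin finite_subset by blast
  interpret sparse A H X "s + 4"
  proof
    fix P assume P: "pth A P" "set P \<subseteq> H - X" "length P = 2 \<or> length P = 3" "(last P, hd P) \<notin> A"
    then have "\<not> exc P" using X(4) by blast
    then show "card H \<le> od A H (last P) + od (A\<inverse>) H (hd P) + (s + 4)"
      using P unfolding exc_def by auto
  next
    show "finite H" by (fact fin)
    show "X \<subseteq> H" by (fact X)
    show "(v, v) \<notin> A" for v by (fact loopfree)
  next
    fix x y z assume "x \<in> H" "y \<in> H" "z \<in> H" "(x, y) \<in> A" "(y, z) \<in> A" "(z, x) \<in> A"
    then show False by (rule no3)
  next
    fix x y z w assume "x \<in> H" "y \<in> H" "z \<in> H" "w \<in> H" "x \<noteq> z" "y \<noteq> w"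
      "(x, y) \<in> A" "(y, z) \<in> A" "(z, w) \<in> A" "(w, x) \<in> A"
    then show False by (rule no4)
  qed simp
  have L: "card (\<Union>F) \<le> 4 * s"
    unfolding fam_card[OF F(1)] using sum_bounded_above[of F card 4] F(2) fin by (simp add: mult.commute)
  \<comment> \<open>From \<open>12 * (s + 2) + 3\<close> vertices, at most 4 are lost to
    \<open>Gm\<close> and \<open>4 * s\<close> to the packed cycles.\<close>
  have m: "8 * s + 23 \<le> card H" using n L Gm(2) card_parts unfolding distrib_left by linarith
  have x: "s = 0 \<Longrightarrow> card X = 0" using X(3) by simp
  have sym: "(y, x) \<in> A" if "x \<in> H - X" "y \<in> H - X" "(x, y) \<in> A" for x y
  proof (rule ccontr)
    assume "(y, x) \<notin> A"
    then have "card H + 4 \<le> 5 * (s + 4) + card X" using one_way_bound[of x y] that by blast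
    then show False using m x X(2) by (cases "s = 0") auto
  qed
  have deg: "od A (H - X) a \<le> 1" if a: "a \<in> H - X" for a
  proof (rule ccontr)
    assume "\<not> ?thesis"
    then have "card H \<le> 3 * (s + 4) + 2 + card X" using symmetric_bound[OF sym a] by simp
    then show False using m x X(2) by (cases "s = 0") auto
  qed
  have deg': "od (A\<inverse>) (H - X) a \<le> 1" if a: "a \<in> H - X" for a
  proof -
    have "od (A\<inverse>) (H - X) a = od A (H - X) a"
      unfolding od_def using sym a by (intro arg_cong[where f=card]) auto
    then show ?thesis using deg a by simp
  qed
  have cHX: "card (H - X) + card X = card H" using X(1) fin finX card_mono[of H X] by (simp add: card_Diff_subset)
  then have "card (H - X) \<noteq> 0" using m X(2) by linarith
  then have "H - X \<noteq> {}" by fastforce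
  \<comment> \<open>Outside \<open>X\<close>, the arcs within \<open>H\<close> now form a matching
    of digons. Hence \<open>p\<close> and a vertex \<open>q\<close> it does not reach have all but
    one of their relevant neighbours in \<open>X\<close>, \<open>Gm\<close> and the packed
    cycles.\<close>
  then obtain p where p: "p \<in> H - X" by blast
  have "card (insert p {w \<in> H - X. (p, w) \<in> A}) \<le> 2"
    using deg[OF p] card_insert_le_m1[of 2 "{w \<in> H - X. (p, w) \<in> A}" p] by (simp add: od_def)
  then have "\<not> H - X \<subseteq> insert p {w \<in> H - X. (p, w) \<in> A}"
    using card_mono[of "insert p {w \<in> H - X. (p, w) \<in> A}" "H - X"] fin cHX m X(2) by fastforce
  then obtain q where q: "q \<in> H - X" "q \<noteq> p" "(p, q) \<notin> A" by blast
  have "card V \<le> od A V p + od (A\<inverse>) V q" using woodallD[OF W, of p q] p q parts(1) by auto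
  moreover have "od A V p \<le> 1 + card X + card Gm + card (\<Union>F)"
    using deg[OF p] od_Diff[OF fin(4) X(1), of A p] od_le[OF finX, of A p] od_le[OF fin(2), of A p]
      od_le[OF fin(3), of A p] unfolding od_parts by linarith
  moreover have "od (A\<inverse>) V q \<le> 1 + card X + card Gm + card (\<Union>F)"
    using deg'[OF q(1)] od_Diff[OF fin(4) X(1), of "A\<inverse>" q] od_le[OF finX, of "A\<inverse>" q] od_le[OF fin(2), of "A\<inverse>" q]
      od_le[OF fin(3), of "A\<inverse>" q] unfolding od_parts by linarith
  ultimately have "card V \<le> 2 * (1 + card X + card Gm + card (\<Union>F))" by simp
  then show False using n L Gm(2) x X(2) by (cases "s = 0") auto
qed

end

lemma ex_packing:
  assumes W: "woodall A V" and Gm: "Gm \<subseteq> V" "card Gm \<le> 4" and n: "12 * (j + 1) + 3 \<le> card V"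
  obtains G where "fam A (V - Gm) j G"
proof -
  define R where "R = (\<lambda>G. fam A (V - Gm) (card G) G \<and> (\<forall>S\<in>G. card S \<le> 4))"
  have fV: "finite V" using W by (simp add: woodall_def)
  have "card G < Suc (card (Pow V))" if "R G" for G
  proof -
    have "G \<subseteq> Pow V" using that by (auto simp: R_def fam_def)
    then show ?thesis using card_mono[of "Pow V" G] fV by simp
  qed
  moreover have "R {}" by (simp add: R_def fam_def)
  ultimately obtain F where F: "R F" "\<And>G. R G \<Longrightarrow> card G \<le> card F"
    using ex_has_greatest_nat[of R "{}" card] by metis
  have "j \<le> card F"
  proof (rule ccontr)
    assume j: "\<not> j \<le> card F"
    interpret packing A V Gm F "card F"
    proof
      fix G t assume G: "fam A (V - Gm) t G" "\<And>S. S \<in> G \<Longrightarrow> card S \<le> 4"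
      then have "R G" "card G = t" by (auto simp: R_def fam_def)
      then show "t \<le> card F" using F(2) by blast
    qed (use W Gm F(1) n j in \<open>auto simp: R_def\<close>)
    show False by (rule packing_impossible)
  qed
  then obtain G where "G \<subseteq> F" "card G = j" using obtain_subset_with_card_n by metis
  then show thesis using that fam_subset[of A "V - Gm" "card F" F G] F(1) unfolding R_def by auto
qed

section \<open>Rigid pairs and good families\<close>

definition rigid_pair :: "('a \<times> 'a) set \<Rightarrow> 'a set \<Rightarrow> 'a \<Rightarrow> 'a \<Rightarrow> bool" where
  "rigid_pair A V r r' \<longleftrightarrow> r \<in> V \<and> r' \<in> V \<and> r \<noteq> r' \<and> (r, r') \<in> A \<and> (r', r) \<in> A \<and>
    (\<forall>v\<in>V - {r, r'}. ((v, r) \<in> A \<longleftrightarrow> (r, v) \<notin> A) \<and> ((v, r') \<in> A \<longleftrightarrow> (v, r) \<in> A) \<and>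
       ((r', v) \<in> A \<longleftrightarrow> (r, v) \<in> A))"

text \<open>The degree bound rules out a single uncovered vertex; for two uncovered vertices it
  makes all estimates tight, which leaves only rigid pairs.\<close>

definition good :: "('a \<times> 'a) set \<Rightarrow> 'a set \<Rightarrow> 'a \<Rightarrow> bool" where
  "good A V v \<longleftrightarrow> card V \<le> od A V v + od (A\<inverse>) V v \<and> (\<forall>r'. \<not> rigid_pair A V v r')"

lemma rigid_pair_converse [simp]: "rigid_pair (A\<inverse>) V r r' \<longleftrightarrow> rigid_pair A V r r'"
  by (auto simp: rigid_pair_def)

lemma good_converse [simp]: "good (A\<inverse>) V v \<longleftrightarrow> good A V v"
  by (simp add: good_def add.commute)

lemma rigid_pair_adjacent:
  assumes "rigid_pair A V r r'" "v \<in> V" "v \<noteq> r"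
  shows "(v, r) \<in> A \<or> (r, v) \<in> A"
  using assms by (auto simp: rigid_pair_def)

lemma rigid_pair_degree:
  assumes r: "rigid_pair A V r r'" and V: "finite V" "(r, r) \<notin> A"
  shows "od A V r + od (A\<inverse>) V r = card V"
proof -
  let ?X = "V - {r, r'}"
  have rr: "r \<in> V" "r' \<in> V" "r \<noteq> r'" "(r, r') \<in> A" "(r', r) \<in> A" using r by (auto simp: rigid_pair_def)
  have "od A ?X r + od (A\<inverse>) ?X r = card ({w \<in> ?X. (r, w) \<in> A} \<union> {w \<in> ?X. (r, w) \<in> A\<inverse>})"
    unfolding od_def using V r by (subst card_Un_disjoint) (auto simp: rigid_pair_def)
  also have "{w \<in> ?X. (r, w) \<in> A} \<union> {w \<in> ?X. (r, w) \<in> A\<inverse>} = ?X" using r by (auto simp: rigid_pair_def)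
  finally have "od A ?X r + od (A\<inverse>) ?X r = card ?X" .
  moreover have "od B V r = od B {r, r'} r + od B ?X r" for B
    using od_Diff[OF V(1), of "{r, r'}" B r] rr by simp
  moreover have "od A {r, r'} r = 1" "od (A\<inverse>) {r, r'} r = 1"
    using rr V(2) by (auto simp: od_insert od_single)
  moreover have "card ?X + 2 = card V"
    using rr V(1) card_mono[of V "{r, r'}"] by (simp add: card_Diff_subset)
  ultimately show ?thesis by simp
qed

lemma (in extremal) uncovered_single:
  assumes "H = {w}"
  shows "\<not> good A V w"
proof -
  have "od (A\<inverse>) (\<Union>F) w + od A (\<Union>F) w \<le> card (\<Union>F)"
    using H_path_sum[of "[w]" F] assms by simp
  moreover have "od A H w = 0" "od (A\<inverse>) H w = 0" using assms loopfree by (auto simp: od_single)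
  ultimately show ?thesis using assms unfolding good_def card_UH od_UH by simp
qed

lemma (in extremal) two_arc:
  assumes H: "H = {h, h'}" "h \<noteq> h'"
  shows "(h, h') \<in> A"
proof -
  obtain p where p: "pth A p" "set p \<subseteq> H" "hd p = h" "last p = h'" using strong H by (metis insertI1 insert_commute)
  have "length p = card (set p)" using p by (simp add: pth_def distinct_card)
  also have "\<dots> \<le> card H" using finH p by (intro card_mono)
  also have "\<dots> = 2" using H by simp
  finally have "length p \<le> 2" .
  then obtain x y where "p = [x] \<or> p = [x, y]" using p(1)
    by (cases p; cases "tl p") (auto simp: pth_def)
  then show ?thesis using p H by (auto simp: pth_def)
qed

text \<open>A good vertex has at most two arcs inside \<open>H\<close>, so it has exactly
  \<open>card S\<close> arcs from and to each cycle \<open>S\<close>. If both directions occurred,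
  \<open>bad\<close> would gather all of them at one vertex of \<open>S\<close>, giving at most
  two.\<close>

lemma (in extremal) two_side:
  assumes H: "H = {h, h'}" "h \<noteq> h'" and g: "good A V h" "good A V h'" and S: "S \<in> F"
  shows "(\<forall>v\<in>S. \<forall>x\<in>H. (v, x) \<in> A \<and> (x, v) \<notin> A) \<or> (\<forall>v\<in>S. \<forall>x\<in>H. (v, x) \<notin> A \<and> (x, v) \<in> A)"
proof -
  have eq: "od (A\<inverse>) S x + od A S x = card S" if x: "x \<in> H" for x
  proof -
    have gx: "good A V x" using x H g by blast
    have "od A H x \<le> 1" "od (A\<inverse>) H x \<le> 1" 
      using od_le_less[of H x x A] od_le_less[of H x x "A\<inverse>"] x H loopfree by auto
    then have "card (\<Union>F) \<le> od (A\<inverse>) (\<Union>F) x + od A (\<Union>F) x"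
      using gx H unfolding good_def card_UH od_UH by simp
    moreover have "od (A\<inverse>) (\<Union>F) x + od A (\<Union>F) x \<le> card (\<Union>F)"
      using H_path_sum[of "[x]" F] x by simp
    ultimately have "(\<Sum>S\<in>F. od (A\<inverse>) S x + od A S x) = (\<Sum>S\<in>F. card S)"
      by (simp add: sum.distrib fam_od[OF fam] fam_card[OF fam])
    then show ?thesis
    proof (rule sum_mono_inv)
      show "od (A\<inverse>) T x + od A T x \<le> card T" if "T \<in> F" for T
        using H_path_not_insertable[of "[x]", OF _ _ that] x by simp
    qed (use S fam in \<open>auto simp: fam_def\<close>)
  qed
  have fS: "finite S" and c3: "3 \<le> card S" using memF(2)[OF S] cyclable_card[OF memF(4)[OF S]] .
  show ?thesis
  proof (cases "\<exists>v\<in>S. \<exists>x\<in>H. (v, x) \<in> A")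
    case True
    then obtain v x where v: "v \<in> S" "x \<in> H" "(v, x) \<in> A" by blast
    have none: "(y, w) \<notin> A" if w: "w \<in> S" "y \<in> H" for w y
    proof
      assume yw: "(y, w) \<in> A"
      have "od (A\<inverse>) S x \<le> card {w}"
        using bad[OF S _ v(2) _ w yw] by (intro od_le_card) auto
      moreover have "od A S x \<le> card {v}"
        using bad[OF S v _ v(2)] by (intro od_le_card) auto
      ultimately show False using eq[OF v(2)] c3 by simp
    qed
    have "(w, y) \<in> A" if w: "w \<in> S" "y \<in> H" for w y
    proof -
      have "od A S y = 0" using none w by (auto simp: od_eq_0 fS)
      then have "od (A\<inverse>) S y = card S" using eq[OF w(2)] by simp
      then show ?thesis using od_card_eq[OF fS _ w(1), of "A\<inverse>" y] by simp
    qed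
    then show ?thesis using none by blast
  next
    case False
    have "(y, w) \<in> A" if w: "w \<in> S" "y \<in> H" for w y
    proof -
      have "od (A\<inverse>) S y = 0" using False w by (auto simp: od_eq_0 fS)
      then have "od A S y = card S" using eq[OF w(2)] by simp
      then show ?thesis using od_card_eq[OF fS _ w(1), of A y] by simp
    qed
    then show ?thesis using False by blast
  qed
qed

lemma (in extremal) uncovered_pair:
  assumes H: "H = {h, h'}" "h \<noteq> h'"
  shows "\<not> (good A V h \<and> good A V h')"
proof
  assume g: "good A V h \<and> good A V h'"
  have "(h', h) \<in> A" by (rule two_arc) (use H in auto)
  moreover have "(h, h') \<in> A" using two_arc[OF H] .
  moreover have "((v, h) \<in> A \<longleftrightarrow> (h, v) \<notin> A) \<and> ((v, h') \<in> A \<longleftrightarrow> (v, h) \<in> A) \<and> ((h', v) \<in> A \<longleftrightarrow> (h, v) \<in> A)"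
    if v: "v \<in> V - {h, h'}" for v
  proof -
    obtain S where S: "S \<in> F" "v \<in> S" using v UH H by blast
    have "h \<in> H" "h' \<in> H" using H by auto
    then show ?thesis using two_side[OF H _ _ S(1)] g S(2) by blast
  qed
  ultimately have "rigid_pair A V h h'" using H HV unfolding rigid_pair_def by blast
  then show False using g by (auto simp: good_def)
qed

text \<open>Covering more vertices keeps the uncovered ones good, so a least uncovered set among
  such families is extremal among all families; each possible size of it has been excluded.\<close>

lemma good_spanning:
  assumes W: "woodall A V" and n: "12 * k + 3 \<le> card V" and k: "1 \<le> k"
    and F0: "fam A V k F0" "\<And>v. v \<in> V - \<Union>F0 \<Longrightarrow> good A V v"
  shows "\<exists>F. fam A V k F \<and> \<Union>F = V"
proof -
  define R where "R = (\<lambda>F. fam A V k F \<and> (\<forall>v\<in>V - \<Union>F. good A V v))"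
  have fV: "finite V" using W by (simp add: woodall_def)
  have "R F0" using F0 by (simp add: R_def)
  then obtain F where F: "R F" "\<And>F'. R F' \<Longrightarrow> \<not> V - \<Union>F' \<subset> V - \<Union>F"
    using ex_least_uncovered[OF fV, of R F0] by metis
  define H where "H = V - \<Union>F"
  have fam: "fam A V k F" and g: "\<And>v. v \<in> H \<Longrightarrow> good A V v" using F(1) by (auto simp: R_def H_def)
  have least: False if F': "fam A V k F'" "V - \<Union>F' \<subset> H" for F'
  proof -
    have "R F'" using F' g unfolding R_def by blast
    then show False using F(2) F'(2) unfolding H_def by blast
  qed
  have Fne: "F \<noteq> {}" using fam k by (auto simp: fam_def)
  then obtain S0 where S0: "S0 \<in> F" by blast
  have fH: "finite H" using fV by (simp add: H_def)
  show ?thesis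
  proof (cases "H = {}")
    case True
    then have "\<Union>F = V" using fam by (auto simp: H_def fam_def)
    then show ?thesis using fam by blast
  next
    case False
    interpret extremal A V k F H S0
    proof
      fix F' S' assume "fam A V k F'" "V - \<Union>F' \<subset> H"
      then show False by (rule least)
    qed (fact W fam H_def False S0)+
    have "card H \<noteq> 0" using False fH by simp
    then consider "card H = 1" | "card H = 2" | "3 \<le> card H" by linarith
    then have False
    proof cases
      case 1
      then obtain w where "H = {w}" using card_1_singletonE by blast
      then show False using uncovered_single g by blast
    next
      case 2
      then obtain h h' where "H = {h, h'}" "h \<noteq> h'" by (auto simp: card_2_iff)
      then show False using uncovered_pair g by blast
    next
      case 3
      interpret B: stuck_family A V k F H
      proof
        fix F' assume "fam A V k F'" "V - \<Union>F' \<subset> H"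
        then show False by (rule least)
      qed (fact W fam H_def 3 Fne)+
      show False using B.stuck_family_impossible n .
    qed
    then show ?thesis ..
  qed
qed

section \<open>Short cycles and chords at rigid vertices\<close>

text \<open>The clause on \<open>hd\<close> carries the induction: the vertex in front must still
  have an arc to the new head.\<close>

lemma semicomplete_insert:
  assumes "pth A Q" "x \<notin> set Q" "\<And>y. y \<in> set Q \<Longrightarrow> (x, y) \<in> A \<or> (y, x) \<in> A"
  shows "\<exists>Q'. pth A Q' \<and> set Q' = insert x (set Q) \<and> (hd Q' = x \<or> hd Q' = hd Q)"
  using assms
proof (induction Q)
  case Nil
  then show ?case by (simp add: pth_def)
next
  case (Cons y Q)
  show ?case
  proof (cases "(x, y) \<in> A")
    case True
    then have "pth A (x # y # Q)" using Cons.prems by (simp add: pth_Cons[of "y # Q"])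
    then show ?thesis by (intro exI[of _ "x # y # Q"]) simp
  next
    case False
    then have yx: "(y, x) \<in> A" using Cons.prems(3)[of y] by simp
    show ?thesis
    proof (cases "Q = []")
      case True
      then have "pth A [y, x]" using yx Cons.prems by (simp add: pth_Cons)
      then show ?thesis using True by (intro exI[of _ "[y, x]"]) auto
    next
      case ne: False
      then have Q: "pth A Q" "y \<notin> set Q" "(y, hd Q) \<in> A" using Cons.prems(1) by (simp_all add: pth_Cons)
      then obtain Q' where Q': "pth A Q'" "set Q' = insert x (set Q)" "hd Q' = x \<or> hd Q' = hd Q"
        using Cons.IH Cons.prems by auto
      then have "Q' \<noteq> []" by auto
      moreover have "(y, hd Q') \<in> A" using Q'(3) Q(3) yx by auto
      moreover have "y \<notin> set Q'" using Q' Q Cons.prems(2) by auto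
      ultimately have "pth A (y # Q')" using Q' by (simp add: pth_Cons)
      then show ?thesis using Q' by (intro exI[of _ "y # Q'"]) auto
    qed
  qed
qed

lemma semicomplete_path:
  assumes "finite R" "R \<noteq> {}" "\<And>x y. x \<in> R \<Longrightarrow> y \<in> R \<Longrightarrow> x \<noteq> y \<Longrightarrow> (x, y) \<in> A \<or> (y, x) \<in> A"
  shows "\<exists>Q. pth A Q \<and> set Q = R"
  using assms
proof (induction rule: finite_ne_induct)
  case (singleton x)
  then show ?case by (intro exI[of _ "[x]"]) simp
next
  case (insert x R)
  then obtain Q where "pth A Q" "set Q = R" by auto
  then show ?case using semicomplete_insert[of A Q x] insert by auto
qed

text \<open>A non-arc leaves \<open>card V - 2\<close> candidates for a degree sum of at least
  \<open>card V\<close>, so there are two common vertices and one differs from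
  \<open>t\<close>.\<close>

lemma woodall_common:
  assumes W: "woodall A V" and x: "x \<in> V" "y \<in> V" "x \<noteq> y" "(x, y) \<notin> A" and t: "t \<in> V"
  obtains z where "z \<in> V" "z \<noteq> x" "z \<noteq> y" "z \<noteq> t" "(x, z) \<in> A" "(z, y) \<in> A"
proof -
  have fin: "finite V" "\<And>v. (v, v) \<notin> A" using W by (auto simp: woodall_def)
  let ?X = "V - {x, y}"
  let ?N = "{w \<in> ?X. (x, w) \<in> A}" and ?M = "{w \<in> ?X. (w, y) \<in> A}"
  have "{w \<in> V. (x, w) \<in> A} = ?N" "{w \<in> V. (y, w) \<in> A\<inverse>} = ?M" using x fin by auto
  then have "od A V x = card ?N" "od (A\<inverse>) V y = card ?M" by (simp_all add: od_def)
  then have "card V \<le> card ?N + card ?M" using woodallD[OF W x(1-4)] by simp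
  also have "\<dots> = card (?N \<union> ?M) + card (?N \<inter> ?M)" using fin by (intro card_Un_Int) auto
  also have "card (?N \<union> ?M) \<le> card ?X" using fin by (intro card_mono) auto
  finally have "card V \<le> card ?X + card (?N \<inter> ?M)" by simp
  moreover have "card ?X + 2 = card V"
    using x fin card_mono[of V "{x, y}"] by (simp add: card_Diff_subset)
  ultimately have "\<not> ?N \<inter> ?M \<subseteq> {t}" using card_mono[of "{t}" "?N \<inter> ?M"] by auto
  then show thesis using that by blast
qed

lemma triangle_cyclable:
  assumes "(x, y) \<in> A" "(y, z) \<in> A" "(z, x) \<in> A" "x \<noteq> y" "y \<noteq> z" "z \<noteq> x"
  shows "cyclable A {x, y, z}"
proof -
  have "cyc A [x, y, z]" using assms by (auto simp: cyc_def pth_def)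
  then show ?thesis using cyclableI by fastforce
qed

lemma square_cyclable:
  assumes "(x, y) \<in> A" "(y, z) \<in> A" "(z, w) \<in> A" "(w, x) \<in> A" "distinct [x, y, z, w]"
  shows "cyclable A {x, y, z, w}"
proof -
  have "cyc A [x, y, z, w]" using assms by (auto simp: cyc_def pth_def)
  then show ?thesis using cyclableI by fastforce
qed

lemma short_cycle_through_two:
  assumes W: "woodall A V" and n: "3 \<le> card V" and ab: "a \<in> V" "b \<in> V" "a \<noteq> b"
  obtains S where "cyclable A S" "S \<subseteq> V" "card S \<le> 4" "a \<in> S" "b \<in> S"
proof -
  have fin: "finite V" "\<And>v. (v, v) \<notin> A" using W by (auto simp: woodall_def)
  have tri: "card {x, y, z} \<le> 4" for x y z :: 'a using card_length[of "[x, y, z]"] by simp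
  have sq: "card {x, y, z, w} \<le> 4" for x y z w :: 'a using card_length[of "[x, y, z, w]"] by simp
  have one: "\<exists>S. cyclable A S \<and> S \<subseteq> V \<and> card S \<le> 4 \<and> x \<in> S \<and> y \<in> S"
    if x: "x \<in> V" "y \<in> V" "x \<noteq> y" "(x, y) \<in> A" "(y, x) \<notin> A" for x y
  proof -
    obtain z where "z \<in> V" "z \<noteq> x" "z \<noteq> y" "(y, z) \<in> A" "(z, x) \<in> A"
      using woodall_common[OF W x(2,1) x(3)[symmetric] x(5) x(1)] by metis
    then show ?thesis using triangle_cyclable[of x y A z] x tri
      by (intro exI[of _ "{x, y, z}"]) auto
  qed
  consider "(a, b) \<in> A" "(b, a) \<notin> A" | "(b, a) \<in> A" "(a, b) \<notin> A" | 
     "(a, b) \<notin> A" "(b, a) \<notin> A" | "(a, b) \<in> A" "(b, a) \<in> A" by blast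
  then have "\<exists>S. cyclable A S \<and> S \<subseteq> V \<and> card S \<le> 4 \<and> a \<in> S \<and> b \<in> S"
  proof cases
    case 1
    then show ?thesis using one[of a b] ab by blast
  next
    case 2
    then show ?thesis using one[of b a] ab by blast
  next
    case 3
    obtain x where x: "x \<in> V" "x \<noteq> a" "x \<noteq> b" "(a, x) \<in> A" "(x, b) \<in> A"
      using woodall_common[OF W ab 3(1) ab(1)] by metis
    obtain y where y: "y \<in> V" "y \<noteq> a" "y \<noteq> b" "y \<noteq> x" "(b, y) \<in> A" "(y, a) \<in> A"
      using woodall_common[OF W ab(2,1) ab(3)[symmetric] 3(2) x(1)] by metis
    have "cyclable A {a, x, b, y}" by (rule square_cyclable) (use x y ab in auto)
    then show ?thesis using x y ab sq by (intro exI[of _ "{a, x, b, y}"]) auto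
  next
    case 4
    have "2 \<le> od A V b" using woodall_outdegree_ge_2[OF W n ab(2)] .
    then have "\<not> {w \<in> V. (b, w) \<in> A} \<subseteq> {a}" using card_mono[of "{a}" "{w \<in> V. (b, w) \<in> A}"] by (auto simp: od_def)
    then obtain p where p: "p \<in> V" "(b, p) \<in> A" "p \<noteq> a" by blast
    have pb: "p \<noteq> b" using p fin by auto
    show ?thesis
    proof (cases "(p, a) \<in> A")
      case True
      then have "cyclable A {a, b, p}" using triangle_cyclable[of a b A p] 4 p pb ab by auto
      then show ?thesis using tri[of a b p] p ab by blast
    next
      case False
      obtain z where z: "z \<in> V" "z \<noteq> p" "z \<noteq> a" "z \<noteq> b" "(p, z) \<in> A" "(z, a) \<in> A"
        using woodall_common[OF W p(1) ab(1) p(3) False ab(2)] by metis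
      have "cyclable A {a, b, p, z}" by (rule square_cyclable) (use z p pb 4 ab in auto)
      then show ?thesis using z p ab sq[of a b p z] by blast
    qed
  qed
  then show thesis using that by blast
qed

lemma rigid_pair_square:
  assumes W: "woodall A V" and r: "rigid_pair A V r r'" and c: "c \<in> V" "c \<noteq> r" "c \<noteq> r'"
  obtains S where "cyclable A S" "S \<subseteq> V" "card S = 4" "r \<in> S" "r' \<in> S" "c \<in> S"
proof -
  have rr: "r \<in> V" "r' \<in> V" "r \<noteq> r'" "(r, r') \<in> A" "(r', r) \<in> A" using r by (auto simp: rigid_pair_def)
  have rc: "(c, r) \<in> A \<longleftrightarrow> (r, c) \<notin> A" "(c, r') \<in> A \<longleftrightarrow> (c, r) \<in> A" "(r', c) \<in> A \<longleftrightarrow> (r, c) \<in> A"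
    using r c by (auto simp: rigid_pair_def)
  show thesis
  proof (cases "(r, c) \<in> A")
    case True
    then obtain z where z: "z \<in> V" "z \<noteq> c" "z \<noteq> r" "z \<noteq> r'" "(c, z) \<in> A" "(z, r) \<in> A"
      using woodall_common[OF W c(1) rr(1) c(2) _ rr(2)] rc by metis
    have "cyclable A {r, r', c, z}" by (rule square_cyclable) (use z rr rc True c in auto)
    then show thesis by (rule that) (use z rr c in auto)
  next
    case False
    then obtain z where z: "z \<in> V" "z \<noteq> r'" "z \<noteq> c" "z \<noteq> r" "(r', z) \<in> A" "(z, c) \<in> A"
      using woodall_common[OF W rr(2) c(1) c(3)[symmetric] _ rr(1)] rc by metis
    have "cyclable A {r, r', z, c}" by (rule square_cyclable) (use z rr rc False c in auto)
    then show thesis by (rule that) (use z rr c in auto)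
  qed
qed

text \<open>Consider the vertex two steps after \<open>r\<close>: an arc from it to \<open>r\<close>
  closes a triangle, an arc from \<open>r\<close> bypasses one vertex. Four vertices ensure that
  \<open>W\<close> is nonempty in both cases.\<close>

lemma chord_at_universal_vertex:
  assumes c: "cyclable A S" "4 \<le> card S" "r \<in> S" "\<And>v. v \<in> S \<Longrightarrow> v \<noteq> r \<Longrightarrow> (v, r) \<in> A \<or> (r, v) \<in> A"
  obtains Z W where "cyc A (Z @ W)" "set (Z @ W) = S" "3 \<le> length Z" "(last Z, hd Z) \<in> A" "W \<noteq> []"
proof -
  obtain c0 where "cyc A c0" "set c0 = S" using c(1) by (auto simp: cyclable_def)
  then obtain c' where c': "cyc A (r # c')" "set (r # c') = S" using cyc_hdE c(3) by metis
  have "length (r # c') = card S" using cyc_card[OF c'(1)] c'(2) by simp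
  then have "3 \<le> length c'" using c(2) by simp
  then obtain x y z d where d: "c' = x # y # z # d" by (cases c'; cases "tl c'"; cases "tl (tl c')") auto
  have y: "y \<in> S" "y \<noteq> r" using c' d cyc_distinct[OF c'(1)] by auto
  show thesis
  proof (cases "(y, r) \<in> A")
    case True
    show thesis by (rule that[of "[r, x, y]" "z # d"]) (use c' d True in auto)
  next
    case False
    then have ry: "(r, y) \<in> A" using c(4) y by blast
    have "cyc A ([y, z] @ d @ [r, x])" using cyc_rotate[of A "[r, x]" "[y, z] @ d"] c'(1) d by simp
    then have 1: "cyc A ((y # z # d @ [r]) @ [x])" by simp
    show thesis by (rule that[OF 1]) (use c' d ry in auto)
  qed
qed

text \<open>A cycle with a chord that sends to all rigid vertices outside the cycles is traded together with a
  cycle receiving from them: the chord splits off a cycle, and the remaining path, a Hamiltonian path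
  of those rigid vertices, and the receiving cycle are concatenated.\<close>
lemma (in extremal) absorb_rigid:
  assumes r: "r \<in> H" "rigid_pair A V r r1" and S: "S0 \<inter> BB = {}"
    and q: "q \<in> S0" "rigid_pair A V q q1" and c4: "4 \<le> card S0"
  shows "\<exists>F'. fam A V k F' \<and> V - \<Union>F' = {h \<in> H. \<forall>x. \<not> rigid_pair A V h x}"
proof -
  define R where "R = {h \<in> H. \<exists>x. rigid_pair A V h x}"
  have S0F: "S0 \<subseteq> \<Union>F" using S0 by blast
  obtain Z Y where ZY: "cyc A (Z @ Y)" "set (Z @ Y) = S0" "3 \<le> length Z" "(last Z, hd Z) \<in> A" "Y \<noteq> []"
    using chord_at_universal_vertex[OF memF(4)[OF S0] c4 q(1)] rigid_pair_adjacent[OF q(2)] memF(1)[OF S0] by blast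
  have hY: "hd Y \<in> S0" "last Y \<in> S0" using ZY(2,5) by auto
  then have hY': "hd Y \<in> \<Union>F" "hd Y \<notin> BB" using S S0F by blast+
  obtain b where b: "b \<in> BB" "(b, hd Y) \<in> A" using in_from_BB[OF hY'] by blast
  then obtain T where T: "T \<in> F" "b \<in> T" using att_sub by blast
  have TS: "S0 \<noteq> T" using T(2) b(1) S by blast
  have HU: "x \<notin> H" if "x \<in> \<Union>F" for x using that UH(2) by blast
  have to: "(v, h) \<in> A" if "v \<in> S0" "h \<in> R" for v h
  proof -
    have v: "v \<in> \<Union>F" "v \<notin> BB" using that(1) S0F S by blast+
    have h: "h \<in> H" using that by (simp add: R_def)
    then have "(h, v) \<notin> A" using v by (auto simp: attached_def)
    moreover have "v \<noteq> h" "v \<in> V" using v(1) h HU UV by blast+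
    ultimately show ?thesis using that(2) rigid_pair_adjacent[of A V h _ v] by (auto simp: R_def)
  qed
  obtain h0 where h0: "h0 \<in> H" "(h0, b) \<in> A" using b(1) by (auto simp: attached_def)
  \<comment> \<open>The rigid vertex \<open>r\<close> is adjacent to everything, so all of
    \<open>T\<close> lies in \<open>AA\<close> or \<open>BB\<close>; a sending vertex would shrink
    \<open>T\<close> to \<open>{b}\<close> by \<open>att_bad\<close>.\<close>
  have TA: "v \<notin> AA" if v: "v \<in> T" for v
  proof
    assume vA: "v \<in> AA"
    have TF: "T \<subseteq> \<Union>F" using T(1) by blast
    have "x \<in> {b}" if x: "x \<in> T" for x
    proof -
      have x': "x \<in> \<Union>F" using x TF by blast
      have "x \<noteq> r" "x \<in> V" using HU[OF x'] r(1) UV x' by auto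
      then have "x \<in> AA \<or> x \<in> BB" using rigid_pair_adjacent[OF r(2)] r(1) x' by (auto simp: attached_def)
      moreover have "v = b" using att_bad[OF T(1)] vA v b(1) T(2) by blast
      ultimately show ?thesis using att_bad[OF T(1)] x vA v b(1) T(2) by blast
    qed
    then have "T \<subseteq> {b}" by blast
    then have "card T \<le> 1" using card_mono[of "{b}" T] by simp
    then show False using cyclable_card[OF memF(4)[OF T(1)]] by simp
  qed
  have frm: "(h, v) \<in> A" if "v \<in> T" "h \<in> R" for v h
  proof -
    have v: "v \<in> \<Union>F" using that(1) T(1) by blast
    have h: "h \<in> H" using that by (simp add: R_def)
    then have "(v, h) \<notin> A" using v TA[OF that(1)] by (auto simp: attached_def)
    moreover have "v \<noteq> h" "v \<in> V" using v h HU UV by blast+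
    ultimately show ?thesis using that(2) rigid_pair_adjacent[of A V h _ v] by (auto simp: R_def)
  qed
  have "\<exists>Q. pth A Q \<and> set Q = R"
  proof (rule semicomplete_path)
    show "finite R" "R \<noteq> {}" using finH r by (auto simp: R_def)
    fix x y assume "x \<in> R" "y \<in> R" "x \<noteq> y"
    then show "(x, y) \<in> A \<or> (y, x) \<in> A" using rigid_pair_adjacent[of A V y _ x] HV by (auto simp: R_def)
  qed
  then obtain Q where Q: "pth A Q" "set Q = R" by blast
  have Qne: "Q \<noteq> []" using Q(1) by (simp add: pth_def)
  obtain t0 where "cyc A t0" "set t0 = T" using memF(4)[OF T(1)] by (auto simp: cyclable_def)
  then obtain t where t: "cyc A (t @ [b])" "set (t @ [b]) = T" using cyc_lastE T(2) by metis
  let ?t = "t @ [b]"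
  have pt: "pth A ?t" using t(1) by (simp add: cyc_def)
  have RH: "R \<subseteq> H" by (auto simp: R_def)
  have sub: "set Z \<subseteq> S0" "set Y \<subseteq> S0" "set Z \<union> set Y = S0" using ZY(2) by auto
  have ST: "S0 \<inter> T = {}" using memF(5)[OF S0 T(1) TS] .
  have dQ: "S0 \<inter> R = {}" "T \<inter> R = {}" using memF(3)[OF S0] memF(3)[OF T(1)] RH by blast+
  have "last Q \<in> R" "hd Q \<in> R" "hd ?t \<in> T" using Q Qne t(2) hd_in_set[of ?t] by auto
  then have "pth A (Q @ ?t)" using pth_append[of Q ?t A] Qne Q pt frm t(2) dQ(2) by blast
  moreover have "set Y \<inter> set (Q @ ?t) = {}" 
    using sub(2) dQ(1) ST unfolding set_append[of Q] Q(2) t(2) by blast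
  moreover have "(last Y, hd (Q @ ?t)) \<in> A" using to hY(2) \<open>hd Q \<in> R\<close> Qne by simp
  moreover have "(last (Q @ ?t), hd Y) \<in> A" using b(2) by simp
  moreover have "3 \<le> length Y + length (Q @ ?t)" using t(1) by (simp add: cyc_def)
  moreover have "pth A Y" using cyc_pthD2[OF ZY(1,5)] .
  ultimately have "cyc A (Y @ (Q @ ?t))" using cyc_path_close by blast
  then have cG: "cyclable A (set Y \<union> R \<union> T)" using cyclableI[of A "Y @ Q @ ?t"] Q(2) t(2)
    by (metis set_append sup_assoc)
  have "pth A Z" using cyc_pthD[OF ZY(1)] ZY(3) by force
  then have cZ: "cyclable A (set Z)" using ZY(3,4) by (intro cyclableI) (simp add: cyc_def)
  have v: "set Z \<subseteq> V" "set Y \<union> R \<union> T \<subseteq> V"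
    using sub memF(1)[OF S0] memF(1)[OF T(1)] RH HV by blast+
  have "set Z \<inter> set Y = {}" using cyc_distinct[OF ZY(1)] by simp
  then have d1: "set Z \<inter> (set Y \<union> R \<union> T) = {}" using sub(1) dQ(1) ST by blast
  have "R \<inter> \<Union>F = {}" using RH UH(2) by blast
  then have d2: "(set Z \<union> (set Y \<union> R \<union> T)) \<inter> (\<Union>F - S0 - T) = {}" using sub(1,2) by blast
  note n = fam_replace2[OF fam S0 T(1) TS cZ v(1) cG v(2) d1 d2]
  have TF: "T \<subseteq> \<Union>F" using T(1) by blast
  have "\<Union>F - S0 - T \<union> set Z \<union> (set Y \<union> R \<union> T) = \<Union>F \<union> R" using sub(3) S0F TF by blast
  then have "\<Union>(insert (set Z) (insert (set Y \<union> R \<union> T) (F - {S0, T}))) = \<Union>F \<union> R" unfolding n(2) .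
  moreover have "V - (\<Union>F \<union> R) = H - R" using H_def by blast
  moreover have "H - R = {h \<in> H. \<forall>x. \<not> rigid_pair A V h x}" by (auto simp: R_def)
  ultimately show ?thesis using n(1) by metis
qed

section \<open>Choice of the initial family\<close>

text \<open>An uncovered vertex of low degree sends to \<open>a\<close> and receives from
  \<open>b\<close>, which puts both on \<open>S0\<close>, against \<open>bad\<close>. An uncovered
  rigid \<open>r\<close> is adjacent to everything, so \<open>S0\<close> contains \<open>Gm\<close>
  and is one-sided; a missing arc at \<open>a\<close> or \<open>b\<close> then makes the degree of
  \<open>r\<close> tie with theirs. The alternative \<open>rigid\<close> either excludes ties or
  supplies a rigid vertex on \<open>S0\<close> for \<open>absorb_rigid\<close>.\<close>

lemma ex_good_family:
  assumes W: "woodall A V" and n: "12 * k + 3 \<le> card V" and k: "2 \<le> k"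
    and a: "a \<in> Gm" "\<And>v. v \<in> V \<Longrightarrow> od (A\<inverse>) V a \<le> od (A\<inverse>) V v"
    and b: "b \<in> Gm" "a \<noteq> b" "\<And>v. v \<in> V \<Longrightarrow> v \<noteq> a \<Longrightarrow> od A V b \<le> od A V v"
    and Gm: "cyclable A Gm" "Gm \<subseteq> V" "card Gm \<le> 4"
    and rigid: "card Gm = 4 \<and> (\<exists>q\<in>Gm. \<exists>q1. rigid_pair A V q q1) \<or>
      (\<forall>r r'. rigid_pair A V r r' \<longrightarrow> od (A\<inverse>) V r \<noteq> od (A\<inverse>) V a) \<and>
      (\<forall>r r'. rigid_pair A V r r' \<longrightarrow> r \<noteq> a \<longrightarrow> od A V r \<noteq> od A V b)"
  shows "\<exists>F. fam A V k F \<and> (\<forall>v\<in>V - \<Union>F. good A V v)"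
proof -
  define nb where "nb = (\<lambda>H. {x. \<exists>h\<in>H. (x, h) \<in> A \<or> (h, x) \<in> A})"
  define R where "R = (\<lambda>F. fam A V k F \<and> Gm \<subseteq> \<Union>F \<and> (\<exists>S\<in>F. Gm \<inter> nb (V - \<Union>F) \<subseteq> S))"
  have fV: "finite V" and lf: "\<And>v. (v, v) \<notin> A" using W by (auto simp: woodall_def)
  obtain j where j: "k = Suc j" using k by (cases k) auto
  obtain G where G: "fam A (V - Gm) j G" using ex_packing[OF W Gm(2,3), of j] n j by auto
  have "fam A V j G" using G by (auto simp: fam_def)
  moreover have "\<Union>G \<inter> \<Union>{Gm} = {}" using G by (auto simp: fam_def)
  ultimately have "fam A V (j + Suc 0) (G \<union> {Gm})" by (rule fam_Un[OF _ fam_single[OF Gm(1,2)]])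
  then have "fam A V k (G \<union> {Gm})" using j by simp
  then have "R (G \<union> {Gm})" by (auto simp: R_def)
  then obtain F where F: "R F" "\<And>F'. R F' \<Longrightarrow> \<not> V - \<Union>F' \<subset> V - \<Union>F"
    using ex_least_uncovered[OF fV, of R] by metis
  define H where "H = V - \<Union>F"
  have fam: "fam A V k F" and GF: "Gm \<subseteq> \<Union>F" using F(1) by (auto simp: R_def)
  obtain S0 where S0: "S0 \<in> F" "Gm \<inter> nb H \<subseteq> S0" using F(1) by (auto simp: R_def H_def)
  show ?thesis
  proof (cases "H = {}")
    case True
    then show ?thesis using fam unfolding H_def by blast
  next
    case False
    interpret E: extremal A V k F H S0
    proof
      fix F' S' assume F': "fam A V k F'" "V - \<Union>F' \<subset> H" "S' \<in> F'"
        "S0 \<inter> {x. \<exists>h\<in>H. (x, h) \<in> A \<or> (h, x) \<in> A} \<subseteq> S'"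
      have "Gm \<subseteq> \<Union>F'" using F'(2) GF Gm(2) unfolding H_def by blast
      moreover have "nb (V - \<Union>F') \<subseteq> nb H" using F'(2) unfolding nb_def by blast
      moreover have "S0 \<inter> nb H \<subseteq> S'" using F'(4) unfolding nb_def .
      ultimately have "R F'" using F'(1,3) S0(2) unfolding R_def by blast
      then show False using F(2) F'(2) unfolding H_def by blast
    qed (fact W fam H_def False S0(1))+
    have GmH: "x \<notin> H" if "x \<in> Gm" for x using that GF E.UH(2) by blast
    have aV: "a \<in> V" "b \<in> V" using a b Gm by auto
    have notlow: "card V \<le> od A V w + od (A\<inverse>) V w" if w: "w \<in> H" for w
    proof (rule ccontr)
      assume low: "\<not> ?thesis"
      have wV: "w \<in> V" using w by (simp add: H_def)
      have wab: "w \<noteq> a" "w \<noteq> b" using GmH a(1) b(1) w by auto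
      have "(w, a) \<in> A"
      proof (rule ccontr)
        assume "(w, a) \<notin> A"
        then show False using woodallD[OF W wV aV(1) wab(1)] a(2)[OF wV] low by linarith
      qed
      moreover have "(b, w) \<in> A"
      proof (rule ccontr)
        assume "(b, w) \<notin> A"
        then show False using woodallD[OF W aV(2) wV wab(2)[symmetric]] b(3)[OF wV wab(1)] low by linarith
      qed
      moreover have "a \<in> S0" "b \<in> S0" using S0(2) a(1) b(1) w calculation unfolding nb_def by blast+
      ultimately have "b = a" using E.bad[OF S0(1), of b w a w] w by blast
      then show False using b(2) by simp
    qed
    show ?thesis
    proof (cases "\<exists>r\<in>H. \<exists>r1. rigid_pair A V r r1")
      case False
      then show ?thesis using fam notlow unfolding good_def H_def by blast
    next
      case True
      then obtain r r1 where r: "r \<in> H" "rigid_pair A V r r1" by blast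
      have S0F: "S0 \<subseteq> \<Union>F" using S0(1) by blast
      have adj: "(v, r) \<in> A \<or> (r, v) \<in> A" if v: "v \<in> \<Union>F" for v
        using rigid_pair_adjacent[OF r(2)] v E.UV E.UH(2) r(1) by blast
      have GS: "Gm \<subseteq> S0" using S0(2) GF adj r(1) unfolding nb_def by blast
      have rV: "r \<in> V" "r \<noteq> a" "r \<noteq> b" using r(1) GmH a(1) b(1) by (auto simp: H_def)
      have side: "S0 \<inter> E.BB = {} \<or> S0 \<inter> E.AA = {}"
      proof (rule ccontr)
        assume "\<not> ?thesis"
        then obtain x y where xy: "x \<in> S0" "x \<in> E.BB" "y \<in> S0" "y \<in> E.AA" by blast
        have "z \<in> E.AA \<or> z \<in> E.BB" if "z \<in> S0" for z
        proof -
          have "z \<in> \<Union>F" using that S0F by blast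
          then show ?thesis using adj r(1) by (auto simp: attached_def)
        qed
        then have "S0 \<subseteq> {x}" using E.att_bad[OF S0(1)] xy by blast
        then have "card S0 \<le> 1" using card_mono[of "{x}" S0] by simp
        then show False using cyclable_card[OF E.memF(4)[OF S0(1)]] by simp
      qed
      have deg: "od A V r + od (A\<inverse>) V r = card V" using rigid_pair_degree[OF r(2) fV lf] .
      have "card Gm = 4 \<and> (\<exists>q\<in>Gm. \<exists>q1. rigid_pair A V q q1)"
      proof (rule ccontr)
        assume "\<not> ?thesis"
        then have no: "od (A\<inverse>) V r \<noteq> od (A\<inverse>) V a" "od A V r \<noteq> od A V b"
          using rigid r(2) rV(2) by blast+
        have aF: "a \<in> \<Union>F" "b \<in> \<Union>F" using GF a(1) b(1) by auto
        have abS: "a \<in> S0" "b \<in> S0" using GS a(1) b(1) by auto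
        from side show False
        proof
          assume "S0 \<inter> E.BB = {}"
          then have "a \<notin> E.BB" using abS by blast
          then have "(r, a) \<notin> A" using aF(1) r(1) by (auto simp: attached_def)
          then show False using woodallD[OF W rV(1) aV(1) rV(2)] a(2)[OF rV(1)] deg no(1) by linarith
        next
          assume "S0 \<inter> E.AA = {}"
          then have "b \<notin> E.AA" using abS by blast
          then have "(b, r) \<notin> A" using aF(2) r(1) by (auto simp: attached_def)
          then show False using woodallD[OF W aV(2) rV(1) rV(3)[symmetric]] b(3)[OF rV(1,2)] deg no(2) by linarith
        qed
      qed
      then obtain q q1 where q: "q \<in> S0" "rigid_pair A V q q1" "card Gm = 4" using GS by blast
      have c4: "4 \<le> card S0" using q(3) card_mono[OF E.memF(2)[OF S0(1)] GS] by simp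
      have "\<exists>F'. fam A V k F' \<and> V - \<Union>F' = {h \<in> H. \<forall>x. \<not> rigid_pair A V h x}"
        using side
      proof
        assume "S0 \<inter> E.BB = {}"
        then show ?thesis using E.absorb_rigid[OF r _ q(1,2) c4] by blast
      next
        assume s: "S0 \<inter> E.AA = {}"
        interpret C: extremal "A\<inverse>" V k F H S0 by (rule E.converse)
        show ?thesis using C.absorb_rigid[OF r(1) _ _ q(1) _ c4] r(2) q(2) s by simp
      qed
      then show ?thesis using notlow unfolding good_def by blast
    qed
  qed
qed

section \<open>The spanning family\<close>

lemma ex_arg_min_on:
  fixes f :: "'a \<Rightarrow> nat"
  assumes "finite X" "X \<noteq> {}"
  obtains x where "x \<in> X" "\<And>y. y \<in> X \<Longrightarrow> f x \<le> f y"
proof -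
  have "Min (f ` X) \<in> f ` X" using assms by (intro Min_in) auto
  then obtain x where "x \<in> X" "f x = Min (f ` X)" by auto
  then show thesis using that[of x] assms(1) by simp
qed

text \<open>Ties are resolved by choice: a rigid vertex attaining the least in-degree becomes
  \<open>a\<close>, failing that one attaining the least out-degree among the remaining vertices
  becomes \<open>b\<close>, and it is put on a four-cycle with the other of the two. With no such
  tie any short cycle through both serves.\<close>

theorem spanning_family:
  assumes W: "woodall A V" and n: "12 * k + 3 \<le> card V" and k: "1 \<le> k"
  shows "\<exists>F. fam A V k F \<and> \<Union>F = V"
proof (cases "k = 1")
  case True
  then have "fam A V k {V}" using woodall_hamiltonian[OF W] n by (simp add: fam_def)
  then show ?thesis by (intro exI[of _ "{V}"]) simp
next
  case False
  then have k2: "2 \<le> k" using k by simp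
  have fV: "finite V" and lf: "\<And>v. (v, v) \<notin> A" using W by (auto simp: woodall_def)
  have c3: "3 \<le> card V" using n k by linarith
  have other: "\<exists>c\<in>V. c \<noteq> x \<and> c \<noteq> y" for x y
  proof -
    have "\<not> V \<subseteq> {x, y}" using card_mono[of "{x, y}" V] c3 card_length[of "[x, y]"] by auto
    then show ?thesis by blast
  qed
  have Vne: "V \<noteq> {}" using c3 by auto
  have from_good: ?thesis if "\<exists>F. fam A V k F \<and> (\<forall>v\<in>V - \<Union>F. good A V v)"
    using that good_spanning[OF W n k] by blast
  have square: "\<exists>S. cyclable A S \<and> S \<subseteq> V \<and> card S = 4 \<and> r \<in> S \<and> c \<in> S"
    if r: "rigid_pair A V r r'" and c: "c \<in> V" for r r' c
  proof (cases "c = r \<or> c = r'")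
    case True
    obtain d where "d \<in> V" "d \<noteq> r" "d \<noteq> r'" using other by blast
    then show ?thesis using rigid_pair_square[OF W r] True by metis
  next
    case False
    then show ?thesis using rigid_pair_square[OF W r c] by metis
  qed
  obtain a0 where a0: "a0 \<in> V" "\<And>v. v \<in> V \<Longrightarrow> od (A\<inverse>) V a0 \<le> od (A\<inverse>) V v"
    using ex_arg_min_on[OF fV Vne] by metis
  have second: "\<exists>b\<in>V - {a}. \<forall>v\<in>V - {a}. od A V b \<le> od A V v" for a
  proof -
    have "V - {a} \<noteq> {}" using other[of a a] by blast
    then show ?thesis using ex_arg_min_on[of "V - {a}" "od A V"] fV by (metis finite_Diff)
  qed
  show ?thesis
  proof (cases "\<exists>r r'. rigid_pair A V r r' \<and> od (A\<inverse>) V r = od (A\<inverse>) V a0")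
    case True
    then obtain r r' where r: "rigid_pair A V r r'" "od (A\<inverse>) V r = od (A\<inverse>) V a0" by blast
    obtain b where b: "b \<in> V" "b \<noteq> r" "\<And>v. v \<in> V \<Longrightarrow> v \<noteq> r \<Longrightarrow> od A V b \<le> od A V v"
      using second[of r] by blast
    obtain S where S: "cyclable A S" "S \<subseteq> V" "card S = 4" "r \<in> S" "b \<in> S"
      using square[OF r(1) b(1)] by blast
    show ?thesis
      by (rule from_good, rule ex_good_family[OF W n k2, of r S b]) (use S r b a0 in auto)
  next
    case no1: False
    obtain b0 where b0: "b0 \<in> V" "b0 \<noteq> a0" "\<And>v. v \<in> V \<Longrightarrow> v \<noteq> a0 \<Longrightarrow> od A V b0 \<le> od A V v"
      using second[of a0] by blast
    show ?thesis
    proof (cases "\<exists>r r'. rigid_pair A V r r' \<and> r \<noteq> a0 \<and> od A V r = od A V b0")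
      case True
      then obtain r r' where r: "rigid_pair A V r r'" "r \<noteq> a0" "od A V r = od A V b0" by blast
      obtain S where S: "cyclable A S" "S \<subseteq> V" "card S = 4" "r \<in> S" "a0 \<in> S"
        using square[OF r(1) a0(1)] by blast
      show ?thesis
        by (rule from_good, rule ex_good_family[OF W n k2, of a0 S r]) (use S r b0 a0 in auto)
    next
      case no2: False
      obtain S where S: "cyclable A S" "S \<subseteq> V" "card S \<le> 4" "a0 \<in> S" "b0 \<in> S"
        using short_cycle_through_two[OF W c3 a0(1) b0(1) b0(2)[symmetric]] by metis
      show ?thesis
        by (rule from_good, rule ex_good_family[OF W n k2, of a0 S b0]) (use S no1 no2 b0 a0 in auto)
    qed
  qed
qed

lemma cyc_dcycle:
  assumes "cyc A c"
  shows "dcycle A c"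
  unfolding dcycle_def
proof (intro conjI allI impI)
  fix i assume i: "i < length c"
  have c: "successively (\<lambda>x y. (x, y) \<in> A) c" "(last c, hd c) \<in> A" "c \<noteq> []"
    using assms by (auto simp: cyc_def pth_def)
  show "(c ! i, c ! ((i + 1) mod length c)) \<in> A"
  proof (cases "i + 1 < length c")
    case True
    then show ?thesis using c(1) by (simp add: successively_conv_nth)
  next
    case False
    then have "i + 1 = length c" using i by simp
    then show ?thesis using c(2,3) by (metis add_diff_cancel_right' hd_conv_nth last_conv_nth mod_self)
  qed
qed (use assms in \<open>auto simp: cyc_def pth_def\<close>)

theorem theorem1:
  fixes V :: "'a set" and A :: "('a \<times> 'a) set" and k n :: nat
  assumes "digraph V A"
    and "k \<ge> 1"
    and "card V = n"
    and "n \<ge> 12 * k + 3"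
    and "\<forall>u \<in> V. \<forall>v \<in> V. u \<noteq> v \<and> (u, v) \<notin> A \<longrightarrow> out_deg A u + in_deg A v \<ge> n"
  shows "\<exists>Cs. dir_2factor V A Cs \<and> length Cs = k \<and> (\<forall>c \<in> set Cs. length c \<ge> 3)"
proof -
  have AV: "A \<subseteq> V \<times> V" using assms(1) by (simp add: digraph_def)
  have "out_deg A u = od A V u" "in_deg A u = od (A\<inverse>) V u" for u
    unfolding out_deg_def in_deg_def od_def using AV by (auto intro!: arg_cong[where f=card])
  then have "woodall A V" using assms(1,3,5) by (auto simp: woodall_def digraph_def)
  moreover have "12 * k + 3 \<le> card V" using assms(3,4) by simp
  ultimately obtain F where F: "fam A V k F" "\<Union>F = V"
    using spanning_family[OF _ _ assms(2)] by metis
  have "finite F" using F(1) by (simp add: fam_def)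
  then obtain Ss where Ss: "set Ss = F" "distinct Ss" using finite_distinct_list by metis
  define C where "C = (\<lambda>S. SOME c. cyc A c \<and> set c = S)"
  have C: "cyc A (C S) \<and> set (C S) = S" if "S \<in> F" for S
  proof -
    have "\<exists>c. cyc A c \<and> set c = S" using F(1) that by (auto simp: fam_def cyclable_def)
    then show ?thesis unfolding C_def by (rule someI_ex)
  qed
  have "set (map C Ss ! i) \<inter> set (map C Ss ! j) = {}" if "i < length Ss" "j < length Ss" "i \<noteq> j" for i j
  proof -
    have "Ss ! i \<in> F" "Ss ! j \<in> F" "Ss ! i \<noteq> Ss ! j" using that Ss nth_eq_iff_index_eq by auto
    moreover from this have "Ss ! i \<inter> Ss ! j = {}"
      using F(1) unfolding fam_def pairwise_def disjnt_def by blast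
    ultimately show ?thesis using C that by simp
  qed
  moreover have "(\<Union>c\<in>set (map C Ss). set c) = V" using C F(2) Ss(1) by simp
  moreover have dc: "\<forall>c\<in>set (map C Ss). dcycle A c" using C Ss(1) cyc_dcycle by auto
  ultimately have "dir_2factor V A (map C Ss)"
    unfolding dir_2factor_def length_map using dc by blast
  moreover have "length (map C Ss) = k" using F(1) Ss distinct_card[OF Ss(2)] by (simp add: fam_def)
  moreover have "\<forall>c\<in>set (map C Ss). 3 \<le> length c" using C Ss(1) by (auto simp: cyc_def)
  ultimately show ?thesis by blast
qed

end
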